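(* Let $E$ be a locally complete lcHs over $\mathbb{K}$, let the linear subspace $G\subset E'$ determine boundedness, and let $\mathcal{F}(\Omega)$ and $\mathcal{F}(\Omega,E)$ resp. $\ell(\mathbb{N})$ and $\ell(\mathbb{N},E)$ be $\varepsilon$-into-compatible with $e'\circ g\in\ell(\mathbb{N})$ for all $e'\in E'$ and $g\in\ell(\mathbb{N},E)$. Let $(f_{n})_{n\in\mathbb{N}}$ be an equicontinuous Schauder basis of $\mathcal{F}(\Omega)$ with associated coefficient functionals $(T^{\mathbb{K}}_{n})_{n\in\mathbb{N}}$ such that \[ T^{\mathbb{K}}\colon\mathcal{F}(\Omega)\to\ell(\mathbb{N}),\;T^{\mathbb{K}}(f):=(T^{\mathbb{K}}_{n}(f))_{n\in\mathbb{N}}, \] is an isomorphism and let there be $T^{E}\colon\mathcal{F}(\Omega,E)\to E^{\mathbb{N}}$ such that $(T^{E},T^{\mathbb{K}})$ is a strong, consistent family for $(\mathcal{F},E)$. If (i) $\mathcal{F}(\Omega)$ is a Fréchet–Schwartz space, or (ii) $E$ is sequentially complete, $G=E'$ and $\mathcal{F}(\Omega)$ is a semi-Montel BC-space, then the following holds: a) $\mathcal{F}_{G}(\mathbb{N},E)=\ell(\mathbb{N},E)$. b) $\ell(\mathbb{N})$ and $\ell(\mathbb{N},E)$ are $\varepsilon$-compatible, in particular, $\ell(\mathbb{N})\varepsilon E\cong\ell(\mathbb{N},E)$. c) The map \[ T^{E}\colon\mathcal{F}(\Omega,E)\to\ell(\mathbb{N},E),\;T^{E}(f):=(T^{E}_{n}(f))_{n\in\mathbb{N}},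 \] is a well-defined isomorphism, $\mathcal{F}(\Omega)$ and $\mathcal{F}(\Omega,E)$ are $\varepsilon$-compatible, in particular, $\mathcal{F}(\Omega)\varepsilon E\cong\mathcal{F}(\Omega,E)$, and $T^{E}=S_{\ell(\mathbb{N})}\circ(T^{\mathbb{K}}\varepsilon\operatorname{id}_{E})\circ S_{\mathcal{F}(\Omega)}^{-1}$.
   Context: $\mathbb{K}=\mathbb{R}$ or $\mathbb{C}$. An lcHs is a non-trivial locally convex Hausdorff space over $\mathbb{K}$. Isomorphisms are linear and topological. $E$ is locally complete if for every closed bounded absolutely convex $D\subset E$ the space $E_D:=\bigcup_n nD$, normed by the gauge of $D$, is a Banach space. $G\subset E'$ determines boundedness if every $\sigma(E,G)$-bounded subset of $E$ is bounded in $E$. For an lcHs $F$, $F'_{\kappa}$ is $F'$ with the topology of uniform convergence on absolutely convex compact subsets of $F$; $F\varepsilon E:=L_{e}(F'_{\kappa},E)$ carries the topology of uniform convergence on equicontinuous subsets of $F'$; for $T\in L(F_1,F_2)$, $(T\varepsilon\operatorname{id}_E)(u):=u\circ T^{t}$, $T^{t}(y')=y'\circ T$. A BC-space is an lcHs $F$ such that every linear map with closed graph from a Banach space into $F$ is continuous. Semi-Montel: every bounded set is relatively compact. For a non-empty set $\Omega$, $\mathcal{F}(\Omega)\subset\mathbb{K}^{\Omega}$ and $\mathcal{F}(\Omega,E)\subset E^{\Omega}$ are lcHs with $\delta_x\in\mathcal{F}(\Omega)'$, $\delta_x(f):=f(x)$, for all $x\in\Omega$; they are $\varepsilon$-into-compatible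 (resp. $\varepsilon$-compatible) if $S_{\mathcal{F}(\Omega)}\colon\mathcal{F}(\Omega)\varepsilon E\to\mathcal{F}(\Omega,E)$, $u\mapsto[x\mapsto u(\delta_x)]$, is a well-defined isomorphism onto its range (resp. an isomorphism). Likewise $\ell(\mathbb{N})\subset\mathbb{K}^{\mathbb{N}}$, $\ell(\mathbb{N},E)\subset E^{\mathbb{N}}$ are lcHs of sequences (the case $\Omega=\mathbb{N}$); $\ell(\mathbb{N})$ is an arbitrary such space, not $\ell^{1}$. $(f_n)$ is a Schauder basis of $\mathcal{F}(\Omega)$ if every $f$ has a unique expansion $f=\sum_nT^{\mathbb{K}}_n(f)f_n$ converging in $\mathcal{F}(\Omega)$ and the coefficient functionals $T^{\mathbb{K}}_n$ are continuous; it is equicontinuous if the operators $f\mapsto\sum_{n=1}^{k}T^{\mathbb{K}}_n(f)f_n$, $k\in\mathbb{N}$, are equicontinuous. $(T^{E},T^{\mathbb{K}})$, with $T^{E}=(T^{E}_n)_{n\in\mathbb{N}}$ linear, is consistent for $(\mathcal{F},E)$ if for all $u\in\mathcal{F}(\Omega)\varepsilon E$, $n\in\mathbb{N}$: $S_{\mathcal{F}(\Omega)}(u)\in\mathcal{F}(\Omega,E)$, $T^{\mathbb{K}}_n\in\mathcal{F}(\Omega)'$ and $T^{E}_n(S_{\mathcal{F}(\Omega)}(u))=u(T^{\mathbb{K}}_n)$; it is strong if for all $e'\in E'$, $f\in\mathcal{F}(\Omega,E)$, $n\in\mathbb{N}$: $e'\circ f\in\mathcal{F}(\Omega)$ and $T^{\mathbb{K}}_n(e'\circ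 f)=e'(T^{E}_n(f))$. $\mathcal{F}_{G}(\mathbb{N},E)$ is the space of all $f\colon\mathbb{N}\to E$ such that for every $e'\in G$ there is $f_{e'}\in\mathcal{F}(\Omega)$ with $T^{\mathbb{K}}_n(f_{e'})=e'(f(n))$ for all $n\in\mathbb{N}$. *)

theory Defs
  imports "HOL-Analysis.Analysis" "HOL-Library.Function_Algebras"
begin

text \<open>
  The scalar fields. The axioms say that the field is, as a normed field, a copy of the reals or of
  the complex numbers; both types are instances.
\<close>

class real_or_complex = real_normed_field +
  assumes real_or_complex:
    "(\<forall>x. \<exists>a. x = a *\<^sub>R 1) \<or>
     (\<exists>i. i * i = - 1 \<and> (\<forall>x. \<exists>a b. x = a *\<^sub>R 1 + b *\<^sub>R i) \<and>
          (\<forall>a b. norm (a *\<^sub>R 1 + b *\<^sub>R i) = sqrt (a\<^sup>2 + b\<^sup>2)))"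

instance real :: real_or_complex
  by standard simp

instance complex :: real_or_complex
proof
  have "\<exists>a b. x = a *\<^sub>R 1 + b *\<^sub>R \<i>" for x :: complex
    by (intro exI[of _ "Re x"] exI[of _ "Im x"]) (simp add: complex_eq_iff)
  then show "(\<forall>x::complex. \<exists>a. x = a *\<^sub>R 1) \<or>
     (\<exists>i::complex. i * i = - 1 \<and> (\<forall>x. \<exists>a b. x = a *\<^sub>R 1 + b *\<^sub>R i) \<and>
          (\<forall>a b. norm (a *\<^sub>R 1 + b *\<^sub>R i) = sqrt (a\<^sup>2 + b\<^sup>2)))"
    by (intro disjI2 exI[of _ \<i>]) (simp add: cmod_def)
qed

text \<open>
  A space is given by a topology \<open>X\<close> on an ambient vector space with scalar multiplication \<open>s\<close>;
  its carrier \<open>topspace X\<close> is a linear subspace. Spaces of functions live in a function type with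
  pointwise operations (addition comes from \<open>Function_Algebras\<close>, scalar multiplication is
  \<open>pw s\<close> below). Linear maps between carriers are functions that vanish outside the domain carrier,
  so that equality of maps is equality of functions and spaces of maps are again linear
  subspaces of a function type.
\<close>

definition pw :: "('k \<Rightarrow> 'b \<Rightarrow> 'b) \<Rightarrow> 'k \<Rightarrow> ('a \<Rightarrow> 'b) \<Rightarrow> 'a \<Rightarrow> 'b" where
  "pw s c f = (\<lambda>x. s c (f x))"

definition zero_nhd :: "'a::zero topology \<Rightarrow> 'a set \<Rightarrow> bool" where
  "zero_nhd X U \<longleftrightarrow> U \<subseteq> topspace X \<and> (\<exists>W. openin X W \<and> 0 \<in> W \<and> W \<subseteq> U)"

definition convex_in :: "('k::real_or_complex \<Rightarrow> 'a::ab_group_add \<Rightarrow> 'a) \<Rightarrow> 'a set \<Rightarrow> bool" where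
  "convex_in s C \<longleftrightarrow>
    (\<forall>x\<in>C. \<forall>y\<in>C. \<forall>t::real. 0 \<le> t \<longrightarrow> t \<le> 1 \<longrightarrow> s (of_real t) x + s (of_real (1 - t)) y \<in> C)"

definition absolutely_convex :: "('k::real_or_complex \<Rightarrow> 'a::ab_group_add \<Rightarrow> 'a) \<Rightarrow> 'a set \<Rightarrow> bool" where
  "absolutely_convex s D \<longleftrightarrow>
    D \<noteq> {} \<and> (\<forall>x\<in>D. \<forall>y\<in>D. \<forall>a b. norm a + norm b \<le> 1 \<longrightarrow> s a x + s b y \<in> D)"

definition lcHs :: "('k::real_or_complex \<Rightarrow> 'a::ab_group_add \<Rightarrow> 'a) \<Rightarrow> 'a topology \<Rightarrow> bool" where
  "lcHs s X \<longleftrightarrow>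
    vector_space s \<and> module.subspace s (topspace X) \<and> topspace X \<noteq> {0} \<and>
    Hausdorff_space X \<and>
    continuous_map (prod_topology X X) X (\<lambda>(x, y). x + y) \<and>
    continuous_map (prod_topology euclidean X) X (\<lambda>(c, x). s c x) \<and>
    (\<forall>U. zero_nhd X U \<longrightarrow> (\<exists>C. zero_nhd X C \<and> convex_in s C \<and> C \<subseteq> U))"

text \<open>Boundedness in the sense of von Neumann.\<close>

definition bounded_in :: "('k::real_or_complex \<Rightarrow> 'a::ab_group_add \<Rightarrow> 'a) \<Rightarrow> 'a topology \<Rightarrow> 'a set \<Rightarrow> bool" where
  "bounded_in s X B \<longleftrightarrow>
    B \<subseteq> topspace X \<and> (\<forall>U. zero_nhd X U \<longrightarrow> (\<exists>r>0. B \<subseteq> s (of_real r) ` U))"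

definition linear_map_on ::
  "('k \<Rightarrow> 'a::ab_group_add \<Rightarrow> 'a) \<Rightarrow> ('k \<Rightarrow> 'b::ab_group_add \<Rightarrow> 'b) \<Rightarrow> 'a set \<Rightarrow> ('a \<Rightarrow> 'b) \<Rightarrow> bool" where
  "linear_map_on s1 s2 V f \<longleftrightarrow>
    (\<forall>x\<in>V. \<forall>y\<in>V. f (x + y) = f x + f y) \<and> (\<forall>c. \<forall>x\<in>V. f (s1 c x) = s2 c (f x))"

definition cont_lin ::
  "('k \<Rightarrow> 'a::ab_group_add \<Rightarrow> 'a) \<Rightarrow> 'a topology \<Rightarrow> ('k \<Rightarrow> 'b::ab_group_add \<Rightarrow> 'b) \<Rightarrow> 'b topology \<Rightarrow> ('a \<Rightarrow> 'b) set" where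
  "cont_lin s1 X s2 Y =
    {f. linear_map_on s1 s2 (topspace X) f \<and> continuous_map X Y f \<and> (\<forall>x. x \<notin> topspace X \<longrightarrow> f x = 0)}"

definition dual :: "('k::real_or_complex \<Rightarrow> 'a::ab_group_add \<Rightarrow> 'a) \<Rightarrow> 'a topology \<Rightarrow> ('a \<Rightarrow> 'k) set" where
  "dual s X = cont_lin s X (*) euclidean"

definition tvs_iso ::
  "('k \<Rightarrow> 'a::ab_group_add \<Rightarrow> 'a) \<Rightarrow> 'a topology \<Rightarrow> ('k \<Rightarrow> 'b::ab_group_add \<Rightarrow> 'b) \<Rightarrow> 'b topology \<Rightarrow> ('a \<Rightarrow> 'b) \<Rightarrow> bool" where
  "tvs_iso s1 X s2 Y f \<longleftrightarrow> linear_map_on s1 s2 (topspace X) f \<and> homeomorphic_map X Y f"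

definition tvs_iso_into ::
  "('k \<Rightarrow> 'a::ab_group_add \<Rightarrow> 'a) \<Rightarrow> 'a topology \<Rightarrow> ('k \<Rightarrow> 'b::ab_group_add \<Rightarrow> 'b) \<Rightarrow> 'b topology \<Rightarrow> ('a \<Rightarrow> 'b) \<Rightarrow> bool" where
  "tvs_iso_into s1 X s2 Y f \<longleftrightarrow>
    linear_map_on s1 s2 (topspace X) f \<and> f ` topspace X \<subseteq> topspace Y \<and> embedding_map X Y f"

definition tvs_isomorphic ::
  "('k \<Rightarrow> 'a::ab_group_add \<Rightarrow> 'a) \<Rightarrow> 'a topology \<Rightarrow> ('k \<Rightarrow> 'b::ab_group_add \<Rightarrow> 'b) \<Rightarrow> 'b topology \<Rightarrow> bool" where
  "tvs_isomorphic s1 X s2 Y \<longleftrightarrow> (\<exists>f. tvs_iso s1 X s2 Y f)"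

text \<open>For families of linear maps it suffices to ask for equicontinuity at \<open>0\<close>.\<close>

definition equicontinuous :: "'a::ab_group_add topology \<Rightarrow> 'b::ab_group_add topology \<Rightarrow> ('a \<Rightarrow> 'b) set \<Rightarrow> bool" where
  "equicontinuous X Y H \<longleftrightarrow>
    (\<forall>U. zero_nhd Y U \<longrightarrow> (\<exists>V. zero_nhd X V \<and> (\<forall>h\<in>H. h ` V \<subseteq> U)))"


subsection \<open>Topologies given by uniform convergence, weak topologies\<close>

definition unif_open ::
  "('a \<Rightarrow> 'b::ab_group_add) set \<Rightarrow> 'a set set \<Rightarrow> 'b topology \<Rightarrow> ('a \<Rightarrow> 'b) set \<Rightarrow> bool" where
  "unif_open L \<S> Y W \<longleftrightarrow>
    W \<subseteq> L \<and>
    (\<forall>u\<in>W. \<exists>\<Q> U. finite \<Q> \<and> \<Q> \<subseteq> \<S> \<and> zero_nhd Y U \<and>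
       {v \<in> L. \<forall>M\<in>\<Q>. \<forall>x\<in>M. v x - u x \<in> U} \<subseteq> W)"

text \<open>The topology on \<open>L\<close> of uniform convergence on the members of \<open>\<S>\<close>.\<close>

definition unif_topology ::
  "('a \<Rightarrow> 'b::ab_group_add) set \<Rightarrow> 'a set set \<Rightarrow> 'b topology \<Rightarrow> ('a \<Rightarrow> 'b) topology" where
  "unif_topology L \<S> Y = topology (unif_open L \<S> Y)"

lemma zero_nhd_Int: "zero_nhd X U \<Longrightarrow> zero_nhd X V \<Longrightarrow> zero_nhd X (U \<inter> V)"
  unfolding zero_nhd_def by (metis IntI Int_mono le_infI1 openin_Int)

lemma openin_unif_topology: "openin (unif_topology L \<S> Y) = unif_open L \<S> Y"
proof -
  let ?N = "\<lambda>u \<Q> U. {v \<in> L. \<forall>M\<in>\<Q>. \<forall>x\<in>M. v x - u x \<in> U}"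
  have "unif_open L \<S> Y (A \<inter> B)" if A: "unif_open L \<S> Y A" and B: "unif_open L \<S> Y B" for A B
    unfolding unif_open_def
  proof (intro conjI ballI)
    show "A \<inter> B \<subseteq> L"
      using A by (auto simp: unif_open_def)
    fix u assume u: "u \<in> A \<inter> B"
    from A u obtain P U where P: "finite P" "P \<subseteq> \<S>" "zero_nhd Y U" "?N u P U \<subseteq> A"
      unfolding unif_open_def by (meson IntD1)
    from B u obtain Q V where Q: "finite Q" "Q \<subseteq> \<S>" "zero_nhd Y V" "?N u Q V \<subseteq> B"
      unfolding unif_open_def by (meson IntD2)
    have "?N u (P \<union> Q) (U \<inter> V) \<subseteq> ?N u P U" "?N u (P \<union> Q) (U \<inter> V) \<subseteq> ?N u Q V"
      by auto
    then have "?N u (P \<union> Q) (U \<inter> V) \<subseteq> A \<inter> B"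
      using P(4) Q(4) by (meson Int_greatest order_trans)
    moreover have "finite (P \<union> Q)" "P \<union> Q \<subseteq> \<S>"
      using P Q by simp_all
    ultimately show "\<exists>\<Q> U. finite \<Q> \<and> \<Q> \<subseteq> \<S> \<and> zero_nhd Y U \<and> ?N u \<Q> U \<subseteq> A \<inter> B"
      using zero_nhd_Int[OF P(3) Q(3)] by (intro exI conjI)
  qed
  moreover have "unif_open L \<S> Y (\<Union>\<K>)" if K: "\<forall>A\<in>\<K>. unif_open L \<S> Y A" for \<K>
    unfolding unif_open_def
  proof (intro conjI ballI)
    show "\<Union>\<K> \<subseteq> L"
      using K by (simp add: unif_open_def Sup_le_iff)
    fix u assume "u \<in> \<Union>\<K>"
    then obtain A where A: "A \<in> \<K>" "u \<in> A" by (rule UnionE)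
    with K have "unif_open L \<S> Y A" by simp
    with A obtain P U where "finite P" "P \<subseteq> \<S>" "zero_nhd Y U" "?N u P U \<subseteq> A"
      unfolding unif_open_def by meson
    moreover from this have "?N u P U \<subseteq> \<Union>\<K>"
      using A(1) by (meson Union_upper order_trans)
    ultimately show "\<exists>\<Q> U. finite \<Q> \<and> \<Q> \<subseteq> \<S> \<and> zero_nhd Y U \<and> ?N u \<Q> U \<subseteq> \<Union>\<K>"
      by (intro exI conjI)
  qed
  ultimately have "istopology (unif_open L \<S> Y)"
    unfolding istopology_def by simp
  then show ?thesis
    by (simp add: unif_topology_def)
qed

lemma topspace_unif_topology:
  assumes "0 \<in> topspace Y"
  shows "topspace (unif_topology L \<S> Y) = L"
proof
  show "topspace (unif_topology L \<S> Y) \<subseteq> L"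
    using openin_topspace[of "unif_topology L \<S> Y"]
    unfolding openin_unif_topology unif_open_def by (rule conjunct1)
  have "zero_nhd Y (topspace Y)"
    using assms unfolding zero_nhd_def by (meson openin_topspace order_refl)
  then have "unif_open L \<S> Y L"
    unfolding unif_open_def
    by (auto intro!: exI[of _ "{}"] exI[of _ "topspace Y"])
  then show "L \<subseteq> topspace (unif_topology L \<S> Y)"
    by (simp add: openin_subset openin_unif_topology)
qed

text \<open>The weak topology \<open>\<sigma>(X, G)\<close>: the coarsest one making all members of \<open>G\<close> continuous.\<close>

definition weak_topology :: "'a topology \<Rightarrow> ('a \<Rightarrow> 'k::topological_space) set \<Rightarrow> 'a topology" where
  "weak_topology X G =
    topology_generated_by (insert (topspace X) {{x \<in> topspace X. \<phi> x \<in> U} |\<phi> U. \<phi> \<in> G \<and> open U})"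

definition determines_boundedness ::
  "('k::real_or_complex \<Rightarrow> 'a::ab_group_add \<Rightarrow> 'a) \<Rightarrow> 'a topology \<Rightarrow> ('a \<Rightarrow> 'k) set \<Rightarrow> bool" where
  "determines_boundedness s X G \<longleftrightarrow>
    (\<forall>B. bounded_in s (weak_topology X G) B \<longrightarrow> bounded_in s X B)"

text \<open>The space \<open>X'\<^sub>\<kappa>\<close>.\<close>

definition dual_kappa :: "('k::real_or_complex \<Rightarrow> 'a::ab_group_add \<Rightarrow> 'a) \<Rightarrow> 'a topology \<Rightarrow> ('a \<Rightarrow> 'k) topology" where
  "dual_kappa s X = unif_topology (dual s X) {K. absolutely_convex s K \<and> compactin X K} euclidean"

text \<open>The space \<open>X \<epsilon> Y = L\<^sub>e(X'\<^sub>\<kappa>, Y)\<close>; its scalar multiplication is \<open>pw\<close> of that of \<open>Y\<close>.\<close>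

definition eps_product ::
  "('k::real_or_complex \<Rightarrow> 'a::ab_group_add \<Rightarrow> 'a) \<Rightarrow> 'a topology \<Rightarrow>
   ('k \<Rightarrow> 'b::ab_group_add \<Rightarrow> 'b) \<Rightarrow> 'b topology \<Rightarrow> (('a \<Rightarrow> 'k) \<Rightarrow> 'b) topology" where
  "eps_product s1 X s2 Y =
    unif_topology (cont_lin (pw (*)) (dual_kappa s1 X) s2 Y)
      {H. H \<subseteq> dual s1 X \<and> equicontinuous X euclidean H} Y"

text \<open>The map \<open>T \<epsilon> id\<close> for \<open>T : X1 \<rightarrow> X2\<close>; \<open>transposed\<close> is \<open>T\<^sup>t : X2' \<rightarrow> X1'\<close>.\<close>

definition transposed :: "'a topology \<Rightarrow> ('a \<Rightarrow> 'b) \<Rightarrow> ('b \<Rightarrow> 'k::zero) \<Rightarrow> 'a \<Rightarrow> 'k" where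
  "transposed X1 T y' = (\<lambda>x. if x \<in> topspace X1 then y' (T x) else 0)"

definition eps_id ::
  "'a topology \<Rightarrow> ('k::real_or_complex \<Rightarrow> 'b::ab_group_add \<Rightarrow> 'b) \<Rightarrow> 'b topology \<Rightarrow> ('a \<Rightarrow> 'b) \<Rightarrow>
   (('a \<Rightarrow> 'k) \<Rightarrow> 'e::zero) \<Rightarrow> ('b \<Rightarrow> 'k) \<Rightarrow> 'e" where
  "eps_id X1 s2 X2 T u = (\<lambda>y'. if y' \<in> dual s2 X2 then u (transposed X1 T y') else 0)"


subsection \<open>Completeness, Banach spaces, classes of spaces\<close>

definition seq_complete :: "'a::ab_group_add topology \<Rightarrow> bool" where
  "seq_complete X \<longleftrightarrow>
    (\<forall>\<sigma>::nat \<Rightarrow> 'a. range \<sigma> \<subseteq> topspace X \<and>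
       (\<forall>U. zero_nhd X U \<longrightarrow> (\<exists>N. \<forall>m\<ge>N. \<forall>n\<ge>N. \<sigma> m - \<sigma> n \<in> U)) \<longrightarrow>
       (\<exists>x. limitin X \<sigma> x sequentially))"

text \<open>
  The metric of a norm on a subspace \<open>V\<close>; \<open>Metric_space\<close> needs a distance that is nonnegative
  and symmetric also outside of \<open>V\<close>.
\<close>

definition norm_dist :: "'a::ab_group_add set \<Rightarrow> ('a \<Rightarrow> real) \<Rightarrow> 'a \<Rightarrow> 'a \<Rightarrow> real" where
  "norm_dist V p x y = (if x \<in> V \<and> y \<in> V then p (x - y) else 0)"

definition normed_on :: "('k::real_or_complex \<Rightarrow> 'a::ab_group_add \<Rightarrow> 'a) \<Rightarrow> 'a set \<Rightarrow> ('a \<Rightarrow> real) \<Rightarrow> bool" where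
  "normed_on s V p \<longleftrightarrow>
    vector_space s \<and> module.subspace s V \<and>
    (\<forall>x\<in>V. 0 \<le> p x \<and> (p x = 0 \<longleftrightarrow> x = 0)) \<and>
    (\<forall>x\<in>V. \<forall>y\<in>V. p (x + y) \<le> p x + p y) \<and>
    (\<forall>c. \<forall>x\<in>V. p (s c x) = norm c * p x)"

definition norm_topology :: "'a::ab_group_add set \<Rightarrow> ('a \<Rightarrow> real) \<Rightarrow> 'a topology" where
  "norm_topology V p = Metric_space.mtopology V (norm_dist V p)"

definition banach_on :: "('k::real_or_complex \<Rightarrow> 'a::ab_group_add \<Rightarrow> 'a) \<Rightarrow> 'a set \<Rightarrow> ('a \<Rightarrow> real) \<Rightarrow> bool" where
  "banach_on s V p \<longleftrightarrow> normed_on s V p \<and> Metric_space.mcomplete V (norm_dist V p)"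

definition gauge_of :: "('k::real_or_complex \<Rightarrow> 'a::ab_group_add \<Rightarrow> 'a) \<Rightarrow> 'a set \<Rightarrow> 'a \<Rightarrow> real" where
  "gauge_of s D x = Inf {t. 0 < t \<and> x \<in> s (of_real t) ` D}"

definition locally_complete :: "('k::real_or_complex \<Rightarrow> 'a::ab_group_add \<Rightarrow> 'a) \<Rightarrow> 'a topology \<Rightarrow> bool" where
  "locally_complete s X \<longleftrightarrow>
    (\<forall>D. closedin X D \<and> bounded_in s X D \<and> absolutely_convex s D \<longrightarrow>
       banach_on s (\<Union>n::nat. s (of_nat n) ` D) (gauge_of s D))"

text \<open>Topology induced by a complete translation invariant metric.\<close>

definition frechet_space :: "('k::real_or_complex \<Rightarrow> 'a::ab_group_add \<Rightarrow> 'a) \<Rightarrow> 'a topology \<Rightarrow> bool" where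
  "frechet_space s X \<longleftrightarrow>
    lcHs s X \<and>
    (\<exists>d. Metric_space (topspace X) d \<and> Metric_space.mtopology (topspace X) d = X \<and>
         Metric_space.mcomplete (topspace X) d \<and>
         (\<forall>x\<in>topspace X. \<forall>y\<in>topspace X. \<forall>z\<in>topspace X. d (x + z) (y + z) = d x y))"

definition schwartz_space :: "('k::real_or_complex \<Rightarrow> 'a::ab_group_add \<Rightarrow> 'a) \<Rightarrow> 'a topology \<Rightarrow> bool" where
  "schwartz_space s X \<longleftrightarrow>
    lcHs s X \<and>
    (\<forall>U. zero_nhd X U \<and> absolutely_convex s U \<longrightarrow>
       (\<exists>V. zero_nhd X V \<and>
          (\<forall>\<epsilon>>0. \<exists>A. finite A \<and> A \<subseteq> V \<and> V \<subseteq> (\<Union>a\<in>A. (\<lambda>x. a + s (of_real \<epsilon>) x) ` U))))"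

definition semi_montel :: "('k::real_or_complex \<Rightarrow> 'a::ab_group_add \<Rightarrow> 'a) \<Rightarrow> 'a topology \<Rightarrow> bool" where
  "semi_montel s X \<longleftrightarrow> lcHs s X \<and> (\<forall>B. bounded_in s X B \<longrightarrow> compactin X (X closure_of B))"

text \<open>
  HOL cannot quantify over the types that carry Banach spaces. The definition uses the Banach
  spaces (with arbitrary norm) whose underlying vector space is a subspace of that of \<open>X\<close>.
  The lemma \<open>BC_space_closed_graph\<close> shows that this
  yields the closed graph property for Banach spaces over every type.
\<close>

definition BC_space :: "('k::real_or_complex \<Rightarrow> 'a::ab_group_add \<Rightarrow> 'a) \<Rightarrow> 'a topology \<Rightarrow> bool" where
  "BC_space s X \<longleftrightarrow>
    lcHs s X \<and>
    (\<forall>V p T. banach_on s V p \<and> linear_map_on s s V T \<and> T ` V \<subseteq> topspace X \<and>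
       closedin (prod_topology (norm_topology V p) X) ((\<lambda>x. (x, T x)) ` V) \<longrightarrow>
       continuous_map (norm_topology V p) X T)"

lemma normed_onD:
  assumes "normed_on s V p"
  shows "module s" and "0 \<in> V"
    and "\<And>x y. x \<in> V \<Longrightarrow> y \<in> V \<Longrightarrow> x + y \<in> V"
    and "\<And>x y. x \<in> V \<Longrightarrow> y \<in> V \<Longrightarrow> x - y \<in> V"
    and "\<And>c x. x \<in> V \<Longrightarrow> s c x \<in> V"
    and "\<And>x. x \<in> V \<Longrightarrow> 0 \<le> p x"
    and "\<And>x. x \<in> V \<Longrightarrow> p x = 0 \<longleftrightarrow> x = 0"
    and "\<And>x y. x \<in> V \<Longrightarrow> y \<in> V \<Longrightarrow> p (x + y) \<le> p x + p y"
    and "\<And>c x. x \<in> V \<Longrightarrow> p (s c x) = norm c * p x"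
    and "\<And>x y. x \<in> V \<Longrightarrow> y \<in> V \<Longrightarrow> p (x - y) = p (y - x)"
proof -
  have "vector_space s" and sub: "module.subspace s V"
    using assms by (auto simp: normed_on_def)
  then interpret vector_space s by simp
  show "module s" by unfold_locales
  show "0 \<in> V" "\<And>x y. x \<in> V \<Longrightarrow> y \<in> V \<Longrightarrow> x + y \<in> V"
    and diff: "\<And>x y. x \<in> V \<Longrightarrow> y \<in> V \<Longrightarrow> x - y \<in> V"
    and "\<And>c x. x \<in> V \<Longrightarrow> s c x \<in> V"
    using sub by (auto simp: subspace_0 subspace_add subspace_diff subspace_scale)
  show "\<And>x. x \<in> V \<Longrightarrow> 0 \<le> p x" "\<And>x. x \<in> V \<Longrightarrow> p x = 0 \<longleftrightarrow> x = 0"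
    "\<And>x y. x \<in> V \<Longrightarrow> y \<in> V \<Longrightarrow> p (x + y) \<le> p x + p y"
    and sc: "\<And>c x. x \<in> V \<Longrightarrow> p (s c x) = norm c * p x"
    using assms by (auto simp: normed_on_def)
  fix x y assume "x \<in> V" "y \<in> V"
  then show "p (x - y) = p (y - x)"
    using sc[of "y - x" "- 1"] diff by simp
qed

lemma Metric_space_norm_dist:
  assumes "normed_on s V p"
  shows "Metric_space V (norm_dist V p)"
proof
  note D = normed_onD[OF assms]
  show "0 \<le> norm_dist V p x y" for x y
    by (simp add: norm_dist_def D)
  show "norm_dist V p x y = norm_dist V p y x" for x y
    by (simp add: norm_dist_def D(10))
  show "(norm_dist V p x y = 0) = (x = y)" if "x \<in> V" "y \<in> V" for x y
    using that by (simp add: norm_dist_def D(4,7))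
  show "norm_dist V p x z \<le> norm_dist V p x y + norm_dist V p y z"
    if "x \<in> V" "y \<in> V" "z \<in> V" for x y z
    using that D(8)[of "x - y" "y - z"] by (simp add: norm_dist_def D(4))
qed

lemma BC_space_closed_graph:
  fixes s :: "'k::real_or_complex \<Rightarrow> 'a::ab_group_add \<Rightarrow> 'a"
    and s' :: "'k \<Rightarrow> 'b::ab_group_add \<Rightarrow> 'b"
  assumes BC: "BC_space s X" and ban: "banach_on s' V p"
    and lin: "linear_map_on s' s V T" and TV: "T ` V \<subseteq> topspace X"
    and clo: "closedin (prod_topology (norm_topology V p) X) ((\<lambda>x. (x, T x)) ` V)"
  shows "continuous_map (norm_topology V p) X T"
proof -
  have nrm: "normed_on s' V p"
    using ban by (simp add: banach_on_def)
  note D = normed_onD[OF nrm]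
  have vs: "vector_space s"
    using BC by (simp add: BC_space_def lcHs_def)
  interpret s: vector_space s by (rule vs)
  interpret P: Metric_space V "norm_dist V p"
    by (rule Metric_space_norm_dist[OF nrm])
  have Tadd: "T (x + y) = T x + T y" if "x \<in> V" "y \<in> V" for x y
    using lin that by (simp add: linear_map_on_def)
  have Tsc: "T (s' c x) = s c (T x)" if "x \<in> V" for c x
    using lin that by (simp add: linear_map_on_def)
  have T0: "T 0 = 0"
    using Tadd[OF D(2) D(2)] by simp
  have Tdiff: "T (x - y) = T x - T y" if "x \<in> V" "y \<in> V" for x y
    using Tadd[of "x - y" y] that D(4) by (simp add: algebra_simps)

  have key: "\<exists>r>0. \<exists>U. openin X U \<and> w \<in> U \<and> (\<forall>v\<in>V. p (v - y) < r \<longrightarrow> T v \<notin> U)"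
    if y: "y \<in> V" and w: "w \<in> topspace X" "T y \<noteq> w" for y w
  proof -
    let ?C = "topspace (prod_topology P.mtopology X) - (\<lambda>x. (x, T x)) ` V"
    have "openin (prod_topology P.mtopology X) ?C"
      using clo by (simp add: closedin_def norm_topology_def)
    moreover have "(y, w) \<in> ?C"
      using y w by auto
    ultimately obtain A U where AU: "openin P.mtopology A" "openin X U" "y \<in> A" "w \<in> U"
      "A \<times> U \<subseteq> ?C"
      unfolding openin_prod_topology_alt by metis
    then obtain r where r: "r > 0" "P.mball y r \<subseteq> A"
      unfolding P.openin_mtopology by metis
    have "T v \<notin> U" if "v \<in> V" "p (v - y) < r" for v
    proof
      assume "T v \<in> U"
      have "v \<in> P.mball y r"
        using that y D(10)[of v y] by (simp add: norm_dist_def)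
      with r \<open>T v \<in> U\<close> have "(v, T v) \<in> A \<times> U" by auto
      with AU(5) have "(v, T v) \<in> ?C" by (rule subsetD)
      with \<open>v \<in> V\<close> show False by simp
    qed
    with r AU(2,4) show ?thesis by metis
  qed

  define W where "W = T ` V"
  define m where "m z = Inf (p ` {y \<in> V. T y = z})" for z
  have lift: "\<exists>y\<in>V. T y = z \<and> p y < r" if "z \<in> W" "m z < r" for z r
  proof -
    have "p ` {y \<in> V. T y = z} \<noteq> {}"
      using that(1) by (auto simp: W_def)
    from cInf_lessD[OF this that(2)[unfolded m_def]] show ?thesis by auto
  qed
  have bdd: "bdd_below (p ` {y \<in> V. T y = z})" for z
    using D(6) by (intro bdd_belowI[of _ 0]) auto
  have upper: "m (T y) \<le> p y" if "y \<in> V" for y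
    unfolding m_def using that bdd by (intro cInf_lower) auto
  have m_nonneg: "0 \<le> m z" if "z \<in> W" for z
    unfolding m_def using that D(6) by (intro cInf_greatest) (auto simp: W_def)
  have subW: "s.subspace W"
    unfolding s.subspace_def W_def
  proof (intro conjI ballI allI)
    show "0 \<in> T ` V"
      using D(2) T0 by (metis imageI)
    show "x + y \<in> T ` V" if xy: "x \<in> T ` V" "y \<in> T ` V" for x y
    proof -
      from xy obtain a b where "a \<in> V" "b \<in> V" "x = T a" "y = T b" by blast
      then show ?thesis using Tadd D(3) by (metis imageI)
    qed
    show "s c x \<in> T ` V" if x: "x \<in> T ` V" for c x
    proof -
      from x obtain a where "a \<in> V" "x = T a" by blast
      then show ?thesis using Tsc D(5) by (metis imageI)
    qed
  qed
  have m0: "m 0 = 0"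
    using upper[OF D(2)] m_nonneg[of 0] D(7)[OF D(2)] T0 s.subspace_0[OF subW] by simp
  have m_eq0: "z = 0" if z: "z \<in> W" "m z = 0" for z
  proof (rule ccontr)
    assume "z \<noteq> 0"
    then have "T 0 \<noteq> z" by (simp add: T0)
    moreover have "z \<in> topspace X" using z TV by (auto simp: W_def)
    ultimately obtain r U where r: "r > 0" "openin X U" "z \<in> U"
      "\<forall>v\<in>V. p (v - 0) < r \<longrightarrow> T v \<notin> U"
      using key[OF D(2)] by metis
    obtain v where "v \<in> V" "T v = z" "p v < r"
      using lift[of z r] z r(1) by auto
    with r show False by auto
  qed
  have m_add: "m (x + y) \<le> m x + m y" if xy: "x \<in> W" "y \<in> W" for x y
  proof (rule field_le_epsilon)
    fix e :: real assume "e > 0"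
    then obtain a b where "a \<in> V" "T a = x" "p a < m x + e / 2" "b \<in> V" "T b = y" "p b < m y + e / 2"
      using lift[OF xy(1), of "m x + e / 2"] lift[OF xy(2), of "m y + e / 2"] by auto
    then show "m (x + y) \<le> m x + m y + e"
      using upper[of "a + b"] D(3)[of a b] D(8)[of a b] Tadd[of a b] by simp
  qed
  have m_sc_le: "m (s c x) \<le> norm c * m x" if x: "x \<in> W" and c: "c \<noteq> 0" for c x
  proof -
    have "m (s c x) / norm c \<le> m x"
      unfolding m_def[of x]
    proof (rule cInf_greatest)
      show "p ` {y \<in> V. T y = x} \<noteq> {}"
        using x by (auto simp: W_def)
      fix t assume "t \<in> p ` {y \<in> V. T y = x}"
      then obtain y where y: "y \<in> V" "T y = x" "t = p y" by auto
      have "m (s c x) \<le> norm c * p y"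
        using upper[OF D(5)[OF y(1)], of c] Tsc[OF y(1), of c] D(9)[OF y(1), of c] y(2) by simp
      with c y(3) show "m (s c x) / norm c \<le> t"
        by (simp add: divide_le_eq mult.commute)
    qed
    with c show ?thesis by (simp add: divide_le_eq mult.commute)
  qed
  have m_sc: "m (s c x) = norm c * m x" if x: "x \<in> W" for c x
  proof (cases "c = 0")
    case True
    then show ?thesis using m0 by simp
  next
    case False
    have "m x = m (s (inverse c) (s c x))"
      using False by simp
    also have "\<dots> \<le> norm (inverse c) * m (s c x)"
      using False x s.subspace_scale[OF subW] by (intro m_sc_le) auto
    finally have "m x \<le> m (s c x) / norm c"
      using False by (simp add: norm_inverse divide_inverse mult.commute)
    then have "norm c * m x \<le> m (s c x)"
      using False by (simp add: pos_le_divide_eq mult.commute)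
    with m_sc_le[OF x False] show ?thesis by simp
  qed
  have nrmW: "normed_on s W m"
    unfolding normed_on_def
    using vs subW m_nonneg m_eq0 m0 m_add m_sc by auto
  interpret Q: Metric_space W "norm_dist W m"
    by (rule Metric_space_norm_dist[OF nrmW])
  have dW: "x - y \<in> W" if "x \<in> W" "y \<in> W" for x y
    using that normed_onD(4)[OF nrmW] by simp

  have "Q.mcomplete"
    unfolding Q.mcomplete_def
  proof (intro allI impI)
    fix \<sigma> assume \<sigma>: "Q.MCauchy \<sigma>"
    then have \<sigma>W: "\<sigma> n \<in> W" for n
      by (auto simp: Q.MCauchy_def)
    have "\<forall>k. \<exists>N. \<forall>n n'. N \<le> n \<longrightarrow> N \<le> n' \<longrightarrow> norm_dist W m (\<sigma> n) (\<sigma> n') < (1/2) ^ k"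
      using \<sigma> unfolding Q.MCauchy_def by simp
    then obtain N where N:
      "\<And>k n n'. N k \<le> n \<Longrightarrow> N k \<le> n' \<Longrightarrow> norm_dist W m (\<sigma> n) (\<sigma> n') < (1/2) ^ k"
      by metis
    define r where "r k = k + Max (N ` {..k})" for k
    have "Max (N ` {..k}) \<le> Max (N ` {..Suc k})" for k
      by (rule Max_mono) auto
    then have "r k < r (Suc k)" for k
      by (simp add: r_def le_imp_less_Suc)
    then have r: "strict_mono r"
      by (simp add: strict_mono_Suc_iff)
    have rN: "N k \<le> r k" for k
      unfolding r_def by (rule trans_le_add2) simp
    have step: "m (\<sigma> (r (Suc k)) - \<sigma> (r k)) < (1/2) ^ k" for k
      using N[of k "r (Suc k)" "r k"] rN[of k] \<sigma>W strict_monoD[OF r, of k "Suc k"]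
      by (simp add: norm_dist_def)
    have "\<exists>d\<in>V. T d = \<sigma> (r (Suc k)) - \<sigma> (r k) \<and> p d < (1/2) ^ k" for k
      using lift[OF dW[OF \<sigma>W \<sigma>W] step] .
    then obtain d where d: "\<And>k. d k \<in> V" "\<And>k. T (d k) = \<sigma> (r (Suc k)) - \<sigma> (r k)"
      "\<And>k. p (d k) < (1/2) ^ k"
      by metis
    obtain y0 where y0: "y0 \<in> V" "T y0 = \<sigma> (r 0)"
      using \<sigma>W[of "r 0"] by (auto simp: W_def)
    define y where "y k = y0 + (\<Sum>i<k. d i)" for k
    have ySuc: "y (Suc k) = y k + d k" for k
      by (simp add: y_def add.assoc)
    have yV: "y k \<in> V" for k
      by (induction k) (use y0 d(1) D(3) in \<open>simp_all add: ySuc, simp add: y_def\<close>)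
    have Ty: "T (y k) = \<sigma> (r k)" for k
    proof (induction k)
      case 0
      then show ?case using y0 by (simp add: y_def)
    next
      case (Suc k)
      then show ?case using Tadd[OF yV d(1)] d(2) by (simp add: ySuc)
    qed
    have ydist: "p (y (n + j) - y n) \<le> 2 * (1/2) ^ n - 2 * (1/2) ^ (n + j)" for n j
    proof (induction j)
      case 0
      then show ?case using D(7)[OF D(2)] by simp
    next
      case (Suc j)
      have "p (y (n + Suc j) - y n) = p ((y (n + j) - y n) + d (n + j))"
        by (simp add: ySuc algebra_simps)
      also have "\<dots> \<le> p (y (n + j) - y n) + p (d (n + j))"
        by (intro D(8) D(4) yV d(1))
      also have "\<dots> \<le> 2 * (1/2) ^ n - 2 * (1/2) ^ (n + j) + (1/2) ^ (n + j)"
        using Suc d(3)[of "n + j"] by linarith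
      finally show ?case by simp
    qed
    have ydist': "p (y n' - y n) \<le> 2 * (1/2) ^ n" if "n \<le> n'" for n n'
    proof -
      have "p (y n' - y n) \<le> 2 * (1/2) ^ n - 2 * (1/2) ^ n'"
        using ydist[of n "n' - n"] that by simp
      also have "\<dots> \<le> 2 * (1/2) ^ n" by simp
      finally show ?thesis .
    qed
    have "P.MCauchy y"
      unfolding P.MCauchy_def
    proof (intro conjI allI impI)
      show "range y \<subseteq> V" using yV by auto
      fix e :: real assume "e > 0"
      then obtain M where M: "(1/2) ^ M < e / 2"
        using real_arch_pow_inv[of "e / 2" "1/2"] by auto
      have aux: "p (y n' - y n) < e" if "M \<le> n" "n \<le> n'" for n n'
      proof -
        have "(1/2) ^ n \<le> (1/2::real) ^ M" using that by (intro power_decreasing) auto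
        with M ydist'[OF that(2)] show ?thesis by linarith
      qed
      have "norm_dist V p (y n) (y n') < e" if "M \<le> n" "M \<le> n'" for n n'
        using aux[of n n'] aux[of n' n] that D(10)[OF yV yV, of n n'] yV
        by (cases "n \<le> n'") (auto simp: norm_dist_def)
      then show "\<exists>M. \<forall>n n'. M \<le> n \<longrightarrow> M \<le> n' \<longrightarrow> norm_dist V p (y n) (y n') < e"
        by blast
    qed
    then obtain z where z: "limitin P.mtopology y z sequentially"
      using ban unfolding banach_on_def P.mcomplete_def by blast
    then have zV: "z \<in> V"
      using limitin_topspace by fastforce
    have "limitin Q.mtopology (\<sigma> \<circ> r) (T z) sequentially"
      unfolding Q.limit_metric_sequentially
    proof (intro conjI allI impI)
      show "T z \<in> W" using zV by (simp add: W_def)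
      fix e :: real assume "e > 0"
      then obtain M where M: "\<And>n. n \<ge> M \<Longrightarrow> norm_dist V p (y n) z < e"
        using z unfolding P.limit_metric_sequentially by blast
      have "(\<sigma> \<circ> r) n \<in> W \<and> norm_dist W m ((\<sigma> \<circ> r) n) (T z) < e" if "n \<ge> M" for n
      proof -
        have "m (\<sigma> (r n) - T z) \<le> p (y n - z)"
          using upper[OF D(4)[OF yV zV]] Tdiff[OF yV zV] Ty by simp
        also have "\<dots> < e"
          using M[OF that] yV zV by (simp add: norm_dist_def)
        finally show ?thesis
          using \<sigma>W zV by (simp add: norm_dist_def W_def)
      qed
      then show "\<exists>M. \<forall>n\<ge>M. (\<sigma> \<circ> r) n \<in> W \<and> norm_dist W m ((\<sigma> \<circ> r) n) (T z) < e"
        by blast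
    qed
    from Q.MCauchy_convergent_subsequence[OF \<sigma> r this]
    show "\<exists>x. limitin Q.mtopology \<sigma> x sequentially" by blast
  qed
  then have banW: "banach_on s W m"
    using nrmW by (simp add: banach_on_def)

  have WX: "W \<subseteq> topspace X"
    using TV by (simp add: W_def)
  have "closedin (prod_topology Q.mtopology X) ((\<lambda>x. (x, x)) ` W)" (is "closedin _ ?G")
    unfolding closedin_def
  proof (intro conjI)
    show "?G \<subseteq> topspace (prod_topology Q.mtopology X)"
      using WX by auto
    show "openin (prod_topology Q.mtopology X) (topspace (prod_topology Q.mtopology X) - ?G)"
      unfolding openin_prod_topology_alt
    proof (intro allI impI)
      fix z w assume zw: "(z, w) \<in> topspace (prod_topology Q.mtopology X) - ?G"
      then have z: "z \<in> W" and w: "w \<in> topspace X" and ne: "z \<noteq> w" by auto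
      obtain y where y: "y \<in> V" "z = T y"
        using z by (auto simp: W_def)
      with ne have "T y \<noteq> w" by simp
      from key[OF y(1) w this] obtain r U where U: "r > 0" "openin X U" "w \<in> U"
        and far: "\<And>v. v \<in> V \<Longrightarrow> p (v - y) < r \<Longrightarrow> T v \<notin> U"
        by blast
      have "z' \<notin> U" if z': "z' \<in> Q.mball z r" for z'
      proof -
        have z'W: "z' \<in> W" and "m (z' - z) < r"
          using z' z normed_onD(10)[OF nrmW, of z z'] by (auto simp: norm_dist_def)
        then obtain v where v: "v \<in> V" "T v = z' - z" "p v < r"
          using lift[OF dW[OF z'W z]] by blast
        have "T (y + v) = z'"
          using Tadd[OF y(1) v(1)] y(2) v(2) by simp
        with far[OF D(3)[OF y(1) v(1)]] v(3) show ?thesis by simp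
      qed
      then have "Q.mball z r \<times> U \<subseteq> topspace (prod_topology Q.mtopology X) - ?G"
        using openin_subset[OF U(2)] by auto
      moreover have "openin Q.mtopology (Q.mball z r)" "z \<in> Q.mball z r"
        using z U(1) by auto
      ultimately show "\<exists>A U. openin Q.mtopology A \<and> openin X U \<and> z \<in> A \<and> w \<in> U \<and>
          A \<times> U \<subseteq> topspace (prod_topology Q.mtopology X) - ?G"
        using U(2,3) by blast
    qed
  qed
  moreover have "linear_map_on s s W (\<lambda>x. x)"
    by (simp add: linear_map_on_def)
  ultimately have id: "continuous_map Q.mtopology X (\<lambda>x. x)"
    using BC banW WX unfolding BC_space_def norm_topology_def by (metis image_ident)
  have "continuous_map P.mtopology Q.mtopology T"
    unfolding Q.continuous_map_to_metric
  proof (intro ballI allI impI)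
    fix y and e :: real assume y: "y \<in> topspace P.mtopology" and e: "e > 0"
    have "T v \<in> Q.mball (T y) e" if v: "v \<in> P.mball y e" for v
    proof -
      have "T y \<in> W" "T v \<in> W"
        using v by (auto simp: W_def)
      then show ?thesis
        using v upper[of "y - v"] Tdiff[of y v] D(4)[of y v] by (auto simp: norm_dist_def)
    qed
    then show "\<exists>U. openin P.mtopology U \<and> y \<in> U \<and> (\<forall>v\<in>U. T v \<in> Q.mball (T y) e)"
      using y e by (intro exI[of _ "P.mball y e"]) auto
  qed
  from continuous_map_compose[OF this id] show ?thesis
    by (simp add: norm_topology_def o_def)
qed

subsection \<open>Spaces of functions\<close>

definition delta :: "('x \<Rightarrow> 'k::zero) topology \<Rightarrow> 'x \<Rightarrow> ('x \<Rightarrow> 'k) \<Rightarrow> 'k" where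
  "delta F x = (\<lambda>f. if f \<in> topspace F then f x else 0)"

text \<open>
  \<open>F\<close> is \<open>\<F>(\<Omega>)\<close> and \<open>FE\<close> is \<open>\<F>(\<Omega>, E)\<close>, with \<open>\<Omega>\<close> the (non-empty) type \<open>'x\<close>.
\<close>

definition function_spaces ::
  "('k::real_or_complex \<Rightarrow> 'e::ab_group_add \<Rightarrow> 'e) \<Rightarrow> 'e topology \<Rightarrow> ('x \<Rightarrow> 'k) topology \<Rightarrow> ('x \<Rightarrow> 'e) topology \<Rightarrow> bool" where
  "function_spaces sE E F FE \<longleftrightarrow>
    lcHs (pw (*)) F \<and> lcHs (pw sE) FE \<and>
    (\<forall>f\<in>topspace FE. range f \<subseteq> topspace E) \<and>
    (\<forall>x. delta F x \<in> dual (pw (*)) F)"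

definition S_map :: "('x \<Rightarrow> 'k::zero) topology \<Rightarrow> ((('x \<Rightarrow> 'k) \<Rightarrow> 'k) \<Rightarrow> 'e) \<Rightarrow> 'x \<Rightarrow> 'e" where
  "S_map F u = (\<lambda>x. u (delta F x))"

definition eps_into_compatible ::
  "('k::real_or_complex \<Rightarrow> 'e::ab_group_add \<Rightarrow> 'e) \<Rightarrow> 'e topology \<Rightarrow> ('x \<Rightarrow> 'k) topology \<Rightarrow> ('x \<Rightarrow> 'e) topology \<Rightarrow> bool" where
  "eps_into_compatible sE E F FE \<longleftrightarrow>
    function_spaces sE E F FE \<and>
    tvs_iso_into (pw sE) (eps_product (pw (*)) F sE E) (pw sE) FE (S_map F)"

definition eps_compatible ::
  "('k::real_or_complex \<Rightarrow> 'e::ab_group_add \<Rightarrow> 'e) \<Rightarrow> 'e topology \<Rightarrow> ('x \<Rightarrow> 'k) topology \<Rightarrow> ('x \<Rightarrow> 'e) topology \<Rightarrow> bool" where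
  "eps_compatible sE E F FE \<longleftrightarrow>
    function_spaces sE E F FE \<and>
    tvs_iso (pw sE) (eps_product (pw (*)) F sE E) (pw sE) FE (S_map F)"

text \<open>
  \<open>b\<close> is the basis, \<open>T\<close> the sequence of coefficient functionals; the equivalence expresses
  existence and uniqueness of the expansion.
\<close>

definition schauder_basis ::
  "('k::real_or_complex \<Rightarrow> 'a::ab_group_add \<Rightarrow> 'a) \<Rightarrow> 'a topology \<Rightarrow> (nat \<Rightarrow> 'a) \<Rightarrow> (nat \<Rightarrow> 'a \<Rightarrow> 'k) \<Rightarrow> bool" where
  "schauder_basis s X b T \<longleftrightarrow>
    range b \<subseteq> topspace X \<and>
    (\<forall>f\<in>topspace X. \<forall>a.
       limitin X (\<lambda>k. \<Sum>n\<le>k. s (a n) (b n)) f sequentially \<longleftrightarrow> a = (\<lambda>n. T n f)) \<and>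
    (\<forall>n. T n \<in> dual s X)"

definition equicontinuous_schauder_basis ::
  "('k::real_or_complex \<Rightarrow> 'a::ab_group_add \<Rightarrow> 'a) \<Rightarrow> 'a topology \<Rightarrow> (nat \<Rightarrow> 'a) \<Rightarrow> (nat \<Rightarrow> 'a \<Rightarrow> 'k) \<Rightarrow> bool" where
  "equicontinuous_schauder_basis s X b T \<longleftrightarrow>
    schauder_basis s X b T \<and>
    equicontinuous X X (range (\<lambda>k f. \<Sum>n\<le>k. s (T n f) (b n)))"

definition consistent ::
  "('k::real_or_complex \<Rightarrow> 'e::ab_group_add \<Rightarrow> 'e) \<Rightarrow> 'e topology \<Rightarrow> ('x \<Rightarrow> 'k) topology \<Rightarrow> ('x \<Rightarrow> 'e) topology \<Rightarrow>
   (nat \<Rightarrow> ('x \<Rightarrow> 'e) \<Rightarrow> 'e) \<Rightarrow> (nat \<Rightarrow> ('x \<Rightarrow> 'k) \<Rightarrow> 'k) \<Rightarrow> bool" where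
  "consistent sE E F FE TE TK \<longleftrightarrow>
    (\<forall>n. linear_map_on (pw sE) sE (topspace FE) (TE n) \<and> TE n ` topspace FE \<subseteq> topspace E) \<and>
    (\<forall>u\<in>topspace (eps_product (pw (*)) F sE E). \<forall>n.
       S_map F u \<in> topspace FE \<and> TK n \<in> dual (pw (*)) F \<and> TE n (S_map F u) = u (TK n))"

definition strong ::
  "('k::real_or_complex \<Rightarrow> 'e::ab_group_add \<Rightarrow> 'e) \<Rightarrow> 'e topology \<Rightarrow> ('x \<Rightarrow> 'k) topology \<Rightarrow> ('x \<Rightarrow> 'e) topology \<Rightarrow>
   (nat \<Rightarrow> ('x \<Rightarrow> 'e) \<Rightarrow> 'e) \<Rightarrow> (nat \<Rightarrow> ('x \<Rightarrow> 'k) \<Rightarrow> 'k) \<Rightarrow> bool" where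
  "strong sE E F FE TE TK \<longleftrightarrow>
    (\<forall>e'\<in>dual sE E. \<forall>f\<in>topspace FE. \<forall>n. e' \<circ> f \<in> topspace F \<and> TK n (e' \<circ> f) = e' (TE n f))"

definition F_G ::
  "'e topology \<Rightarrow> ('x \<Rightarrow> 'k) topology \<Rightarrow> (nat \<Rightarrow> ('x \<Rightarrow> 'k) \<Rightarrow> 'k) \<Rightarrow> ('e \<Rightarrow> 'k) set \<Rightarrow> (nat \<Rightarrow> 'e) set" where
  "F_G E F TK G =
    {f. range f \<subseteq> topspace E \<and> (\<forall>e'\<in>G. \<exists>g\<in>topspace F. \<forall>n. TK n g = e' (f n))}"

end

theory Submission
  imports Defs
begin

text \<open>
  Everything reduces to an interpolation statement: for \<open>g \<in> \<F>\<^sub>G(\<nat>, E)\<close> there is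
  \<open>w \<in> \<F>(\<Omega>) \<epsilon> E\<close> with \<open>w(T\<^sub>n) = g(n)\<close> for all \<open>n\<close>. The candidate is
  \<open>w(y) = \<Sum>\<^sub>n y(f\<^sub>n) g(n)\<close>. With \<open>R(e')\<close> the element of \<open>\<F>(\<Omega>)\<close> whose coefficients are
  \<open>e'(g(n))\<close>, one has \<open>e'(w(y)) = y(R(e'))\<close>, so by Hahn-Banach \<open>w\<close> is continuous on the dual with the
  topology of uniform convergence on absolutely convex compact sets as soon as \<open>R\<close> maps polars of
  neighbourhoods to bounded, hence relatively compact, sets.

  In case (i) the partial sums over a polar in \<open>\<F>(\<Omega>)'\<close> are \<open>\<sigma>(E, G)\<close>-bounded, thus bounded, and the
  Schwartz property makes the series Cauchy in \<open>E\<^sub>D\<close> for a bounded \<open>D\<close>; the same estimate shows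
  that \<open>R(e')\<close> exists for all \<open>e' \<in> E'\<close>. In case (ii) \<open>R\<close> is bounded on polars by the closed graph
  property, and the expansion operators converge uniformly on compact sets.
\<close>

section \<open>Scalars, gauges and continuous seminorms\<close>

text \<open>Interpolation suffices because \<open>S_map l\<close>, composed with the map induced by
  \<open>TK\<close> on epsilon products, turns w into the sequence w(T_n). It is thus the middle
  inclusion of the cycle l(N,E) in F_G(N,E) in S_l(l(N) eps E) in l(N,E). Applied to the sequence
  T^E_n(h) it also yields w with S_F(w) = h, since e' o S_F(w) and e' o h have the same basis
  coefficients for every e' in E'. The obstacle is completeness of E. Under local completeness it
  does not suffice that the partial sums are Cauchy for every continuous seminorm: one bounded disc
  must control all differences. In case (i) the estimates are therefore inclusions into small
  multiples of a set of partial sums, and such sets are bounded because G determines boundedness. In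
  case (ii) seminorm estimates suffice, but nothing bounds R a priori; the closed graph property is
  applied to R on the Banach space of functionals dominated by a continuous seminorm p, whose unit
  ball is the polar of p.\<close>

lemma Cauchy_convergent_scalar:
  fixes z :: "nat \<Rightarrow> 'k::real_or_complex"
  assumes z: "Cauchy z"
  shows "convergent z"
  using real_or_complex[where 'a='k]
proof
  assume "\<forall>x::'k. \<exists>a. x = a *\<^sub>R 1"
  then obtain a where a: "\<And>x::'k. x = a x *\<^sub>R 1" by metis
  have "norm (x - y) = \<bar>a x - a y\<bar>" for x y :: 'k
    by (subst a[of x], subst a[of y], subst scaleR_left_diff_distrib[symmetric]) simp
  then have "Cauchy (\<lambda>n. a (z n))"
    using z by (simp add: Cauchy_def dist_norm)
  then obtain l where "(\<lambda>n. a (z n)) \<longlonglongrightarrow> l"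
    using real_Cauchy_convergent convergent_def by blast
  then have "(\<lambda>n. a (z n) *\<^sub>R (1::'k)) \<longlonglongrightarrow> l *\<^sub>R 1"
    by (intro tendsto_intros)
  then show ?thesis by (auto simp: convergent_def simp flip: a)
next
  assume "\<exists>i::'k. i * i = - 1 \<and> (\<forall>x. \<exists>a b. x = a *\<^sub>R 1 + b *\<^sub>R i) \<and>
          (\<forall>a b. norm (a *\<^sub>R 1 + b *\<^sub>R i) = sqrt (a\<^sup>2 + b\<^sup>2))"
  then obtain i :: 'k and a b where ab: "\<And>x. x = a x *\<^sub>R 1 + b x *\<^sub>R i"
    and nrm: "\<And>a b. norm (a *\<^sub>R 1 + b *\<^sub>R i) = sqrt (a\<^sup>2 + b\<^sup>2)"
    by metis
  have nd: "norm (x - y) = sqrt ((a x - a y)\<^sup>2 + (b x - b y)\<^sup>2)" for x y :: 'k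
  proof -
    \<comment> \<open>The norm formula is applied to the difference of the two chosen
      representations, so the coordinate functions \<open>a\<close> and \<open>b\<close> need not be
      known to be additive.\<close>
    have "x - y = (a x - a y) *\<^sub>R 1 + (b x - b y) *\<^sub>R i"
      using ab[of x] ab[of y] by (simp add: scaleR_left_diff_distrib algebra_simps)
    then show ?thesis using nrm by simp
  qed
  have "\<bar>a x - a y\<bar> \<le> norm (x - y)" "\<bar>b x - b y\<bar> \<le> norm (x - y)" for x y :: 'k
    by (simp_all add: nd real_le_rsqrt)
  then have "Cauchy (\<lambda>n. a (z n))" "Cauchy (\<lambda>n. b (z n))"
    using z unfolding Cauchy_def dist_norm real_norm_def by (meson le_less_trans)+
  then obtain l m where "(\<lambda>n. a (z n)) \<longlonglongrightarrow> l" "(\<lambda>n. b (z n)) \<longlonglongrightarrow> m"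
    using real_Cauchy_convergent convergent_def by meson
  then have "(\<lambda>n. a (z n) *\<^sub>R 1 + b (z n) *\<^sub>R i) \<longlonglongrightarrow> l *\<^sub>R 1 + m *\<^sub>R i"
    by (intro tendsto_intros)
  then show ?thesis by (auto simp: convergent_def simp flip: ab)
qed

lemma zero_nhd_superset: "zero_nhd X U \<Longrightarrow> U \<subseteq> U' \<Longrightarrow> U' \<subseteq> topspace X \<Longrightarrow> zero_nhd X U'"
  unfolding zero_nhd_def by blast

text \<open>Nonnegativity and the value 0 at the origin follow from the two algebraic laws.
  Continuity is required only in the form of balls around 0, and values outside the carrier are
  arbitrary, so that gauges and norms of functionals qualify unchanged.\<close>

definition cseminorm :: "('k::real_or_complex \<Rightarrow> 'a::ab_group_add \<Rightarrow> 'a) \<Rightarrow> 'a topology \<Rightarrow> ('a \<Rightarrow> real) \<Rightarrow> bool" where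
  "cseminorm s X p \<longleftrightarrow>
    (\<forall>x\<in>topspace X. \<forall>y\<in>topspace X. p (x + y) \<le> p x + p y) \<and>
    (\<forall>c. \<forall>x\<in>topspace X. p (s c x) = norm c * p x) \<and>
    (\<forall>e>0. zero_nhd X {x \<in> topspace X. p x < e})"

section \<open>Gauges of absolutely convex sets\<close>

lemma absolutely_convex_scale:
  assumes "module s" "absolutely_convex s D" "x \<in> D" "norm a \<le> 1"
  shows "s a x \<in> D"
proof -
  interpret module s by fact
  have "s a x + s 0 x \<in> D"
    using assms(2-4) unfolding absolutely_convex_def by (metis add.right_neutral norm_zero)
  then show ?thesis by simp
qed

lemma gauge_of_le: "t > 0 \<Longrightarrow> x \<in> s (of_real t) ` D \<Longrightarrow> gauge_of s D x \<le> t"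
  unfolding gauge_of_def by (rule cInf_lower) (auto intro: bdd_belowI[of _ 0])

text \<open>The hypothesis that \<open>x\<close> lies in some positive multiple of \<open>D\<close>
  keeps the infimum in \<open>gauge_of\<close> from being taken over the empty set; the addition and
  scaling lemmas below carry it for the same reason.\<close>

lemma gauge_of_less:
  assumes "t > 0" "x \<in> s (of_real t) ` D" "gauge_of s D x < r"
  obtains t where "0 < t" "t < r" "x \<in> s (of_real t) ` D"
proof -
  have "{t. 0 < t \<and> x \<in> s (of_real t) ` D} \<noteq> {}" using assms by auto
  from cInf_lessD[OF this assms(3)[unfolded gauge_of_def]] that show ?thesis by auto
qed

lemma gauge_of_add:
  fixes s :: "'k::real_or_complex \<Rightarrow> 'a::ab_group_add \<Rightarrow> 'a"
  assumes "module s" and D: "absolutely_convex s D"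
    and x: "t > 0" "x \<in> s (of_real t) ` D" and y: "r > 0" "y \<in> s (of_real r) ` D"
  shows "gauge_of s D (x + y) \<le> gauge_of s D x + gauge_of s D y"
proof (rule field_le_epsilon)
  interpret module s by fact
  fix e :: real assume "e > 0"
  then have "gauge_of s D x < gauge_of s D x + e/2" "gauge_of s D y < gauge_of s D y + e/2" by auto
  then obtain t r where t: "t > 0" "t < gauge_of s D x + e/2" "x \<in> s (of_real t) ` D"
    and r: "r > 0" "r < gauge_of s D y + e/2" "y \<in> s (of_real r) ` D"
    using gauge_of_less x y by (metis (full_types))
  then obtain d d' where d: "d \<in> D" "x = s (of_real t) d" "d' \<in> D" "y = s (of_real r) d'" by auto
  let ?z = "s (of_real (t / (t + r))) d + s (of_real (r / (t + r))) d'"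
  have "norm (of_real (t / (t + r)) :: 'k) + norm (of_real (r / (t + r)) :: 'k) \<le> 1"
    using t r unfolding norm_of_real by (simp add: add_divide_distrib[symmetric])
  then have "?z \<in> D"
    using D d unfolding absolutely_convex_def by blast
  moreover have "of_real (t + r) * of_real (t / (t + r)) = (of_real t :: 'k)"
    "of_real (t + r) * of_real (r / (t + r)) = (of_real r :: 'k)"
    unfolding of_real_mult[symmetric] using t r by simp_all
  then have "x + y = s (of_real (t + r)) ?z"
    using d by (simp only: scale_right_distrib scale_scale)
  ultimately have "gauge_of s D (x + y) \<le> t + r"
    using t r by (intro gauge_of_le) auto
  then show "gauge_of s D (x + y) \<le> gauge_of s D x + gauge_of s D y + e"
    using t r by simp
qed

lemma gauge_of_zero:
  assumes "module s" and D: "absolutely_convex s D"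
  shows "gauge_of s D 0 = 0"
proof -
  interpret module s by fact
  obtain d where "d \<in> D" using D unfolding absolutely_convex_def by auto
  then have "s 0 d \<in> D" by (intro absolutely_convex_scale[OF assms]) auto
  then have 0: "0 \<in> s c ` D" for c by (auto simp: image_iff intro!: bexI[of _ 0])
  have "gauge_of s D 0 \<le> 0 + e" if "e > 0" for e :: real
    using gauge_of_le[OF that 0] by simp
  then have "gauge_of s D 0 \<le> 0" by (rule field_le_epsilon)
  moreover have "0 \<le> gauge_of s D 0"
    unfolding gauge_of_def using 0 by (intro cInf_greatest) (auto intro: exI[of _ 1])
  ultimately show ?thesis by simp
qed

text \<open>Writing c = |c| (c / |c|), the unimodular factor is absorbed by \<open>D\<close>. The
  second conclusion supplies the membership needed to apply the inequality once more, to the point c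
  x and the scalar 1/c.\<close>

lemma gauge_of_scale_le:
  assumes "vector_space s" and D: "absolutely_convex s D"
    and x: "t > 0" "x \<in> s (of_real t) ` D" and c: "c \<noteq> 0"
  shows "gauge_of s D (s c x) \<le> norm c * gauge_of s D x" "s c x \<in> s (of_real (norm c * t)) ` D"
proof -
  interpret vector_space s by fact
  have m: "module s" by unfold_locales
  have *: "s c x \<in> s (of_real (norm c * t)) ` D" if x: "x \<in> s (of_real t) ` D" for t
  proof -
    obtain d where d: "d \<in> D" "x = s (of_real t) d" using x by auto
    have "s (c / of_real (norm c)) d \<in> D"
      using d c by (intro absolutely_convex_scale[OF m D]) (auto simp: norm_divide)
    moreover have "s c x = s (of_real (norm c * t)) (s (c / of_real (norm c)) d)"
      using c d by (simp add: mult.commute)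
    ultimately show ?thesis by blast
  qed
  then show "s c x \<in> s (of_real (norm c * t)) ` D" using x by blast
  have "gauge_of s D (s c x) / norm c \<le> gauge_of s D x"
    unfolding gauge_of_def[of s D x]
  proof (rule cInf_greatest)
    show "{t. 0 < t \<and> x \<in> s (of_real t) ` D} \<noteq> {}" using x by auto
    fix t assume "t \<in> {t. 0 < t \<and> x \<in> s (of_real t) ` D}"
    then show "gauge_of s D (s c x) / norm c \<le> t"
      using gauge_of_le[of "norm c * t" "s c x" s D] *[of t] c by (simp add: divide_le_eq mult.commute)
  qed
  then show "gauge_of s D (s c x) \<le> norm c * gauge_of s D x"
    using c by (simp add: divide_le_eq mult.commute)
qed

lemma gauge_of_scale:
  assumes "vector_space s" and D: "absolutely_convex s D"
    and x: "t > 0" "x \<in> s (of_real t) ` D"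
  shows "gauge_of s D (s c x) = norm c * gauge_of s D x"
proof (cases "c = 0")
  interpret vector_space s by fact
  have m: "module s" by unfold_locales
  case True then show ?thesis using gauge_of_zero[OF m D] by simp
next
  interpret vector_space s by fact
  case False
  note * = gauge_of_scale_le[OF assms(1,2) x False]
  have "gauge_of s D (s (inverse c) (s c x)) \<le> norm (inverse c) * gauge_of s D (s c x)"
    using False x by (intro gauge_of_scale_le(1)[OF assms(1,2) _ *(2)]) auto
  then have "gauge_of s D x \<le> gauge_of s D (s c x) / norm c"
    using False by (simp add: norm_inverse divide_inverse mult.commute)
  then have "norm c * gauge_of s D x \<le> gauge_of s D (s c x)"
    using False by (simp add: pos_le_divide_eq mult.commute)
  with *(1) show ?thesis by simp
qed

section \<open>Locally convex spaces described by their continuous seminorms\<close>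

locale lc_space =
  fixes s :: "'k::real_or_complex \<Rightarrow> 'a::ab_group_add \<Rightarrow> 'a" and X :: "'a topology"
  assumes lcHs: "lcHs s X"

sublocale lc_space \<subseteq> vector_space s
  using lcHs by (simp add: lcHs_def)

context lc_space
begin

abbreviation V where "V \<equiv> topspace X"
abbreviation cs where "cs \<equiv> cseminorm s X"

lemma module_s: "module s" by unfold_locales

lemma subspace_V: "subspace V"
  using lcHs by (simp add: lcHs_def)

lemma V_closed [simp]:
  "0 \<in> V" "x \<in> V \<Longrightarrow> y \<in> V \<Longrightarrow> x + y \<in> V" "x \<in> V \<Longrightarrow> y \<in> V \<Longrightarrow> x - y \<in> V"
  "x \<in> V \<Longrightarrow> s c x \<in> V" "x \<in> V \<Longrightarrow> - x \<in> V"
  using subspace_V subspace_0 subspace_add subspace_diff subspace_scale subspace_neg by auto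

lemma V_sum: "(\<And>i. i \<in> I \<Longrightarrow> f i \<in> V) \<Longrightarrow> (\<Sum>i\<in>I. f i) \<in> V"
  using subspace_V subspace_sum by blast

lemma cs_add: "cs p \<Longrightarrow> x \<in> V \<Longrightarrow> y \<in> V \<Longrightarrow> p (x + y) \<le> p x + p y"
  and cs_scale: "cs p \<Longrightarrow> x \<in> V \<Longrightarrow> p (s c x) = norm c * p x"
  and cs_zero_nhd: "cs p \<Longrightarrow> e > 0 \<Longrightarrow> zero_nhd X {x \<in> V. p x < e}"
  by (auto simp: cseminorm_def)

lemma cs_zero [simp]: "cs p \<Longrightarrow> p 0 = 0"
  using cs_scale[of p 0 0] by simp

lemma cs_minus: "cs p \<Longrightarrow> x \<in> V \<Longrightarrow> p (- x) = p x"
  using cs_scale[of p x "-1"] by simp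

lemma cs_nonneg: "cs p \<Longrightarrow> x \<in> V \<Longrightarrow> 0 \<le> p x"
  using cs_add[of p x "- x"] by (simp add: cs_minus)

lemma cs_diff: "cs p \<Longrightarrow> x \<in> V \<Longrightarrow> y \<in> V \<Longrightarrow> p (x - y) \<le> p x + p y"
  using cs_add[of p x "- y"] by (simp add: cs_minus)

lemma cs_diff_commute: "cs p \<Longrightarrow> x \<in> V \<Longrightarrow> y \<in> V \<Longrightarrow> p (x - y) = p (y - x)"
  using cs_minus[of p "x - y"] by simp

lemma cs_triangle:
  "cs p \<Longrightarrow> x \<in> V \<Longrightarrow> y \<in> V \<Longrightarrow> z \<in> V \<Longrightarrow> p (x - z) \<le> p (x - y) + p (y - z)"
  using cs_add[of p "x - y" "y - z"] by simp

lemma cs_mult: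
  assumes p: "cs p" and c: "c > 0"
  shows "cs (\<lambda>x. c * p x)"
proof -
  have "zero_nhd X {x \<in> V. c * p x < e}" if "e > 0" for e
    using cs_zero_nhd[OF p, of "e / c"] that c by (simp add: pos_less_divide_eq mult.commute)
  then show ?thesis
    using cs_add[OF p] cs_scale[OF p] c
    by (auto simp: cseminorm_def simp flip: distrib_left)
qed

lemma continuous_translate: "a \<in> V \<Longrightarrow> continuous_map X X (\<lambda>x. x + a)"
proof -
  assume "a \<in> V"
  then have "continuous_map X (prod_topology X X) (\<lambda>x. (x, a))"
    by (intro continuous_map_pairedI) auto
  moreover have "continuous_map (prod_topology X X) X (\<lambda>(x, y). x + y)"
    using lcHs by (simp add: lcHs_def)
  ultimately show ?thesis
    using continuous_map_compose by (fastforce simp: o_def)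
qed

lemma continuous_scale: "continuous_map X X (s c)"
proof -
  have "continuous_map X (prod_topology euclidean X) (\<lambda>x. (c, x))"
    by (intro continuous_map_pairedI) auto
  moreover have "continuous_map (prod_topology euclidean X) X (\<lambda>(c, x). s c x)"
    using lcHs by (simp add: lcHs_def)
  ultimately show ?thesis
    using continuous_map_compose by (fastforce simp: o_def)
qed

lemma zero_nhd_scale:
  assumes "zero_nhd X U" shows "zero_nhd X {x \<in> V. s c x \<in> U}"
proof -
  obtain W where W: "openin X W" "0 \<in> W" "W \<subseteq> U" using assms by (auto simp: zero_nhd_def)
  have "openin X {x \<in> V. s c x \<in> W}"
    using continuous_scale W(1) by (rule openin_continuous_map_preimage)
  then show ?thesis using W unfolding zero_nhd_def
    by (intro conjI exI[of _ "{x \<in> V. s c x \<in> W}"]) auto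
qed

text \<open>Local convexity is given by convex, not necessarily balanced, neighbourhoods, so the
  balanced core of \<open>C\<close> is taken; convexity of \<open>C\<close> makes this core
  absolutely convex.\<close>

lemma zero_nhd_absolutely_convex:
  assumes "zero_nhd X U"
  obtains D where "zero_nhd X D" "absolutely_convex s D" "D \<subseteq> U"
proof -
  obtain C where C: "zero_nhd X C" "convex_in s C" "C \<subseteq> U"
    using assms lcHs by (auto simp: lcHs_def)
  then obtain W where W: "openin X W" "0 \<in> W" "W \<subseteq> C" by (auto simp: zero_nhd_def)
  have CV: "C \<subseteq> V" using C by (auto simp: zero_nhd_def)
  define D where "D = {x \<in> V. \<forall>c. norm c \<le> 1 \<longrightarrow> s c x \<in> C}"
  have "continuous_map (prod_topology euclidean X) X (\<lambda>(c, x). s c x)"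
    using lcHs by (simp add: lcHs_def)
  from openin_continuous_map_preimage[OF this W(1)]
  have op: "openin (prod_topology euclidean X) {z. snd z \<in> V \<and> s (fst z) (snd z) \<in> W}" (is "openin _ ?Z")
    by (simp add: case_prod_unfold mem_Times_iff)
  have in0: "(0, 0) \<in> ?Z" using W by simp
  obtain A B where A: "openin euclidean A" and AB: "openin X B" "0 \<in> A" "0 \<in> B" "A \<times> B \<subseteq> ?Z"
    by (rule op[unfolded openin_prod_topology_alt, rule_format, OF in0, THEN exE]) (elim exE conjE)
  from A have "open A" by simp
  with AB obtain r where r: "r > 0" "ball 0 r \<subseteq> A" by (meson open_contains_ball)
  have AB': "s c x \<in> W" if "norm c < r" "x \<in> B" for c x
  proof -
    have "(c, x) \<in> A \<times> B" using r(2) that by auto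
    then show ?thesis using AB(4) by auto
  qed
  \<comment> \<open>Continuity of scalar multiplication at (0, 0) provided \<open>r\<close> and
    \<open>B\<close>. The factor 2 leaves room: c x = (c r/2) ((2/r) x) with |c r/2| at most r/2,
    hence inside the open ball of radius r.\<close>
  have sub: "{x \<in> V. s (of_real (2 / r)) x \<in> B} \<subseteq> D"
  proof
    fix x assume "x \<in> {x \<in> V. s (of_real (2 / r)) x \<in> B}"
    then have x: "x \<in> V" "s (of_real (2 / r)) x \<in> B" by auto
    have "s c x \<in> C" if c: "norm c \<le> 1" for c
    proof -
      have "norm (c * of_real (r / 2)) \<le> r / 2"
        using c r(1) by (simp add: norm_mult mult_le_cancel_right1 del: of_real_divide)
      then have "s (c * of_real (r / 2)) (s (of_real (2 / r)) x) \<in> W"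
        using r(1) x(2) by (intro AB') auto
      moreover have "s (c * of_real (r / 2)) (s (of_real (2 / r)) x) = s c x"
        using r(1) by (simp add: mult.assoc flip: of_real_mult del: of_real_divide)
      ultimately show ?thesis using W by auto
    qed
    with x show "x \<in> D" by (simp add: D_def)
  qed
  have "zero_nhd X B" using AB openin_subset by (auto simp: zero_nhd_def)
  from zero_nhd_superset[OF zero_nhd_scale[OF this] sub] have nD: "zero_nhd X D"
    by (auto simp: D_def)
  have "s \<alpha> x + s \<beta> y \<in> C" if "x \<in> D" "y \<in> D" "norm \<alpha> + norm \<beta> \<le> 1" for x y \<alpha> \<beta>
  proof -
    \<comment> \<open>With t = |\<alpha>| the combination is t (\<alpha>/t) x + (1 - t) (\<beta>/(1
      - t)) y. At t = 0 or t = 1 the corresponding coefficient vanishes and division by zero yields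
      0, so the same formula remains correct.\<close>
    let ?t = "norm \<alpha>"
    have b1: "norm (\<alpha> / of_real ?t) \<le> 1" by (simp add: norm_divide)
    have t1: "?t \<le> 1" using that(3) norm_ge_zero[of \<beta>] by linarith
    then have nn: "norm (1 - of_real ?t :: 'k) = 1 - ?t"
      using norm_of_real[of "1 - ?t", where 'a='k] by (simp only: of_real_diff of_real_1 abs_of_nonneg diff_ge_0_iff_ge)
    have b2: "norm (\<beta> / of_real (1 - ?t)) \<le> 1"
      using that(3) t1 by (auto simp: norm_divide divide_le_eq_1 nn)
    have "s (of_real ?t) (s (\<alpha> / of_real ?t) x) + s (of_real (1 - ?t)) (s (\<beta> / of_real (1 - ?t)) y) \<in> C"
      using C(2) that b1 b2 norm_ge_zero[of \<alpha>] norm_ge_zero[of \<beta>] unfolding convex_in_def D_def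
      by (smt (verit) mem_Collect_eq)
    moreover have "of_real ?t * (\<alpha> / of_real ?t) = \<alpha>" by simp
    moreover have "of_real (1 - ?t) * (\<beta> / of_real (1 - ?t)) = \<beta>"
      using that(3) by (cases "?t = 1") auto
    ultimately show ?thesis by (simp only: scale_scale)
  qed note conv = this
  have "absolutely_convex s D"
    unfolding absolutely_convex_def
  proof (intro conjI ballI allI impI)
    show "D \<noteq> {}" using nD by (auto simp: zero_nhd_def)
    fix x y and a b :: 'k assume xy: "x \<in> D" "y \<in> D" and ab: "norm a + norm (b::'k) \<le> 1"
    have "s c (s a x + s b y) \<in> C" if "norm c \<le> 1" for c
    proof -
      have "norm (c * a) + norm (c * b) = norm c * (norm a + norm b)"
        by (simp add: norm_mult algebra_simps)
      also have "\<dots> \<le> 1" using that ab by (simp add: mult_le_one)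
      finally have "norm (c * a) + norm (c * b) \<le> 1" .
      from conv[OF xy this] show ?thesis by (simp add: scale_right_distrib)
    qed
    then show "s a x + s b y \<in> D" using xy by (auto simp: D_def)
  qed
  moreover have "D \<subseteq> C" unfolding D_def by (auto dest: spec[of _ 1])
  ultimately show ?thesis using that nD C by blast
qed

text \<open>Every point is absorbed by \<open>D\<close> because c |-> c x is continuous at 0; this
  makes the gauge a true infimum. The second conclusion lets a seminorm ball replace an arbitrary
  neighbourhood of 0.\<close>

lemma cseminorm_gauge_of:
  assumes D: "zero_nhd X D" "absolutely_convex s D"
  shows "cs (gauge_of s D)" "{x \<in> V. gauge_of s D x < 1} \<subseteq> D"
proof -
  have DV: "D \<subseteq> V" using D by (auto simp: zero_nhd_def)
  have abs: "\<exists>t>0. x \<in> s (of_real t) ` D" if x: "x \<in> V" for x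
  proof -
    have "continuous_map euclidean (prod_topology euclidean X) (\<lambda>c::'k. (c, x))"
      using x by (intro continuous_map_pairedI) auto
    moreover have "continuous_map (prod_topology euclidean X) X (\<lambda>(c, x). s c x)"
      using lcHs by (simp add: lcHs_def)
    ultimately have c: "continuous_map euclidean X (\<lambda>c. s c x)"
      using continuous_map_compose by (fastforce simp: o_def)
    obtain W where W: "openin X W" "0 \<in> W" "W \<subseteq> D" using D by (auto simp: zero_nhd_def)
    from openin_continuous_map_preimage[OF c W(1)] have "open {c. s c x \<in> W}" by simp
    moreover have "0 \<in> {c. s c x \<in> W}" using W by simp
    ultimately obtain r where r: "r > 0" "ball 0 r \<subseteq> {c. s c x \<in> W}" by (meson open_contains_ball)
    moreover have "of_real (r / 2) \<in> ball (0::'k) r"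
      using r(1) by (simp del: of_real_divide)
    ultimately have "s (of_real (r / 2)) x \<in> W" by blast
    then have "s (of_real (r / 2)) x \<in> D" using W by auto
    then have "s (of_real (2 / r)) (s (of_real (r / 2)) x) \<in> s (of_real (2 / r)) ` D" by blast
    moreover have "s (of_real (2 / r)) (s (of_real (r / 2)) x) = x"
      using r(1) by (simp flip: of_real_mult del: of_real_divide)
    ultimately show ?thesis using r(1) by (intro exI[of _ "2 / r"]) auto
  qed
  have "zero_nhd X {x \<in> V. gauge_of s D x < e}" if e: "e > 0" for e
  proof (rule zero_nhd_superset[OF zero_nhd_scale[OF D(1), of "of_real (2 / e)"]])
    show "{x \<in> V. s (of_real (2 / e)) x \<in> D} \<subseteq> {x \<in> V. gauge_of s D x < e}"
    proof clarify
      fix x assume x: "x \<in> V" "s (of_real (2 / e)) x \<in> D"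
      then have "s (of_real (e / 2)) (s (of_real (2 / e)) x) \<in> s (of_real (e / 2)) ` D" by blast
      moreover have "s (of_real (e / 2)) (s (of_real (2 / e)) x) = x"
        using e by (simp flip: of_real_mult del: of_real_divide)
      ultimately have "gauge_of s D x \<le> e / 2" using e by (intro gauge_of_le) auto
      then show "gauge_of s D x < e" using e by simp
    qed
  qed auto
  moreover have "gauge_of s D (x + y) \<le> gauge_of s D x + gauge_of s D y" if "x \<in> V" "y \<in> V" for x y
    using abs[OF that(1)] abs[OF that(2)] gauge_of_add[OF module_s D(2)] by blast
  moreover have "gauge_of s D (s c x) = norm c * gauge_of s D x" if "x \<in> V" for x c
    using abs[OF that(1)] gauge_of_scale[OF vector_space_axioms D(2)] by blast
  ultimately show "cs (gauge_of s D)" by (auto simp: cseminorm_def)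
  show "{x \<in> V. gauge_of s D x < 1} \<subseteq> D"
  proof clarify
    fix x assume x: "x \<in> V" "gauge_of s D x < 1"
    then obtain t where t: "0 < t" "t < 1" "x \<in> s (of_real t) ` D"
      using abs[OF x(1)] gauge_of_less by metis
    then show "x \<in> D" using absolutely_convex_scale[OF module_s D(2)] by auto
  qed
qed

lemma zero_nhd_cs:
  assumes "zero_nhd X U"
  obtains p where "cs p" "{x \<in> V. p x < 1} \<subseteq> U"
proof -
  obtain D where "zero_nhd X D" "absolutely_convex s D" "D \<subseteq> U"
    using assms by (rule zero_nhd_absolutely_convex)
  then show ?thesis using that[of "gauge_of s D"] cseminorm_gauge_of by blast
qed

lemma openin_shift:
  assumes "openin X W" "a \<in> V"
  shows "openin X {x \<in> V. x - a \<in> W}"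
  using openin_continuous_map_preimage[OF continuous_translate[of "- a"] assms(1)] assms(2) by simp

text \<open>Most later topology goes through this description. Radius 1 suffices because positive
  multiples of continuous seminorms are again such, and a single seminorm suffices because the
  gauges of absolutely convex neighbourhoods already give a base at 0.\<close>

lemma openin_cs: "openin X W \<longleftrightarrow> W \<subseteq> V \<and> (\<forall>x\<in>W. \<exists>p. cs p \<and> {y \<in> V. p (y - x) < 1} \<subseteq> W)"
proof (intro iffI conjI ballI)
  assume W: "openin X W"
  then show "W \<subseteq> V" by (rule openin_subset)
  fix x assume x: "x \<in> W"
  with W have xV: "x \<in> V" using openin_subset by blast
  have "openin X {y \<in> V. y - (- x) \<in> W}" using W xV by (intro openin_shift) auto
  then have "zero_nhd X {y \<in> V. y + x \<in> W}"
    using x unfolding zero_nhd_def by (intro conjI exI[of _ "{y \<in> V. y + x \<in> W}"]) auto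
  then obtain p where "cs p" "{y \<in> V. p y < 1} \<subseteq> {y \<in> V. y + x \<in> W}" by (rule zero_nhd_cs)
  then show "\<exists>p. cs p \<and> {y \<in> V. p (y - x) < 1} \<subseteq> W"
    using xV by (intro exI[of _ p]) (force dest: subsetD[where c = "_ - x"])
next
  assume W: "W \<subseteq> V \<and> (\<forall>x\<in>W. \<exists>p. cs p \<and> {y \<in> V. p (y - x) < 1} \<subseteq> W)"
  have "\<exists>O'. openin X O' \<and> x \<in> O' \<and> O' \<subseteq> W" if x: "x \<in> W" for x
  proof -
    obtain p where p: "cs p" "{y \<in> V. p (y - x) < 1} \<subseteq> W" using W x by blast
    have xV: "x \<in> V" using W x by auto
    obtain O' where O': "openin X O'" "0 \<in> O'" "O' \<subseteq> {y \<in> V. p y < 1}"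
      using cs_zero_nhd[OF p(1), of 1] by (auto simp: zero_nhd_def)
    then show ?thesis
      using openin_shift[OF O'(1) xV] xV p by (intro exI[of _ "{y \<in> V. y - x \<in> O'}"]) auto
  qed
  then show "openin X W" using openin_subopen by metis
qed

lemma openin_cs_nhd:
  assumes "openin X W" "x \<in> W"
  obtains p where "cs p" "{y \<in> V. p (y - x) < 1} \<subseteq> W"
  using assms that unfolding openin_cs by blast

lemma openin_cs_ball:
  assumes p: "cs p" and a: "a \<in> V"
  shows "openin X {x \<in> V. p (x - a) < e}"
  unfolding openin_cs
proof (intro conjI ballI)
  fix x assume "x \<in> {x \<in> V. p (x - a) < e}"
  then have x: "x \<in> V" "p (x - a) < e" by auto
  \<comment> \<open>\<open>?q\<close> is \<open>p\<close> rescaled by the remaining distance e - p(x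
    - a), so that its unit ball around \<open>x\<close> stays inside the given ball.\<close>
  let ?q = "\<lambda>z. inverse (e - p (x - a)) * p z"
  have "cs ?q" using p x by (intro cs_mult) auto
  moreover have "p (y - a) < e" if "y \<in> V" "?q (y - x) < 1" for y
  proof -
    have "p (y - x) < e - p (x - a)" using that x by (simp add: divide_simps)
    then show ?thesis using cs_triangle[OF p that(1) x(1) a] by simp
  qed
  ultimately show "\<exists>p'. cs p' \<and> {y \<in> V. p' (y - x) < 1} \<subseteq> {x \<in> V. p (x - a) < e}"
    by (intro exI[of _ ?q]) auto
qed auto

lemma limitin_cs:
  assumes "\<And>n. \<sigma> n \<in> V"
  shows "limitin X \<sigma> x F \<longleftrightarrow> x \<in> V \<and> (\<forall>p. cs p \<longrightarrow> (\<forall>e>0. \<forall>\<^sub>F n in F. p (\<sigma> n - x) < e))"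
proof (intro iffI conjI allI impI)
  assume L: "limitin X \<sigma> x F"
  then show xV: "x \<in> V" by (rule limitin_topspace)
  fix p and e :: real assume "cs p" "e > 0"
  then have "openin X {y \<in> V. p (y - x) < e}" "x \<in> {y \<in> V. p (y - x) < e}"
    using openin_cs_ball xV by auto
  then show "\<forall>\<^sub>F n in F. p (\<sigma> n - x) < e"
    using L unfolding limitin_def by (auto elim: eventually_mono)
next
  assume *: "x \<in> V \<and> (\<forall>p. cs p \<longrightarrow> (\<forall>e>0. \<forall>\<^sub>F n in F. p (\<sigma> n - x) < e))"
  show "limitin X \<sigma> x F"
    unfolding limitin_def
  proof (intro conjI allI impI)
    show "x \<in> V" using * by simp
    fix U assume "openin X U \<and> x \<in> U"
    then obtain p where p: "cs p" "{y \<in> V. p (y - x) < 1} \<subseteq> U" using openin_cs_nhd by metis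
    then have "\<forall>\<^sub>F n in F. p (\<sigma> n - x) < 1" using * by simp
    then show "\<forall>\<^sub>F n in F. \<sigma> n \<in> U"
      by (rule eventually_mono) (use assms p in auto)
  qed
qed

lemma bounded_in_cs: "bounded_in s X B \<longleftrightarrow> B \<subseteq> V \<and> (\<forall>p. cs p \<longrightarrow> (\<exists>c. \<forall>x\<in>B. p x \<le> c))"
proof (intro iffI conjI allI impI)
  assume B: "bounded_in s X B"
  then show "B \<subseteq> V" by (simp add: bounded_in_def)
  fix p assume p: "cs p"
  then obtain r where "r > 0" "B \<subseteq> s (of_real r) ` {x \<in> V. p x < 1}"
    using B cs_zero_nhd[OF p, of 1] unfolding bounded_in_def by auto
  then have "\<forall>x\<in>B. p x \<le> r" using p by (auto dest!: subsetD simp: cs_scale mult_le_cancel_left1)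
  then show "\<exists>c. \<forall>x\<in>B. p x \<le> c" by blast
next
  assume *: "B \<subseteq> V \<and> (\<forall>p. cs p \<longrightarrow> (\<exists>c. \<forall>x\<in>B. p x \<le> c))"
  show "bounded_in s X B"
    unfolding bounded_in_def
  proof (intro conjI allI impI)
    show "B \<subseteq> V" using * by simp
    fix U assume "zero_nhd X U"
    then obtain p where p: "cs p" "{x \<in> V. p x < 1} \<subseteq> U" by (rule zero_nhd_cs)
    then obtain c where c: "\<forall>x\<in>B. p x \<le> c" using * by blast
    \<comment> \<open>One more than |c|: this makes \<open>r\<close> positive and the bound strict,
      as the ball p < 1 requires.\<close>
    define r where "r = \<bar>c\<bar> + 1"
    have r: "r > 0" "c < r" by (auto simp: r_def)
    have "x \<in> s (of_real r) ` U" if x: "x \<in> B" for x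
    proof -
      have xV: "x \<in> V" using x * by auto
      have "p x < r" using c x r(2) by force
      then have "s (of_real (1 / r)) x \<in> U"
        using p(2) xV r(1) cs_scale[OF p(1) xV, of "of_real (1/r)"]
        by (auto simp del: of_real_divide)
      moreover have "x = s (of_real r) (s (of_real (1 / r)) x)"
        using r(1) by (simp flip: of_real_mult del: of_real_divide)
      ultimately show ?thesis by blast
    qed
    then show "\<exists>r>0. B \<subseteq> s (of_real r) ` U" using r(1) by blast
  qed
qed

lemma cs_separates:
  assumes x: "x \<in> V" and 0: "\<And>p. cs p \<Longrightarrow> p x = 0"
  shows "x = 0"
proof (rule ccontr)
  assume "x \<noteq> 0"
  moreover have "Hausdorff_space X" using lcHs by (simp add: lcHs_def)
  ultimately obtain U W where UW: "openin X U" "0 \<in> U" "x \<notin> U"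
    using x V_closed(1) unfolding Hausdorff_space_def disjnt_iff by metis
  then obtain p where "cs p" "{y \<in> V. p (y - 0) < 1} \<subseteq> U" using openin_cs_nhd by metis
  with 0[of p] x UW show False by auto
qed

text \<open>For a continuous functional the seminorm |\<phi>| itself is the dominating one. The
  clause on points outside the carrier is the normalisation that makes equality of functionals
  equality of functions.\<close>

lemma dual_iff: "\<phi> \<in> dual s X \<longleftrightarrow> linear_map_on s (*) V \<phi> \<and> (\<forall>x. x \<notin> V \<longrightarrow> \<phi> x = 0) \<and>
  (\<exists>p. cs p \<and> (\<forall>x\<in>V. norm (\<phi> x) \<le> p x))"
proof (intro iffI conjI)
  assume \<phi>: "\<phi> \<in> dual s X"
  then show lin: "linear_map_on s (*) V \<phi>" and "\<forall>x. x \<notin> V \<longrightarrow> \<phi> x = 0"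
    by (auto simp: dual_def cont_lin_def)
  have 0: "\<phi> 0 = 0" using lin unfolding linear_map_on_def
    by (metis V_closed(1) add_cancel_right_right)
  have "zero_nhd X {x \<in> V. norm (\<phi> x) < e}" if "e > 0" for e
  proof -
    have "openin X {x \<in> V. \<phi> x \<in> ball 0 e}"
      using \<phi> by (intro openin_continuous_map_preimage[where Y = euclidean]) (auto simp: dual_def cont_lin_def)
    then show ?thesis using 0 that unfolding zero_nhd_def
      by (intro conjI exI[of _ "{x \<in> V. \<phi> x \<in> ball 0 e}"]) auto
  qed
  then have "cs (\<lambda>x. norm (\<phi> x))"
    using lin by (auto simp: cseminorm_def linear_map_on_def norm_triangle_ineq norm_mult)
  then show "\<exists>p. cs p \<and> (\<forall>x\<in>V. norm (\<phi> x) \<le> p x)" by blast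
next
  assume *: "linear_map_on s (*) V \<phi> \<and> (\<forall>x. x \<notin> V \<longrightarrow> \<phi> x = 0) \<and>
    (\<exists>p. cs p \<and> (\<forall>x\<in>V. norm (\<phi> x) \<le> p x))"
  then obtain p where p: "cs p" "\<And>x. x \<in> V \<Longrightarrow> norm (\<phi> x) \<le> p x" by blast
  have diff: "\<phi> (x - y) = \<phi> x - \<phi> y" if "x \<in> V" "y \<in> V" for x y
    using * that unfolding linear_map_on_def by (metis V_closed(3) add_diff_cancel diff_add_cancel)
  have "continuous_map X euclidean \<phi>"
    unfolding continuous_map_def
  proof (intro conjI allI impI)
    fix U :: "'k set" assume "openin euclidean U"
    then have U: "open U" by simp
    show "openin X {x \<in> V. \<phi> x \<in> U}"
      unfolding openin_cs
    proof (intro conjI ballI)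
      fix x assume "x \<in> {x \<in> V. \<phi> x \<in> U}"
      then have x: "x \<in> V" "\<phi> x \<in> U" by auto
      then obtain e where e: "e > 0" "ball (\<phi> x) e \<subseteq> U" using U open_contains_ball by metis
      have "\<phi> y \<in> U" if "y \<in> V" "inverse e * p (y - x) < 1" for y
      proof -
        have "norm (\<phi> (y - x)) < e"
          using that e(1) p(2)[of "y - x"] x by (simp add: divide_simps)
        then have "\<phi> y \<in> ball (\<phi> x) e" using that x by (simp add: diff dist_norm norm_minus_commute)
        then show ?thesis using e by auto
      qed
      then show "\<exists>p. cs p \<and> {y \<in> V. p (y - x) < 1} \<subseteq> {x \<in> V. \<phi> x \<in> U}"
        using cs_mult[OF p(1), of "inverse e"] e(1) by (intro exI[of _ "\<lambda>x. inverse e * p x"]) auto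
    qed auto
  qed auto
  then show "\<phi> \<in> dual s X" using * by (auto simp: dual_def cont_lin_def)
qed

lemma dualD:
  assumes "\<phi> \<in> dual s X"
  shows "x \<in> V \<Longrightarrow> y \<in> V \<Longrightarrow> \<phi> (x + y) = \<phi> x + \<phi> y"
    "x \<in> V \<Longrightarrow> \<phi> (s c x) = c * \<phi> x" "\<phi> 0 = 0"
    "x \<in> V \<Longrightarrow> y \<in> V \<Longrightarrow> \<phi> (x - y) = \<phi> x - \<phi> y"
    "x \<notin> V \<Longrightarrow> \<phi> x = 0"
proof -
  have *: "linear_map_on s (*) V \<phi>" using assms dual_iff by blast
  show 1: "\<phi> (x + y) = \<phi> x + \<phi> y" if "x \<in> V" "y \<in> V" for x y using * that by (auto simp: linear_map_on_def)
  show 2: "\<phi> (s c x) = c * \<phi> x" if "x \<in> V" using * that by (auto simp: linear_map_on_def)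
  show "\<phi> 0 = 0" using 1[of 0 0] by simp
  show "\<phi> (x - y) = \<phi> x - \<phi> y" if "x \<in> V" "y \<in> V" using 1[of "x - y" y] that by simp
  show "x \<notin> V \<Longrightarrow> \<phi> x = 0" using assms dual_iff by blast
qed

lemma dual_sum:
  assumes "\<phi> \<in> dual s X" "\<And>i. i \<in> I \<Longrightarrow> x i \<in> V"
  shows "\<phi> (\<Sum>i\<in>I. x i) = (\<Sum>i\<in>I. \<phi> (x i))"
  using assms(2)
  by (induction I rule: infinite_finite_induct) (auto simp: dualD[OF assms(1)] V_sum)

lemma dual_bounded:
  assumes "\<phi> \<in> dual s X"
  obtains p where "cs p" "\<And>x. x \<in> V \<Longrightarrow> norm (\<phi> x) \<le> p x"
  using dual_iff[THEN iffD1, OF assms] that by blast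

lemma dual_limit:
  assumes "\<phi> \<in> dual s X" "limitin X \<sigma> x F"
  shows "((\<lambda>n. \<phi> (\<sigma> n)) \<longlongrightarrow> \<phi> x) F"
  using continuous_map_limit[OF _ assms(2), of euclidean \<phi>] assms(1)
  by (auto simp: dual_def cont_lin_def o_def)

text \<open>Homogeneity turns a bound on the open unit ball of \<open>p\<close> into a bound by a
  multiple of \<open>p\<close>. Scaling by a number slightly larger than p x treats p x = 0 together
  with the other case.\<close>

lemma cs_bound_scale:
  assumes p: "cs p" and 1: "\<And>x. x \<in> V \<Longrightarrow> p x < 1 \<Longrightarrow> q x \<le> c"
    and q: "\<And>x t. x \<in> V \<Longrightarrow> t > 0 \<Longrightarrow> q (s (of_real t) x) = t * q x" and x: "x \<in> V" and c: "c \<ge> 0"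
  shows "q x \<le> c * p x"
proof (rule field_le_epsilon)
  fix e :: real assume e: "e > 0"
  \<comment> \<open>Dividing by c + 1 rather than c admits c = 0 and still gives c (e / (c + 1))
    \<le> e.\<close>
  define r where "r = p x + e / (c + 1)"
  have r: "r > p x" "r > 0" using e c cs_nonneg[OF p x] by (auto simp: r_def add_nonneg_pos)
  have "p (s (of_real (1 / r)) x) < 1" using r x by (simp add: cs_scale[OF p x] del: of_real_divide)
  then have "q (s (of_real (1 / r)) x) \<le> c" using x by (intro 1) auto
  then have "q x \<le> c * r" using q[OF x, of "1 / r"] r by (simp add: pos_divide_le_eq)
  also have "\<dots> \<le> c * p x + e" using c e by (simp add: r_def field_simps)
  finally show "q x \<le> c * p x + e" .
qed

text \<open>For nonempty \<open>B\<close> inside the carrier this is the closed absolutely convex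
  hull, that is, the bipolar. Describing it by seminorms instead of functionals makes closedness,
  boundedness and absolute convexity direct to check, before Hahn-Banach is available.\<close>

definition polar_hull :: "'a set \<Rightarrow> 'a set" where
  "polar_hull B = {x \<in> V. \<forall>p c. cs p \<longrightarrow> (\<forall>b\<in>B. p b \<le> c) \<longrightarrow> p x \<le> c}"

lemma polar_hull_superset: "B \<subseteq> V \<Longrightarrow> B \<subseteq> polar_hull B"
  by (auto simp: polar_hull_def)

lemma closedin_polar_hull: "closedin X (polar_hull B)"
  unfolding closedin_def
proof (intro conjI)
  show "openin X (V - polar_hull B)"
    unfolding openin_cs
  proof (intro conjI ballI)
    fix x assume "x \<in> V - polar_hull B"
    then obtain p c where x: "x \<in> V" and p: "cs p" "\<forall>b\<in>B. p b \<le> c" "p x > c"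
      by (auto simp: polar_hull_def not_le)
    let ?q = "\<lambda>z. inverse (p x - c) * p z"
    have "y \<notin> polar_hull B" if "y \<in> V" "?q (y - x) < 1" for y
    proof -
      have "p (y - x) < p x - c" using that p by (simp add: divide_simps)
      then have "p y > c"
        using cs_diff[OF p(1), of y "y - x"] that x by simp
      then show ?thesis using p by (auto simp: polar_hull_def not_le)
    qed
    moreover have "cs ?q" using p by (intro cs_mult) auto
    ultimately show "\<exists>q. cs q \<and> {y \<in> V. q (y - x) < 1} \<subseteq> V - polar_hull B" by (intro exI[of _ ?q]) auto
  qed auto
qed (auto simp: polar_hull_def)

lemma bounded_polar_hull: "bounded_in s X B \<Longrightarrow> bounded_in s X (polar_hull B)"
  unfolding bounded_in_cs
proof (intro conjI allI impI)
  assume B: "B \<subseteq> V \<and> (\<forall>p. cs p \<longrightarrow> (\<exists>c. \<forall>x\<in>B. p x \<le> c))"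
  show "polar_hull B \<subseteq> V" by (auto simp: polar_hull_def)
  fix p assume p: "cs p"
  then obtain c where "\<forall>x\<in>B. p x \<le> c" using B by blast
  then have "\<forall>x\<in>polar_hull B. p x \<le> c" using p by (simp add: polar_hull_def)
  then show "\<exists>c. \<forall>x\<in>polar_hull B. p x \<le> c" ..
qed

lemma absolutely_convex_polar_hull:
  assumes "B \<subseteq> V" "B \<noteq> {}"
  shows "absolutely_convex s (polar_hull B)"
  unfolding absolutely_convex_def
proof (intro conjI ballI allI impI)
  show "polar_hull B \<noteq> {}" using assms polar_hull_superset by auto
  fix x y and a b :: 'k assume xy: "x \<in> polar_hull B" "y \<in> polar_hull B" and ab: "norm (a::'k) + norm (b::'k) \<le> 1"
  show "s a x + s b y \<in> polar_hull B"
    unfolding polar_hull_def mem_Collect_eq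
  proof (intro conjI allI impI)
    have V: "x \<in> V" "y \<in> V" using xy by (auto simp: polar_hull_def)
    then show "s a x + s b y \<in> V" by auto
    fix p c assume p: "cs p" "\<forall>b\<in>B. p b \<le> c"
    have pc: "p x \<le> c" "p y \<le> c" using xy p by (auto simp: polar_hull_def)
    have c: "c \<ge> 0" using pc(1) cs_nonneg[OF p(1) V(1)] by linarith
    have "p (s a x + s b y) \<le> norm a * p x + norm b * p y"
      using cs_add[OF p(1), of "s a x" "s b y"] V by (simp add: cs_scale[OF p(1)])
    also have "\<dots> \<le> norm a * c + norm b * c" using pc by (intro add_mono mult_left_mono) auto
    also have "\<dots> \<le> c" using ab c by (metis distrib_right mult_left_le_one_le mult_right_mono mult_1)
    finally show "p (s a x + s b y) \<le> c" .
  qed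
qed

lemma seq_completeD:
  assumes "seq_complete X" "\<And>n. \<sigma> n \<in> V"
    and "\<And>p e. cs p \<Longrightarrow> e > 0 \<Longrightarrow> \<exists>N. \<forall>m\<ge>N. \<forall>n\<ge>N. p (\<sigma> m - \<sigma> n) < e"
  shows "\<exists>x. limitin X \<sigma> x sequentially"
proof -
  have "\<exists>N. \<forall>m\<ge>N. \<forall>n\<ge>N. \<sigma> m - \<sigma> n \<in> U" if U: "zero_nhd X U" for U
  proof -
    obtain p where p: "cs p" "{x \<in> V. p x < 1} \<subseteq> U" using U by (rule zero_nhd_cs)
    with assms(3)[of p 1] obtain N where "\<forall>m\<ge>N. \<forall>n\<ge>N. p (\<sigma> m - \<sigma> n) < 1" by auto
    then show ?thesis using p(2) assms(2) by (intro exI[of _ N]) auto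
  qed
  moreover have "range \<sigma> \<subseteq> V" using assms(2) by auto
  ultimately show ?thesis using assms(1) by (simp add: seq_complete_def)
qed

end

section \<open>The Hahn-Banach theorem\<close>

context lc_space
begin

definition sublinear :: "('a \<Rightarrow> real) \<Rightarrow> bool" where
  "sublinear q \<longleftrightarrow> (\<forall>x\<in>V. \<forall>y\<in>V. q (x + y) \<le> q x + q y) \<and>
    (\<forall>t\<ge>0. \<forall>x\<in>V. q (s (of_real t) x) = t * q x) \<and> (\<forall>x. x \<notin> V \<longrightarrow> q x = 0)"

text \<open>
  Linear functionals arise as minimal sublinear ones: by minimality \<open>tilt q y = q\<close> for all \<open>y\<close>, and
  \<open>tilt q y x \<le> q (x + y) - q y\<close> then makes \<open>q\<close> additive.
\<close>

definition tilt :: "('a \<Rightarrow> real) \<Rightarrow> 'a \<Rightarrow> 'a \<Rightarrow> real" where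
  "tilt q y x = (if x \<in> V then Inf ((\<lambda>t. q (x + s (of_real t) y) - t * q y) ` {0..}) else 0)"

lemma sublinearD:
  assumes "sublinear q"
  shows "x \<in> V \<Longrightarrow> y \<in> V \<Longrightarrow> q (x + y) \<le> q x + q y"
    "x \<in> V \<Longrightarrow> t \<ge> 0 \<Longrightarrow> q (s (of_real t) x) = t * q x" "x \<notin> V \<Longrightarrow> q x = 0" "q 0 = 0"
    "x \<in> V \<Longrightarrow> - q (- x) \<le> q x"
proof -
  show 1: "x \<in> V \<Longrightarrow> y \<in> V \<Longrightarrow> q (x + y) \<le> q x + q y" for x y
    using assms by (auto simp: sublinear_def)
  show 2: "x \<in> V \<Longrightarrow> t \<ge> 0 \<Longrightarrow> q (s (of_real t) x) = t * q x" for x t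
    using assms by (auto simp: sublinear_def)
  show "x \<notin> V \<Longrightarrow> q x = 0"
    using assms by (auto simp: sublinear_def)
  show 0: "q 0 = 0" using 2[of 0 0] by simp
  show "x \<in> V \<Longrightarrow> - q (- x) \<le> q x" using 1[of x "- x"] 0 by simp
qed

text \<open>Positive homogeneity needs only the inequality: applying it with 1/t to the point t x
  gives the reverse one.\<close>

lemma sublinearI_le:
  assumes 1: "\<And>x y. x \<in> V \<Longrightarrow> y \<in> V \<Longrightarrow> q (x + y) \<le> q x + q y"
    and 2: "\<And>x t. x \<in> V \<Longrightarrow> t > 0 \<Longrightarrow> q (s (of_real t) x) \<le> t * q x"
    and 3: "\<And>x. x \<notin> V \<Longrightarrow> q x = 0" and 4: "q 0 = 0"
  shows "sublinear q"
proof -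
  have "q (s (of_real t) x) = t * q x" if x: "x \<in> V" and t: "t \<ge> 0" for t x
  proof (cases "t = 0")
    case False
    with t have t: "t > 0" by simp
    have "q x = q (s (of_real (1 / t)) (s (of_real t) x))"
      using t by (simp flip: of_real_mult del: of_real_divide)
    also have "\<dots> \<le> (1 / t) * q (s (of_real t) x)" using x t by (intro 2) auto
    finally have "t * q x \<le> q (s (of_real t) x)" using t by (simp add: pos_le_divide_eq mult.commute)
    with 2[OF x t] show ?thesis by simp
  qed (simp add: 4)
  then show ?thesis using 1 3 by (auto simp: sublinear_def)
qed

lemma tilt:
  assumes q: "sublinear q" and y: "y \<in> V"
  shows "sublinear (tilt q y)" "tilt q y \<le> q" "\<And>x. x \<in> V \<Longrightarrow> tilt q y x \<le> q (x + y) - q y"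
proof -
  note D = sublinearD[OF q]
  \<comment> \<open>This is the lower bound, uniform in t, that keeps the infimum in
    \<open>tilt\<close> finite; it comes from t q(y) = q(t y) \<le> q(x + t y) + q(-x).\<close>
  have low: "- q (- x) \<le> q (x + s (of_real t) y) - t * q y" if "x \<in> V" "t \<ge> 0" for x t
    using D(1)[of "x + s (of_real t) y" "- x"] D(2)[OF y that(2)] that y by simp
  have bdd: "bdd_below ((\<lambda>t. q (x + s (of_real t) y) - t * q y) ` {0..})" if "x \<in> V" for x
    using low[OF that] by (intro bdd_belowI[of _ "- q (- x)"]) auto
  have le: "tilt q y x \<le> q (x + s (of_real t) y) - t * q y" if "x \<in> V" "t \<ge> 0" for x t
    unfolding tilt_def using that bdd[OF that(1)] by (auto intro!: cInf_lower)
  have ex: "\<exists>t\<ge>0. q (x + s (of_real t) y) - t * q y < r" if "x \<in> V" "tilt q y x < r" for x r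
    using cInf_lessD[of "(\<lambda>t. q (x + s (of_real t) y) - t * q y) ` {0..}" r] that
    by (auto simp: tilt_def)
  show "tilt q y x \<le> q (x + y) - q y" if "x \<in> V" for x using le[OF that, of 1] by simp
  show "tilt q y \<le> q"
  proof (rule le_funI)
    show "tilt q y x \<le> q x" for x
      using le[of x 0] D(3) by (cases "x \<in> V") (auto simp: tilt_def)
  qed
  show "sublinear (tilt q y)"
  proof (rule sublinearI_le)
    fix x z assume xz: "x \<in> V" "z \<in> V"
    show "tilt q y (x + z) \<le> tilt q y x + tilt q y z"
    proof (rule field_le_epsilon)
      fix e :: real assume "e > 0"
      then obtain t r where t: "t \<ge> 0" "q (x + s (of_real t) y) - t * q y < tilt q y x + e / 2"
        and r: "r \<ge> 0" "q (z + s (of_real r) y) - r * q y < tilt q y z + e / 2"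
        using ex[OF xz(1), of "tilt q y x + e / 2"] ex[OF xz(2), of "tilt q y z + e / 2"] by auto
      have "tilt q y (x + z) \<le> q (x + z + s (of_real (t + r)) y) - (t + r) * q y"
        using xz t r by (intro le) auto
      also have "x + z + s (of_real (t + r)) y = (x + s (of_real t) y) + (z + s (of_real r) y)"
        by (simp add: scale_left_distrib algebra_simps)
      also have "q \<dots> \<le> q (x + s (of_real t) y) + q (z + s (of_real r) y)"
        using xz y by (intro D) auto
      finally show "tilt q y (x + z) \<le> tilt q y x + tilt q y z + e"
        using t r by (simp add: algebra_simps)
    qed
  next
    fix x and c :: real assume x: "x \<in> V" and c: "c > 0"
    show "tilt q y (s (of_real c) x) \<le> c * tilt q y x"
    proof (rule field_le_epsilon)
      fix e :: real assume "e > 0"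
      then obtain t where t: "t \<ge> 0" "q (x + s (of_real t) y) - t * q y < tilt q y x + e / c"
        using ex[OF x, of "tilt q y x + e / c"] c by auto
      have "tilt q y (s (of_real c) x) \<le> q (s (of_real c) x + s (of_real (c * t)) y) - (c * t) * q y"
        using x t c by (intro le) auto
      also have "s (of_real c) x + s (of_real (c * t)) y = s (of_real c) (x + s (of_real t) y)"
        by (simp add: scale_right_distrib)
      also have "q \<dots> = c * q (x + s (of_real t) y)" using x y c by (intro D) auto
      also have "c * q (x + s (of_real t) y) - c * t * q y = c * (q (x + s (of_real t) y) - t * q y)"
        by (simp add: algebra_simps)
      also have "\<dots> \<le> c * (tilt q y x + e / c)" using t c by (intro mult_left_mono) auto
      also have "\<dots> = c * tilt q y x + e" using c by (simp add: field_simps)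
      finally show "tilt q y (s (of_real c) x) \<le> c * tilt q y x + e" .
    qed
  next
    have "(\<lambda>t. q (0 + s (of_real t) y) - t * q y) ` {0..} = {0}"
      using D(2)[OF y] by (auto simp: image_iff)
    then show "tilt q y 0 = 0" by (simp add: tilt_def)
  qed (simp add: tilt_def)
qed

lemma ex_minimal_sublinear:
  assumes q0: "sublinear q0"
  obtains r where "sublinear r" "r \<le> q0" "\<And>q. sublinear q \<Longrightarrow> q \<le> r \<Longrightarrow> q = r"
proof -
  define A where "A = {q. sublinear q \<and> q \<le> q0}"
  \<comment> \<open>The order is reversed, so that the maximal element delivered by Zorn's lemma is
    a minimal sublinear functional.\<close>
  let ?P = "\<lambda>q r :: 'a \<Rightarrow> real. r \<le> q"
  have "\<exists>m\<in>A. \<forall>a\<in>A. ?P m a \<longrightarrow> a = m"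
  proof (rule predicate_Zorn)
    show "partial_order_on A (relation_of ?P A)"
      by (rule partial_order_on_relation_ofI) auto
  next
    fix C assume C: "C \<in> Chains (relation_of ?P A)"
    then have CA: "C \<subseteq> A" and lin: "\<And>q r. q \<in> C \<Longrightarrow> r \<in> C \<Longrightarrow> q \<le> r \<or> r \<le> q"
      by (auto simp: Chains_def relation_of_def)
    show "\<exists>u\<in>A. \<forall>a\<in>C. ?P a u"
    proof (cases "C = {}")
      case True
      then show ?thesis using q0 by (auto simp: A_def)
    next
      case False
      \<comment> \<open>Members of the chain are bounded below at \<open>x\<close> by -q0(-x), so
        their pointwise infimum \<open>u\<close> is finite and can serve as lower bound of the
        chain.\<close>
      have low: "- q0 (- x) \<le> q x" if "q \<in> C" "x \<in> V" for q x
      proof -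
        have "q (- x) \<le> q0 (- x)" "- q (- x) \<le> q x"
          using that CA sublinearD(5) by (auto simp: A_def le_fun_def)
        then show ?thesis by linarith
      qed
      define u where "u x = (if x \<in> V then Inf ((\<lambda>q. q x) ` C) else 0)" for x
      have le: "u x \<le> q x" if "q \<in> C" for q x
      proof (cases "x \<in> V")
        case True
        then have "bdd_below ((\<lambda>q. q x) ` C)" using low by (intro bdd_belowI[of _ "- q0 (- x)"]) auto
        then show ?thesis using True that unfolding u_def by (auto intro: cInf_lower)
      next
        case False
        then show ?thesis using that CA sublinearD(3)[of q x] by (auto simp: A_def u_def)
      qed
      have ex: "\<exists>q\<in>C. q x < r" if "x \<in> V" "u x < r" for x r
        using cInf_lessD[of "(\<lambda>q. q x) ` C" r] that False by (auto simp: u_def)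
      have "sublinear u"
      proof (rule sublinearI_le)
        fix x y assume xy: "x \<in> V" "y \<in> V"
        show "u (x + y) \<le> u x + u y"
        proof (rule field_le_epsilon)
          fix e :: real assume "e > 0"
          then obtain q q' where q: "q \<in> C" "q x < u x + e / 2" "q' \<in> C" "q' y < u y + e / 2"
            using ex[OF xy(1), of "u x + e / 2"] ex[OF xy(2), of "u y + e / 2"] by auto
          \<comment> \<open>Since the chain is totally ordered, the smaller of \<open>q\<close> and
            \<open>q'\<close> controls both points at once.\<close>
          then obtain r where r: "r \<in> C" "r \<le> q" "r \<le> q'" using lin[of q q'] by auto
          then have "u (x + y) \<le> r x + r y"
            using le[OF r(1), of "x + y"] CA sublinearD(1)[of r] xy by (force simp: A_def)
          also have "\<dots> \<le> q x + q' y" using r by (intro add_mono) (auto simp: le_fun_def)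
          finally show "u (x + y) \<le> u x + u y + e" using q by simp
        qed
      next
        fix x and t :: real assume x: "x \<in> V" and t: "t > 0"
        show "u (s (of_real t) x) \<le> t * u x"
        proof (rule field_le_epsilon)
          fix e :: real assume "e > 0"
          then obtain q where q: "q \<in> C" "q x < u x + e / t" using ex[OF x, of "u x + e / t"] t by auto
          have "u (s (of_real t) x) \<le> q (s (of_real t) x)" by (rule le[OF q(1)])
          also have "\<dots> = t * q x" using q CA x t sublinearD(2) by (auto simp: A_def)
          also have "\<dots> \<le> t * (u x + e / t)" using q t by (intro mult_left_mono) auto
          also have "\<dots> = t * u x + e" using t by (simp add: field_simps)
          finally show "u (s (of_real t) x) \<le> t * u x + e" .
        qed
      next
        have "(\<lambda>q. q 0) ` C = {0}" using CA sublinearD(4) False by (fastforce simp: A_def)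
        then show "u 0 = 0" by (simp add: u_def)
      qed (simp add: u_def)
      moreover obtain q where "q \<in> C" using False by blast
      then have "u \<le> q" "q \<le> q0" using le CA by (auto simp: A_def le_fun_def)
      then have "u \<le> q0" by (rule order_trans)
      ultimately show ?thesis using le by (auto simp: A_def le_fun_def)
    qed
  qed
  then obtain r where r: "r \<in> A" "\<And>q. q \<in> A \<Longrightarrow> q \<le> r \<Longrightarrow> q = r" by blast
  show ?thesis
  proof (rule that[of r])
    show "sublinear r" "r \<le> q0" using r by (auto simp: A_def)
    show "q = r" if "sublinear q" "q \<le> r" for q
      using that r by (auto simp: A_def intro: order_trans)
  qed
qed

text \<open>The minimal functional is sought below \<open>tilt p' x0\<close> instead of
  \<open>p'\<close>: tilting forces the value at -x0 to be at most p'(0) - p'(x0) = -p(x0), which is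
  the norming condition at x0. \<open>p'\<close> cuts \<open>p\<close> off outside the carrier
  because \<open>sublinear\<close> asks for zero there.\<close>

lemma Hahn_Banach_real:
  assumes p: "cs p" and x0: "x0 \<in> V"
  obtains r where "\<And>x y. x \<in> V \<Longrightarrow> y \<in> V \<Longrightarrow> r (x + y) = r x + r y"
    "\<And>x t. x \<in> V \<Longrightarrow> r (s (of_real t) x) = t * r x" "\<And>x. x \<in> V \<Longrightarrow> r x \<le> p x" "p x0 \<le> r x0"
proof -
  define p' where "p' x = (if x \<in> V then p x else 0)" for x
  have p': "sublinear p'"
    using cs_add[OF p] cs_scale[OF p] by (auto simp: sublinear_def p'_def)
  note q0 = tilt[OF p' x0]
  obtain r where r: "sublinear r" "r \<le> tilt p' x0" and min: "\<And>q. sublinear q \<Longrightarrow> q \<le> r \<Longrightarrow> q = r"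
    using ex_minimal_sublinear[OF q0(1)] by metis
  note D = sublinearD[OF r(1)]
  have add: "r (x + y) = r x + r y" if xy: "x \<in> V" "y \<in> V" for x y
  proof -
    have "tilt r y = r" using tilt[OF r(1) xy(2)] by (intro min) auto
    then have "r x \<le> r (x + y) - r y" using tilt(3)[OF r(1) xy(2) xy(1)] by simp
    with D(1)[OF xy] show ?thesis by simp
  qed
  have neg: "r (- x) = - r x" if "x \<in> V" for x using add[of x "- x"] D(4) that by simp
  show ?thesis
  proof
    show "r (x + y) = r x + r y" if "x \<in> V" "y \<in> V" for x y using add that .
    show "r (s (of_real t) x) = t * r x" if "x \<in> V" for x t
    proof (cases "t \<ge> 0")
      case False
      then show ?thesis using D(2)[of "- x" "- t"] neg that by simp
    qed (use D(2) that in simp)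
    show "r x \<le> p x" if "x \<in> V" for x
      using le_funD[OF r(2), of x] le_funD[OF q0(2), of x] that by (simp add: p'_def)
    have "r (- x0) \<le> tilt p' x0 (- x0)" using r(2) by (simp add: le_fun_def)
    also have "\<dots> \<le> - p x0" using q0(3)[of "- x0"] x0 p by (simp add: p'_def)
    finally show "p x0 \<le> r x0" using neg x0 by simp
  qed
qed

lemma Hahn_Banach:
  assumes p: "cs p" and x0: "x0 \<in> V"
  obtains \<phi> where "\<phi> \<in> dual s X" "\<And>x. x \<in> V \<Longrightarrow> norm (\<phi> x) \<le> p x" "norm (\<phi> x0) = p x0"
proof -
  obtain r where add: "\<And>x y. x \<in> V \<Longrightarrow> y \<in> V \<Longrightarrow> r (x + y) = r x + r y"
    and sc: "\<And>x t. x \<in> V \<Longrightarrow> r (s (of_real t) x) = t * r x"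
    and le: "\<And>x. x \<in> V \<Longrightarrow> r x \<le> p x" and ge: "p x0 \<le> r x0"
    using Hahn_Banach_real[OF p x0] by metis
  have neg: "r (- x) = - r x" if "x \<in> V" for x using sc[OF that, of "-1"] by simp
  show ?thesis using real_or_complex[where 'a='k]
  proof
    assume "\<forall>x::'k. \<exists>a. x = a *\<^sub>R 1"
    then have real: "\<exists>a. c = of_real a" for c :: 'k by (simp add: of_real_def)
    define \<phi> where "\<phi> x = (if x \<in> V then of_real (r x) else 0 :: 'k)" for x
    have \<phi>_le: "norm (\<phi> x) \<le> p x" if "x \<in> V" for x
      using le[of x] le[of "- x"] neg cs_minus[OF p] that by (simp add: \<phi>_def abs_le_iff)
    have "\<phi> (s c x) = c * \<phi> x" if "x \<in> V" for c x
      using real[of c] sc that by (auto simp: \<phi>_def)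
    then have "\<phi> \<in> dual s X"
      using p \<phi>_le unfolding dual_iff linear_map_on_def by (auto simp: \<phi>_def add)
    moreover have "norm (\<phi> x0) = p x0"
      using \<phi>_le[OF x0] ge x0 by (simp add: \<phi>_def)
    ultimately show ?thesis using that \<phi>_le by blast
  next
    assume "\<exists>i::'k. i * i = - 1 \<and> (\<forall>x. \<exists>a b. x = a *\<^sub>R 1 + b *\<^sub>R i) \<and>
          (\<forall>a b. norm (a *\<^sub>R 1 + b *\<^sub>R i) = sqrt (a\<^sup>2 + b\<^sup>2))"
    then obtain i :: 'k where i: "i * i = - 1" and ab: "\<And>x. \<exists>a b. x = of_real a + i * of_real b"
      and nrm: "\<And>a b. norm (of_real a + i * of_real b) = sqrt (a\<^sup>2 + b\<^sup>2)"
      by (auto simp: scaleR_conv_of_real mult.commute)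
    \<comment> \<open>The standard complexification: a complex linear functional is recovered from
      its real part r as r(x) - i r(i x).\<close>
    define \<phi> where "\<phi> x = (if x \<in> V then of_real (r x) - i * of_real (r (s i x)) else 0)" for x
    have \<phi>_add: "\<phi> (x + y) = \<phi> x + \<phi> y" if "x \<in> V" "y \<in> V" for x y
      using that by (simp add: \<phi>_def add scale_right_distrib algebra_simps)
    have \<phi>_real: "\<phi> (s (of_real a) x) = of_real a * \<phi> x" if "x \<in> V" for x a
      using that sc[of "s i x" a] by (simp add: \<phi>_def sc scale_left_commute algebra_simps)
    have \<phi>_i: "\<phi> (s i x) = i * \<phi> x" if "x \<in> V" for x
    proof -
      have "i * (i * z) = - z" for z using i by (simp flip: mult.assoc)
      then show ?thesis
        using that neg[of x] by (simp add: \<phi>_def i right_diff_distrib)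
    qed
    have \<phi>_sc: "\<phi> (s c x) = c * \<phi> x" if "x \<in> V" for c x
    proof -
      obtain a b where c: "c = of_real a + i * of_real b" using ab by blast
      have "\<phi> (s c x) = \<phi> (s (of_real a) x) + \<phi> (s i (s (of_real b) x))"
        using that by (simp add: c scale_left_distrib \<phi>_add)
      also have "\<phi> (s i (s (of_real b) x)) = i * (of_real b * \<phi> x)"
        using \<phi>_i[of "s (of_real b) x"] \<phi>_real[OF that, of b] that by (simp del: scale_scale)
      also have "\<phi> (s (of_real a) x) + i * (of_real b * \<phi> x) = c * \<phi> x"
        using that by (simp add: \<phi>_real c algebra_simps)
      finally show ?thesis .
    qed
    have re: "\<bar>r x\<bar> \<le> norm (\<phi> x)" if "x \<in> V" for x
      using nrm[of "r x" "- r (s i x)"] that by (simp add: \<phi>_def real_le_rsqrt)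
    have \<phi>_le: "norm (\<phi> x) \<le> p x" if x: "x \<in> V" for x
    proof (cases "\<phi> x = 0")
      case False
      \<comment> \<open>\<open>c\<close> rotates \<phi> x onto the nonnegative reals. That r(c x)
        then equals the norm is read off the norm formula, by applying it to a combination that is
        zero.\<close>
      define c where "c = of_real (norm (\<phi> x)) / \<phi> x"
      have c: "norm c = 1" using False by (simp add: c_def norm_divide)
      have "of_real (norm (\<phi> x)) = \<phi> (s c x)" using x False by (simp add: \<phi>_sc c_def)
      also have "\<dots> = of_real (r (s c x)) - i * of_real (r (s i (s c x)))"
        using x by (simp add: \<phi>_def)
      finally have "of_real (norm (\<phi> x) - r (s c x)) + i * of_real (r (s i (s c x))) = 0"
        by (simp add: algebra_simps)
      then have "sqrt ((norm (\<phi> x) - r (s c x))\<^sup>2 + (r (s i (s c x)))\<^sup>2) = 0"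
        using nrm[of "norm (\<phi> x) - r (s c x)" "r (s i (s c x))"] by simp
      then have "norm (\<phi> x) = r (s c x)" by (simp add: sum_power2_eq_zero_iff)
      also have "\<dots> \<le> p x" using le[of "s c x"] x c cs_scale[OF p x, of c] by simp
      finally show ?thesis .
    qed (use cs_nonneg[OF p x] in simp)
    have "\<phi> \<in> dual s X"
      using p \<phi>_le \<phi>_add \<phi>_sc unfolding dual_iff linear_map_on_def by (auto simp: \<phi>_def)
    moreover have "norm (\<phi> x0) = p x0"
      using \<phi>_le[OF x0] re[OF x0] ge by simp
    ultimately show ?thesis using that \<phi>_le by blast
  qed
qed

end

section \<open>Frechet-Schwartz spaces are semi-Montel\<close>

context lc_space
begin

text \<open>Together with absolute convexity of the hull this provides the absolutely convex compact
  sets that define the topology of \<open>dual_kappa\<close>.\<close>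

lemma semi_montelD:
  assumes "semi_montel s X" "bounded_in s X B"
  shows "compactin X (polar_hull B)"
proof -
  have "compactin X (X closure_of polar_hull B)"
    using assms bounded_polar_hull by (auto simp: semi_montel_def)
  then show ?thesis using closedin_polar_hull by (simp add: closure_of_closedin)
qed

lemma frechet_metric:
  assumes "frechet_space s X"
  obtains d where "Metric_space V d" "Metric_space.mtopology V d = X" "Metric_space.mcomplete V d"
    "\<forall>x\<in>V. \<forall>y\<in>V. d x y = d (x - y) 0"
    "\<forall>e>0. zero_nhd X {x \<in> V. d x 0 < e}"
proof -
  obtain d where M: "Metric_space V d" and top: "Metric_space.mtopology V d = X"
    and mc: "Metric_space.mcomplete V d"
    and inv: "\<forall>x\<in>V. \<forall>y\<in>V. \<forall>z\<in>V. d (x + z) (y + z) = d x y"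
    using assms unfolding frechet_space_def by blast
  interpret Metric_space V d by (rule M)
  show ?thesis
  proof (rule that[OF M top mc])
    show "\<forall>x\<in>V. \<forall>y\<in>V. d x y = d (x - y) 0"
    proof (intro ballI)
      show "d x y = d (x - y) 0" if "x \<in> V" "y \<in> V" for x y
        using inv[rule_format, of x y "- y"] that by simp
    qed
    show "\<forall>e>0. zero_nhd X {x \<in> V. d x 0 < e}"
    proof (intro allI impI)
      fix e :: real assume "e > 0"
      have "openin X (mball 0 e)" using openin_mball top by metis
      moreover have "mball 0 e \<subseteq> {x \<in> V. d x 0 < e}" by (auto simp: commute)
      ultimately show "zero_nhd X {x \<in> V. d x 0 < e}" using \<open>e > 0\<close> unfolding zero_nhd_def
        by (intro conjI exI[of _ "mball 0 e"]) auto
    qed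
  qed
qed

lemma frechet_seq_complete:
  assumes "frechet_space s X"
  shows "seq_complete X"
  unfolding seq_complete_def
proof (intro allI impI, elim conjE)
  obtain d where M: "Metric_space V d" and top: "Metric_space.mtopology V d = X"
    and mc: "Metric_space.mcomplete V d"
    and d: "\<forall>x\<in>V. \<forall>y\<in>V. d x y = d (x - y) 0"
    and nhd: "\<forall>e>0. zero_nhd X {x \<in> V. d x 0 < e}"
    by (rule frechet_metric[OF assms])
  interpret Metric_space V d by (rule M)
  fix \<sigma> :: "nat \<Rightarrow> 'a"
  assume \<sigma>: "range \<sigma> \<subseteq> V"
    and C: "\<forall>U. zero_nhd X U \<longrightarrow> (\<exists>N. \<forall>m\<ge>N. \<forall>n\<ge>N. \<sigma> m - \<sigma> n \<in> U)"
  have "MCauchy \<sigma>"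
    unfolding MCauchy_def
  proof (intro conjI allI impI)
    fix e :: real assume "e > 0"
    then have "zero_nhd X {x \<in> V. d x 0 < e}" using nhd by simp
    from C[rule_format, OF this] obtain N where "\<forall>m\<ge>N. \<forall>n\<ge>N. \<sigma> m - \<sigma> n \<in> {x \<in> V. d x 0 < e}"
      by (rule exE)
    then have "d (\<sigma> n) (\<sigma> n') < e" if "N \<le> n" "N \<le> n'" for n n'
      using that d[rule_format, of "\<sigma> n" "\<sigma> n'"] \<sigma> by (simp add: range_subsetD)
    then show "\<exists>N. \<forall>n n'. N \<le> n \<longrightarrow> N \<le> n' \<longrightarrow> d (\<sigma> n) (\<sigma> n') < e" by blast
  qed (rule \<sigma>)
  then show "\<exists>x. limitin X \<sigma> x sequentially" using mc top by (simp add: mcomplete_def)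
qed

text \<open>If \<open>B\<close> lies in r W and W is covered by finitely many translates of (1/r) U,
  then \<open>B\<close> is covered by finitely many translates of U. So bounded sets are totally
  bounded, and completeness of the metric gives compact closures.\<close>

lemma frechet_schwartz_semi_montel:
  assumes F: "frechet_space s X" and S: "schwartz_space s X"
  shows "semi_montel s X"
  unfolding semi_montel_def
proof (intro conjI allI impI)
  show "lcHs s X" by (rule lcHs)
  obtain d where M: "Metric_space V d" and top: "Metric_space.mtopology V d = X"
    and mc: "Metric_space.mcomplete V d"
    and d: "\<forall>x\<in>V. \<forall>y\<in>V. d x y = d (x - y) 0"
    and nhd: "\<forall>e>0. zero_nhd X {x \<in> V. d x 0 < e}"
    by (rule frechet_metric[OF F])
  interpret Metric_space V d by (rule M)
  fix B assume B: "bounded_in s X B"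
  then have BV: "B \<subseteq> V" by (simp add: bounded_in_def)
  have "mtotally_bounded B"
    unfolding mtotally_bounded_def
  proof (intro allI impI)
    fix e :: real assume e: "e > 0"
    obtain U where U: "zero_nhd X U" "absolutely_convex s U" "U \<subseteq> {x \<in> V. d x 0 < e / 2}"
      using zero_nhd_absolutely_convex[OF nhd[rule_format, of "e / 2"]] e by auto
    from S[unfolded schwartz_space_def, THEN conjunct2, rule_format, OF conjI[OF U(1,2)]]
    obtain W where W: "zero_nhd X W"
      "\<forall>\<epsilon>>0. \<exists>A. finite A \<and> A \<subseteq> W \<and> W \<subseteq> (\<Union>a\<in>A. (\<lambda>x. a + s (of_real \<epsilon>) x) ` U)"
      by (elim exE conjE)
    obtain r where r: "r > 0" "B \<subseteq> s (of_real r) ` W"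
      using B W(1) unfolding bounded_in_def by blast
    obtain A where A: "finite A" "A \<subseteq> W" "W \<subseteq> (\<Union>a\<in>A. (\<lambda>x. a + s (of_real (1 / r)) x) ` U)"
      using W(2)[rule_format, of "1 / r"] r(1) by auto
    have AV: "A \<subseteq> V" using A(2) W(1) by (auto simp: zero_nhd_def)
    \<comment> \<open>The centres r a of the cover need not lie in \<open>B\<close>, as total
      boundedness demands here. Each useful one is replaced by a point of \<open>B\<close> near it,
      which is why the radius e / 2 was chosen.\<close>
    define P where "P a b \<longleftrightarrow> b \<in> B \<and> d b (s (of_real r) a) < e / 2" for a b
    define c where "c a = (SOME b. P a b)" for a
    have near: "\<exists>a\<in>A. P a b" if b: "b \<in> B" for b
    proof -
      obtain w where w: "w \<in> W" "b = s (of_real r) w" using r b by blast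
      then obtain a u where a: "a \<in> A" "u \<in> U" "w = a + s (of_real (1 / r)) u" using A by blast
      have "s (of_real r) (s (of_real (1 / r)) u) = u"
        using r(1) by (simp flip: of_real_mult del: of_real_divide)
      then have "b - s (of_real r) a = u" using a w by (simp add: scale_right_distrib del: scale_scale)
      moreover have "d u 0 < e / 2" using a U by blast
      ultimately have "d b (s (of_real r) a) < e / 2"
        using d[rule_format, of b "s (of_real r) a"] b BV a(1) AV by (auto simp: subset_iff)
      then show ?thesis using a b by (auto simp: P_def)
    qed
    show "\<exists>K. finite K \<and> K \<subseteq> B \<and> B \<subseteq> (\<Union>x\<in>K. mball x e)"
    proof (intro exI conjI)
      show "finite (c ` {a \<in> A. \<exists>b. P a b})" using A by simp
      have c: "P a (c a)" if "P a b" for a b unfolding c_def using that by (rule someI)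
      then show "c ` {a \<in> A. \<exists>b. P a b} \<subseteq> B" by (auto simp: P_def)
      show "B \<subseteq> (\<Union>x\<in>c ` {a \<in> A. \<exists>b. P a b}. mball x e)"
      proof
        fix b assume b: "b \<in> B"
        then obtain a where a: "a \<in> A" "P a b" using near by blast
        have *: "c a \<in> B" "d (c a) (s (of_real r) a) < e / 2" "d b (s (of_real r) a) < e / 2"
          using c[OF a(2)] a(2) by (auto simp: P_def)
        have "d (c a) b \<le> d (c a) (s (of_real r) a) + d (s (of_real r) a) b"
          using * b BV a(1) AV by (intro triangle) auto
        also have "\<dots> < e" using * by (simp add: commute)
        finally have "b \<in> mball (c a) e" using * b BV by auto
        then show "b \<in> (\<Union>x\<in>c ` {a \<in> A. \<exists>b. P a b}. mball x e)" using a by blast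
      qed
    qed
  qed
  then show "compactin X (X closure_of B)"
    using mtotally_bounded_eq_compact_closure_of[OF mc] top by simp
qed

end

section \<open>Equicontinuous bases and interpolation\<close>

context lc_space
begin

section \<open>Operations on functionals and separation of points by the dual\<close>

lemma cs_plus:
  assumes p: "cs p" and q: "cs q"
  shows "cs (\<lambda>x. p x + q x)"
proof -
  have "zero_nhd X {x \<in> V. p x + q x < e}" if "e > 0" for e
    by (rule zero_nhd_superset[OF zero_nhd_Int[OF cs_zero_nhd[OF p, of "e / 2"] cs_zero_nhd[OF q, of "e / 2"]]])
      (use that in auto)
  then show ?thesis
    using cs_add[OF p] cs_add[OF q] cs_scale[OF p] cs_scale[OF q]
    unfolding cseminorm_def by (simp add: distrib_left add_mono add.assoc) (smt (verit, best))
qed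

lemma dual_add: "\<phi> \<in> dual s X \<Longrightarrow> \<psi> \<in> dual s X \<Longrightarrow> \<phi> + \<psi> \<in> dual s X"
proof -
  assume \<phi>: "\<phi> \<in> dual s X" and \<psi>: "\<psi> \<in> dual s X"
  obtain p where p: "cs p" "\<And>x. x \<in> V \<Longrightarrow> norm (\<phi> x) \<le> p x" using dual_bounded[OF \<phi>] by blast
  obtain q where q: "cs q" "\<And>x. x \<in> V \<Longrightarrow> norm (\<psi> x) \<le> q x" using dual_bounded[OF \<psi>] by blast
  have "norm ((\<phi> + \<psi>) x) \<le> p x + q x" if "x \<in> V" for x
    using norm_triangle_ineq[of "\<phi> x" "\<psi> x"] p(2)[OF that] q(2)[OF that] by simp
  then show ?thesis using cs_plus[OF p(1) q(1)] dualD[OF \<phi>] dualD[OF \<psi>]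
    unfolding dual_iff linear_map_on_def by (auto simp: algebra_simps)
qed

lemma dual_scale: "\<phi> \<in> dual s X \<Longrightarrow> pw (*) c \<phi> \<in> dual s X"
proof -
  assume \<phi>: "\<phi> \<in> dual s X"
  obtain p where p: "cs p" "\<And>x. x \<in> V \<Longrightarrow> norm (\<phi> x) \<le> p x" using dual_bounded[OF \<phi>] by blast
  \<comment> \<open>The additional 1 keeps the factor positive when c = 0, as \<open>cs_mult\<close>
    requires.\<close>
  have "norm (pw (*) c \<phi> x) \<le> (norm c + 1) * p x" if "x \<in> V" for x
    using p(2)[OF that] cs_nonneg[OF p(1) that]
    by (simp add: pw_def norm_mult distrib_right add_increasing2 mult_left_mono)
  moreover have "cs (\<lambda>x. (norm c + 1) * p x)"
    using p(1) by (intro cs_mult) (auto intro: add_nonneg_pos)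
  ultimately show ?thesis using dualD[OF \<phi>]
    unfolding dual_iff linear_map_on_def by (auto simp: pw_def algebra_simps)
qed

lemma dual_zero: "0 \<in> dual s X"
proof -
  have "zero_nhd X V" by (auto simp: zero_nhd_def intro: exI[of _ V])
  then have "cs (\<lambda>x. 0)" by (auto simp: cseminorm_def)
  then show ?thesis unfolding dual_iff linear_map_on_def by auto
qed

lemma dual_separates:
  assumes x: "x \<in> V" "y \<in> V" and "\<And>\<phi>. \<phi> \<in> dual s X \<Longrightarrow> \<phi> x = \<phi> y"
  shows "x = y"
proof -
  have "p (x - y) = 0" if p: "cs p" for p
  proof -
    obtain \<phi> where "\<phi> \<in> dual s X" "norm (\<phi> (x - y)) = p (x - y)"
      using Hahn_Banach[OF p, of "x - y"] x by auto
    then show ?thesis using assms(3)[of \<phi>] x dualD(4)[of \<phi> x y] by simp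
  qed
  then have "x - y = 0" using x by (intro cs_separates) auto
  then show ?thesis by simp
qed

text \<open>For a continuous seminorm \<open>p\<close> this is the polar of the ball p \<le> 1,
  written without the ball. Every equicontinuous subset of the dual lies in such a polar.\<close>

definition polar :: "('a \<Rightarrow> real) \<Rightarrow> ('a \<Rightarrow> 'k) set" where
  "polar p = {\<phi> \<in> dual s X. \<forall>x\<in>V. norm (\<phi> x) \<le> p x}"

lemma zero_in_polar: "cs p \<Longrightarrow> 0 \<in> polar p"
  using dual_zero cs_nonneg by (auto simp: polar_def)

end

section \<open>Expansion operators of an equicontinuous Schauder basis\<close>

locale lc_basis = lc_space s X
  for s :: "'k::real_or_complex \<Rightarrow> 'a::ab_group_add \<Rightarrow> 'a" and X +
  fixes b :: "nat \<Rightarrow> 'a" and T :: "nat \<Rightarrow> 'a \<Rightarrow> 'k"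
  assumes basis: "equicontinuous_schauder_basis s X b T"
begin

definition P :: "nat \<Rightarrow> 'a \<Rightarrow> 'a" where "P k x = (\<Sum>n\<le>k. s (T n x) (b n))"

lemma schauder: "schauder_basis s X b T"
  using basis by (simp add: equicontinuous_schauder_basis_def)

lemma b_V [simp]: "b n \<in> V"
  using schauder by (auto simp: schauder_basis_def)

lemma T_dual: "T n \<in> dual s X"
  using schauder by (auto simp: schauder_basis_def)

lemmas T_lin = dualD[OF T_dual]

lemma P_V [simp]: "P k x \<in> V"
  unfolding P_def by (intro V_sum V_closed b_V)

lemma expansion_iff:
  "x \<in> V \<Longrightarrow> limitin X (\<lambda>k. \<Sum>n\<le>k. s (a n) (b n)) x sequentially \<longleftrightarrow> a = (\<lambda>n. T n x)"
  using schauder by (auto simp: schauder_basis_def)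

lemma P_limit: "x \<in> V \<Longrightarrow> limitin X (\<lambda>k. P k x) x sequentially"
  unfolding P_def by (simp add: expansion_iff)

lemma coefficient:
  assumes "limitin X (\<lambda>k. \<Sum>n\<le>k. s (a n) (b n)) x sequentially"
  shows "T n x = a n"
  using expansion_iff[OF limitin_topspace[OF assms], of a] assms by simp

lemma T_inject:
  assumes x: "x \<in> V" "x' \<in> V" and T: "\<And>n. T n x = T n x'"
  shows "x = x'"
proof -
  have "P k x = P k x'" for k by (simp add: P_def T)
  then have "limitin X (\<lambda>k. P k x) x' sequentially" using P_limit[OF x(2)] by simp
  moreover have "Hausdorff_space X" using lcHs by (simp add: lcHs_def)
  ultimately show ?thesis
    using P_limit[OF x(1)] limitin_Hausdorff_unique by (metis trivial_limit_sequentially)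
qed

text \<open>Biorthogonality comes from uniqueness of the expansion: the partial sums with Kronecker
  coefficients are eventually constant, equal to \<open>b m\<close>.\<close>

lemma T_b: "T n (b m) = (if n = m then 1 else 0)"
proof -
  have "(\<Sum>n\<le>k. s (if n = m then 1 else 0) (b n)) = (if m \<le> k then b m else 0)" for k
    by (simp add: if_distrib[of "\<lambda>c. s c _"] sum.delta' cong: if_cong)
  moreover have "\<forall>\<^sub>F k in sequentially. (if m \<le> k then b m else 0) = b m"
    using eventually_ge_at_top[of m] by eventually_elim simp
  ultimately have "limitin X (\<lambda>k. \<Sum>n\<le>k. s (if n = m then 1 else 0) (b n)) (b m) sequentially"
    by (intro limitin_eventually) simp_all
  from coefficient[OF this] show ?thesis .
qed

lemma P_b: "P k (b m) = (if m \<le> k then b m else 0)"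
  by (simp add: P_def T_b if_distrib[of "\<lambda>c. s c _"] sum.delta' cong: if_cong)

lemma P_add: "x \<in> V \<Longrightarrow> y \<in> V \<Longrightarrow> P k (x + y) = P k x + P k y"
  by (simp add: P_def T_lin scale_left_distrib sum.distrib)

lemma P_scale: "x \<in> V \<Longrightarrow> P k (s c x) = s c (P k x)"
  by (simp add: P_def T_lin scale_sum_right)

lemma P_diff: "x \<in> V \<Longrightarrow> y \<in> V \<Longrightarrow> P k (x - y) = P k x - P k y"
  by (simp add: P_def T_lin scale_left_diff_distrib sum_subtractf)

text \<open>Equicontinuity becomes one seminorm \<open>q\<close> dominating all p o P k
  simultaneously; homogeneity removes the restriction to a neighbourhood.\<close>

lemma P_equicontinuous:
  assumes p: "cs p"
  obtains q where "cs q" "\<And>k x. x \<in> V \<Longrightarrow> p (P k x) \<le> q x"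
proof -
  have eq: "equicontinuous X X (range P)"
    using basis by (simp add: equicontinuous_schauder_basis_def P_def[abs_def])
  from eq[unfolded equicontinuous_def, rule_format, OF cs_zero_nhd[OF p zero_less_one]]
  obtain W where W: "zero_nhd X W" "\<forall>h\<in>range P. h ` W \<subseteq> {x \<in> V. p x < 1}"
    by (elim exE conjE)
  obtain q where q: "cs q" "{x \<in> V. q x < 1} \<subseteq> W" by (rule zero_nhd_cs[OF W(1)])
  have "p (P k x) \<le> 1 * q x" if "x \<in> V" for k x
  proof (rule cs_bound_scale[OF q(1), where q = "\<lambda>x. p (P k x)"])
    show "p (P k x) \<le> 1" if x: "x \<in> V" "q x < 1" for x
    proof -
      have "P k x \<in> {x \<in> V. p x < 1}" using q(2) W(2) x by blast
      then show ?thesis by simp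
    qed
    show "p (P k (s (of_real t) x)) = t * p (P k x)" if "x \<in> V" "t > 0" for x t
      using that by (simp add: P_scale cs_scale[OF p])
  qed (use that in auto)
  then show ?thesis using that q by auto
qed

text \<open>Equicontinuous operators that converge pointwise converge uniformly on precompact sets.
  Precompactness of \<open>M\<close> is asked only with respect to the one seminorm
  \<open>q\<close>, so that the lemma applies to compact sets and also to the seminorm balls
  provided by the Schwartz property.\<close>

lemma P_uniform_Cauchy:
  assumes p: "cs p" and q: "cs q" and pq: "\<And>k x. x \<in> V \<Longrightarrow> p (P k x) \<le> q x"
    and M: "M \<subseteq> V" "\<And>\<epsilon>::real. \<epsilon> > 0 \<Longrightarrow> \<exists>A. finite A \<and> A \<subseteq> V \<and> (\<forall>x\<in>M. \<exists>a\<in>A. q (x - a) \<le> \<epsilon>)"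
    and e: "(e::real) > 0"
  shows "\<exists>N. \<forall>i\<ge>N. \<forall>j\<ge>N. \<forall>x\<in>M. p (P i x - P j x) \<le> e"
proof -
  \<comment> \<open>A quarter, because P k x is within e/4 + e/4 of the net point \<open>a\<close>,
    and \<open>i\<close> and \<open>j\<close> each contribute this once.\<close>
  obtain A where A: "finite A" "A \<subseteq> V" "\<And>x. x \<in> M \<Longrightarrow> \<exists>a\<in>A. q (x - a) \<le> e / 4"
    using M(2)[of "e / 4"] e by auto
  have "\<forall>\<^sub>F k in sequentially. p (P k a - a) < e / 4" if "a \<in> V" for a
    using P_limit[OF that, unfolded limitin_cs[OF P_V], THEN conjunct2, rule_format, OF p, of "e / 4"] e
    by simp
  then have "\<forall>\<^sub>F k in sequentially. \<forall>a\<in>A. p (P k a - a) < e / 4"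
    using A(1,2) by (intro eventually_ball_finite) auto
  then obtain N where N: "\<And>k a. k \<ge> N \<Longrightarrow> a \<in> A \<Longrightarrow> p (P k a - a) < e / 4"
    unfolding eventually_sequentially by blast
  have "p (P i x - P j x) \<le> e" if ij: "i \<ge> N" "j \<ge> N" and x: "x \<in> M" for i j x
  proof -
    obtain a where a: "a \<in> A" "q (x - a) \<le> e / 4" using A(3)[OF x] by blast
    have V: "x \<in> V" "a \<in> V" using x a M A by auto
    have 1: "p (P k x - a) \<le> e / 2" if "k \<ge> N" for k
    proof -
      have "p (P k x - a) \<le> p (P k x - P k a) + p (P k a - a)"
        using V by (intro cs_triangle p) auto
      also have "p (P k x - P k a) \<le> q (x - a)"
        using pq[of "x - a" k] V by (simp add: P_diff)
      finally show ?thesis using a(2) N[OF that a(1)] by simp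
    qed
    have "p (P i x - P j x) \<le> p (P i x - a) + p (a - P j x)"
      using V by (intro cs_triangle p) auto
    also have "p (a - P j x) = p (P j x - a)" using V p by (intro cs_diff_commute) auto
    finally show ?thesis using 1[OF ij(1)] 1[OF ij(2)] by simp
  qed
  then show ?thesis by blast
qed

end

section \<open>E-valued partial sums and the interpolation criterion common to both cases\<close>

locale lc_basis_pair = lc_basis s X b T + E: lc_space sE E
  for s :: "'k::real_or_complex \<Rightarrow> 'a::ab_group_add \<Rightarrow> 'a" and X b T
    and sE :: "'k \<Rightarrow> 'e::ab_group_add \<Rightarrow> 'e" and E +
  fixes g :: "nat \<Rightarrow> 'e"
  assumes g_E [simp]: "g n \<in> topspace E"
begin

definition u :: "nat \<Rightarrow> ('a \<Rightarrow> 'k) \<Rightarrow> 'e" where "u k y = (\<Sum>n\<le>k. sE (y (b n)) (g n))"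

lemma u_E [simp]: "u k y \<in> topspace E"
  unfolding u_def by (intro E.V_sum E.V_closed g_E)

text \<open>Both sides equal the sum of y(b_n) e(g_n) over n \<le> k. This transposition moves
  estimates in E to the expansion operators on the scalar space.\<close>

lemma dual_u:
  assumes e: "e \<in> dual sE E" and y: "y \<in> dual s X" and h: "\<And>n. T n h = e (g n)"
  shows "e (u k y) = y (P k h)"
  by (simp add: u_def P_def E.dual_sum[OF e] E.dualD[OF e] dual_sum[OF y] dualD[OF y] h mult.commute)

text \<open>Isolates what both cases must supply: convergence of the partial sums, an element
  \<open>R e\<close> with coefficients e(g_n) for all e in E', and boundedness of \<open>R\<close>
  on polars.\<close>

lemma eps_product_interpolation:
  assumes SM: "semi_montel s X"
    and conv: "\<And>y. y \<in> dual s X \<Longrightarrow> \<exists>z. limitin E (\<lambda>k. u k y) z sequentially"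
    and R: "\<And>e. e \<in> dual sE E \<Longrightarrow> R e \<in> V \<and> (\<forall>n. T n (R e) = e (g n))"
    and Rb: "\<And>p. E.cs p \<Longrightarrow> bounded_in s X (R ` E.polar p)"
  obtains w where "w \<in> topspace (eps_product s X sE E)" "\<And>n. w (T n) = g n"
proof -
  define w where "w y = (if y \<in> dual s X then SOME z. limitin E (\<lambda>k. u k y) z sequentially else 0)" for y
  have w: "limitin E (\<lambda>k. u k y) (w y) sequentially" if "y \<in> dual s X" for y
    using someI_ex[OF conv[OF that]] that by (simp add: w_def)
  have wE: "w y \<in> topspace E" for y
    using limitin_topspace[OF w[of y]] by (cases "y \<in> dual s X") (auto simp: w_def)
  have ew: "e (w y) = y (R e)" if e: "e \<in> dual sE E" and y: "y \<in> dual s X" for e y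
  proof (rule LIMSEQ_unique)
    show "(\<lambda>k. e (u k y)) \<longlonglongrightarrow> e (w y)" using e w[OF y] by (rule E.dual_limit)
    show "(\<lambda>k. e (u k y)) \<longlonglongrightarrow> y (R e)"
      using dual_limit[OF y P_limit[of "R e"]] R[OF e] by (simp add: dual_u[OF e y, of "R e"])
  qed
  have top: "topspace (dual_kappa s X) = dual s X"
    unfolding dual_kappa_def by (rule topspace_unif_topology) simp
  \<comment> \<open>Linearity is checked after testing with e in E', where it is linearity of y |->
    y(R e); functionals separate the points of E.\<close>
  have lin: "linear_map_on (pw (*)) sE (dual s X) w"
    unfolding linear_map_on_def
  proof (intro conjI ballI allI)
    show "w (x + y) = w x + w y" if "x \<in> dual s X" "y \<in> dual s X" for x y
      using that wE by (intro E.dual_separates) (auto simp: ew E.dualD dual_add)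
    show "w (pw (*) c x) = sE c (w x)" if "x \<in> dual s X" for c x
      using that wE dual_scale[OF that] by (intro E.dual_separates) (auto simp: ew E.dualD pw_def)
  qed
  have "continuous_map (dual_kappa s X) E w"
    unfolding continuous_map_def top
  proof (intro conjI allI impI)
    fix W assume W: "openin E W"
    show "openin (dual_kappa s X) {y \<in> dual s X. w y \<in> W}"
      unfolding dual_kappa_def openin_unif_topology unif_open_def
    proof (intro conjI ballI)
      fix y assume "y \<in> {y \<in> dual s X. w y \<in> W}"
      then have y: "y \<in> dual s X" "w y \<in> W" by auto
      then obtain p where p: "E.cs p" "{z \<in> topspace E. p (z - w y) < 1} \<subseteq> W"
        using E.openin_cs_nhd[OF W] by blast
      \<comment> \<open>The neighbourhood of \<open>y\<close> will consist of the y' with |y' - y| <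
        1 on the polar hull of \<open>B\<close>, an absolutely convex compact set.\<close>
      define B where "B = R ` E.polar p"
      have BV: "B \<subseteq> V" using Rb[OF p(1)] by (simp add: bounded_in_def B_def)
      have "B \<noteq> {}" using E.zero_in_polar[OF p(1)] by (auto simp: B_def)
      then have K: "absolutely_convex s (polar_hull B)" "compactin X (polar_hull B)"
        using BV absolutely_convex_polar_hull semi_montelD[OF SM] Rb[OF p(1)] by (auto simp: B_def)
      have "y' \<in> {y \<in> dual s X. w y \<in> W}"
        if y': "y' \<in> dual s X" "\<And>x. x \<in> polar_hull B \<Longrightarrow> y' x - y x \<in> ball 0 1" for y'
      proof -
        \<comment> \<open>The functional norming w y' - w y for \<open>p\<close> lies in the polar
          of \<open>p\<close>, so p(w y' - w y) = |(y' - y)(R e)| < 1.\<close>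
        obtain e where e: "e \<in> dual sE E" "\<And>x. x \<in> topspace E \<Longrightarrow> norm (e x) \<le> p x"
          "norm (e (w y' - w y)) = p (w y' - w y)"
          using E.Hahn_Banach[OF p(1), of "w y' - w y"] wE by auto
        then have "R e \<in> polar_hull B" using polar_hull_superset[OF BV] by (auto simp: B_def E.polar_def)
        from y'(2)[OF this] have "norm (e (w y') - e (w y)) < 1"
          using e y y' by (simp add: ew)
        then have "p (w y' - w y) < 1" using e wE by (simp add: E.dualD)
        then show ?thesis using p wE y' by auto
      qed
      then have "{v \<in> dual s X. \<forall>M\<in>{polar_hull B}. \<forall>x\<in>M. v x - y x \<in> ball 0 1} \<subseteq> {y \<in> dual s X. w y \<in> W}"
        by auto
      moreover have "zero_nhd euclidean (ball (0::'k) 1)"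
        unfolding zero_nhd_def by (auto intro!: exI[of _ "ball 0 1"])
      ultimately show "\<exists>\<Q> U. finite \<Q> \<and> \<Q> \<subseteq> {K. absolutely_convex s K \<and> compactin X K} \<and> zero_nhd euclidean U \<and>
          {v \<in> dual s X. \<forall>M\<in>\<Q>. \<forall>x\<in>M. v x - y x \<in> U} \<subseteq> {y \<in> dual s X. w y \<in> W}"
        using K by (intro exI[of _ "{polar_hull B}"] exI[of _ "ball 0 1"]) auto
    qed auto
  qed (use wE in auto)
  with lin have "w \<in> topspace (eps_product s X sE E)"
    unfolding eps_product_def by (subst topspace_unif_topology) (auto simp: cont_lin_def top w_def)
  moreover have "w (T n) = g n" for n
    using wE R by (intro E.dual_separates) (auto simp: ew T_dual)
  ultimately show ?thesis using that by blast
qed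

end

section \<open>The Frechet-Schwartz case\<close>

context lc_space
begin

section \<open>Weak boundedness, limits in Banach discs, and the Schwartz property in seminorm
  form\<close>

lemma topspace_weak_topology: "topspace (weak_topology X G) = V"
  unfolding weak_topology_def topology_generated_by_topspace by auto

text \<open>Induction over the generated topology. The claim is conditional on 0 \<in> W because
  members of that topology need not contain 0; since functionals in \<open>G\<close> vanish at 0, a
  generator containing 0 contains a slab |\<phi>| < d.\<close>

lemma weak_topology_zero_nhd:
  fixes G :: "('a \<Rightarrow> 'k) set"
  assumes G: "G \<subseteq> dual s X" and U: "zero_nhd (weak_topology X G) U"
  obtains H d where "finite H" "H \<subseteq> G" "d > (0::real)" "{x \<in> V. \<forall>\<phi>\<in>H. norm (\<phi> x) < d} \<subseteq> U"
proof -
  let ?N = "\<lambda>W. \<exists>H d. finite H \<and> H \<subseteq> G \<and> d > (0::real) \<and> {x \<in> V. \<forall>\<phi>\<in>H. norm (\<phi> x) < d} \<subseteq> W"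
  have *: "0 \<in> W \<longrightarrow> ?N W"
    if "generate_topology_on (insert V {{x \<in> V. \<phi> x \<in> U} |\<phi> U. \<phi> \<in> G \<and> open U}) W" for W
    using that
  proof induction
    case (Int A B)
    show ?case
    proof
      assume "0 \<in> A \<inter> B"
      with Int obtain H H' d d' where H: "finite H" "H \<subseteq> G" "d > 0" "{x \<in> V. \<forall>\<phi>\<in>H. norm (\<phi> x) < d} \<subseteq> A"
        and H': "finite H'" "H' \<subseteq> G" "d' > 0" "{x \<in> V. \<forall>\<phi>\<in>H'. norm (\<phi> x) < d'} \<subseteq> B"
        by auto
      have "{x \<in> V. \<forall>\<phi>\<in>H \<union> H'. norm (\<phi> x) < min d d'} \<subseteq> A \<inter> B"
        using H(4) H'(4) by auto
      then show "?N (A \<inter> B)"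
        using H H' by (intro exI[of _ "H \<union> H'"] exI[of _ "min d d'"]) auto
    qed
  next
    case (UN K)
    show ?case
    proof
      assume "0 \<in> \<Union>K"
      then obtain A where A: "A \<in> K" "0 \<in> A" by blast
      with UN have "?N A" by simp
      then obtain H d where "finite H" "H \<subseteq> G" "d > 0" "{x \<in> V. \<forall>\<phi>\<in>H. norm (\<phi> x) < d} \<subseteq> A" by blast
      then show "?N (\<Union>K)" using A(1) by (intro exI[of _ H] exI[of _ d]) auto
    qed
  next
    case (Basis A)
    show ?case
    proof
      assume 0: "0 \<in> A"
      from Basis consider "A = V" | \<phi> U where "A = {x \<in> V. \<phi> x \<in> U}" "\<phi> \<in> G" "open U" by blast
      then show "?N A"
      proof cases
        case 1
        then show ?thesis by (intro exI[of _ "{}"] exI[of _ 1]) auto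
      next
        case 2
        have "\<phi> 0 = 0" using 2(2) G dualD(3) by blast
        with 0 2 have "0 \<in> U" by simp
        then obtain d where "d > 0" "ball 0 d \<subseteq> U" using 2(3) open_contains_ball by metis
        then show ?thesis using 2(1,2) by (intro exI[of _ "{\<phi>}"] exI[of _ d]) (auto simp: subset_iff)
      qed
    qed
  qed auto
  obtain W where W: "openin (weak_topology X G) W" "0 \<in> W" "W \<subseteq> U"
    using U by (auto simp: zero_nhd_def)
  then have "?N W" using * by (simp add: weak_topology_def openin_topology_generated_by_iff)
  then obtain H d where "finite H" "H \<subseteq> G" "d > 0" "{x \<in> V. \<forall>\<phi>\<in>H. norm (\<phi> x) < d} \<subseteq> W"
    by (elim exE conjE)
  then show ?thesis using that[of H d] W(3) by auto
qed

lemma weakly_bounded: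
  fixes G :: "('a \<Rightarrow> 'k) set"
  assumes G: "G \<subseteq> dual s X" and B: "B \<subseteq> V" "\<And>\<phi>. \<phi> \<in> G \<Longrightarrow> \<exists>c. \<forall>x\<in>B. norm (\<phi> x) \<le> c"
  shows "bounded_in s (weak_topology X G) B"
  unfolding bounded_in_def topspace_weak_topology
proof (intro conjI allI impI B(1))
  fix U assume U: "zero_nhd (weak_topology X G) U"
  obtain H d where H: "finite H" "H \<subseteq> G" "d > (0::real)" "{x \<in> V. \<forall>\<phi>\<in>H. norm (\<phi> x) < d} \<subseteq> U"
    by (rule weak_topology_zero_nhd[OF G U])
  have "\<exists>c. \<forall>\<phi>\<in>G. \<forall>x\<in>B. norm (\<phi> x) \<le> c \<phi>"
    using B(2) by metis
  then obtain c where c: "\<And>\<phi> x. \<phi> \<in> G \<Longrightarrow> x \<in> B \<Longrightarrow> norm (\<phi> x) \<le> c \<phi>" by blast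
  \<comment> \<open>One radius for finitely many functionals: the sum of the bounds dominates each
    of them, and the added 1 makes the estimate strict and \<open>r\<close> positive even if the sum
    is zero.\<close>
  define r where "r = ((\<Sum>\<phi>\<in>H. \<bar>c \<phi>\<bar>) + 1) / d"
  have r: "r > 0" using H(3) by (simp add: r_def add_nonneg_pos sum_nonneg)
  have "x \<in> s (of_real r) ` U" if x: "x \<in> B" for x
  proof -
    have xV: "x \<in> V" using x B by auto
    have "norm (\<phi> (s (of_real (1 / r)) x)) < d" if \<phi>: "\<phi> \<in> H" for \<phi>
    proof -
      have "norm (\<phi> x) \<le> \<bar>c \<phi>\<bar>" using c[of \<phi> x] \<phi> H(2) x by fastforce
      also have "\<dots> \<le> (\<Sum>\<phi>\<in>H. \<bar>c \<phi>\<bar>)" using \<phi> H(1) by (intro member_le_sum) auto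
      also have "\<dots> < r * d" using H(3) by (simp add: r_def)
      finally have "norm (\<phi> x) < r * d" .
      moreover have "\<phi> \<in> dual s X" using \<phi> H(2) G by auto
      ultimately show ?thesis
        using r xV by (simp add: dualD norm_divide pos_divide_less_eq mult.commute)
    qed
    then have "s (of_real (1 / r)) x \<in> U" using H(4) xV by auto
    moreover have "x = s (of_real r) (s (of_real (1 / r)) x)"
      using r by (simp flip: of_real_mult del: of_real_divide)
    ultimately show ?thesis by blast
  qed
  then show "\<exists>r>0. B \<subseteq> s (of_real r) ` U" using r by blast
qed

text \<open>A sequence that is Cauchy relative to a bounded set \<open>B\<close> is norm Cauchy in
  the Banach space spanned by the closed absolutely convex hull D of \<open>B\<close>. Boundedness
  of D makes the inclusion of that space into X continuous, so the limit persists in X.\<close>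

lemma locally_complete_limit:
  assumes LC: "locally_complete s X" and B: "bounded_in s X B" and \<sigma>: "range \<sigma> \<subseteq> B"
    and C: "\<And>\<epsilon>::real. \<epsilon> > 0 \<Longrightarrow> \<exists>N. \<forall>i\<ge>N. \<forall>j\<ge>N. \<sigma> i - \<sigma> j \<in> s (of_real \<epsilon>) ` B"
  shows "\<exists>x. limitin X \<sigma> x sequentially"
proof -
  define D where "D = polar_hull B"
  have BV: "B \<subseteq> V" using B by (simp add: bounded_in_def)
  have BD: "B \<subseteq> D" using BV by (simp add: D_def polar_hull_superset)
  have "B \<noteq> {}" using \<sigma> by auto
  then have D: "closedin X D" "bounded_in s X D" "absolutely_convex s D"
    using B BV by (simp_all add: D_def closedin_polar_hull bounded_polar_hull absolutely_convex_polar_hull)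
  define W where "W = (\<Union>n::nat. s (of_nat n) ` D)"
  have ban: "banach_on s W (gauge_of s D)"
    using LC D by (simp add: locally_complete_def W_def)
  then have nrm: "normed_on s W (gauge_of s D)" by (simp add: banach_on_def)
  interpret M: Metric_space W "norm_dist W (gauge_of s D)"
    by (rule Metric_space_norm_dist[OF nrm])
  have DW: "D \<subseteq> W" by (auto simp: W_def intro!: exI[of _ 1])
  have \<sigma>W: "\<sigma> n \<in> W" for n using \<sigma> BD DW by auto
  have "M.MCauchy \<sigma>"
    unfolding M.MCauchy_def
  proof (intro conjI allI impI)
    fix e :: real assume e: "e > 0"
    then obtain N where N: "\<forall>i\<ge>N. \<forall>j\<ge>N. \<sigma> i - \<sigma> j \<in> s (of_real (e / 2)) ` B" using C[of "e / 2"] by auto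
    have "norm_dist W (gauge_of s D) (\<sigma> i) (\<sigma> j) < e" if "N \<le> i" "N \<le> j" for i j
    proof -
      have "gauge_of s D (\<sigma> i - \<sigma> j) \<le> e / 2"
        using e by (intro gauge_of_le subsetD[OF image_mono[OF BD] N[rule_format, OF that]]) simp
      then show ?thesis using e \<sigma>W by (simp add: norm_dist_def)
    qed
    then show "\<exists>N. \<forall>i j. N \<le> i \<longrightarrow> N \<le> j \<longrightarrow> norm_dist W (gauge_of s D) (\<sigma> i) (\<sigma> j) < e" by blast
  qed (use \<sigma>W in auto)
  then obtain x where x: "limitin M.mtopology \<sigma> x sequentially"
    using ban unfolding banach_on_def M.mcomplete_def by blast
  have xW: "x \<in> W" using limitin_topspace[OF x] by simp
  have DV: "D \<subseteq> V" by (auto simp: D_def polar_hull_def)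
  then have WV: "W \<subseteq> V" by (auto simp: W_def)
  have "limitin X \<sigma> x sequentially"
  proof (subst limitin_cs)
    show "\<sigma> n \<in> V" for n using \<sigma>W WV by auto
    show "x \<in> V \<and> (\<forall>p. cs p \<longrightarrow> (\<forall>e>0. \<forall>\<^sub>F n in sequentially. p (\<sigma> n - x) < e))"
    proof (intro conjI allI impI)
      show "x \<in> V" using xW WV by auto
      fix p and e :: real assume p: "cs p" and e: "e > 0"
      obtain c where c: "\<forall>x\<in>D. p x \<le> c" using D(2) p by (auto simp: bounded_in_cs)
      define c' where "c' = \<bar>c\<bar> + 1"
      have c': "c' > 0" "\<And>x. x \<in> D \<Longrightarrow> p x \<le> c'" using c by (force simp: c'_def)+
      obtain N where N: "\<And>n. n \<ge> N \<Longrightarrow> norm_dist W (gauge_of s D) (\<sigma> n) x < e / c'"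
        using x e c'(1) unfolding M.limit_metric_sequentially by (metis divide_pos_pos)
      have "p (\<sigma> n - x) < e" if n: "n \<ge> N" for n
      proof -
        have dW: "\<sigma> n - x \<in> W" using normed_onD(4)[OF nrm \<sigma>W xW] .
        then obtain m :: nat and d where d: "d \<in> D" "\<sigma> n - x = s (of_nat m) d" by (auto simp: W_def)
        \<comment> \<open>\<open>W\<close> is the union of integer multiples, including n = 0,
          whereas \<open>gauge_of_less\<close> needs a positive real multiple. Writing m d = (m + 1)
          (m / (m + 1)) d provides one.\<close>
        have "s (of_real (real m / (real m + 1))) d \<in> D"
          by (rule absolutely_convex_scale[OF module_s D(3) d(1)]) (simp add: norm_divide flip: of_real_add)
        moreover have "\<sigma> n - x = s (of_real (real m + 1)) (s (of_real (real m / (real m + 1))) d)"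
        proof -
          have "of_real (real m + 1) * of_real (real m / (real m + 1)) = (of_nat m :: 'k)"
            unfolding of_real_mult[symmetric] by (simp add: add_nonneg_eq_0_iff)
          then show ?thesis by (simp only: d scale_scale)
        qed
        ultimately have "\<sigma> n - x \<in> s (of_real (real m + 1)) ` D" by blast
        moreover have "gauge_of s D (\<sigma> n - x) < e / c'"
          using N[OF n] \<sigma>W xW by (simp add: norm_dist_def)
        ultimately obtain t where t: "0 < t" "t < e / c'" "\<sigma> n - x \<in> s (of_real t) ` D"
          using gauge_of_less[of "real m + 1" "\<sigma> n - x" s D "e / c'"] by auto
        then obtain d where d: "d \<in> D" "\<sigma> n - x = s (of_real t) d" by blast
        have "p (\<sigma> n - x) = t * p d" using d DV t by (auto simp: cs_scale[OF p])
        also have "\<dots> \<le> t * c'" using t c'(2)[OF d(1)] by simp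
        also have "\<dots> < e" using t c'(1) by (simp add: pos_less_divide_eq)
        finally show ?thesis .
      qed
      then show "\<forall>\<^sub>F n in sequentially. p (\<sigma> n - x) < e" unfolding eventually_sequentially by blast
    qed
  qed
  then show ?thesis by blast
qed

text \<open>Supplies the precompact sets for \<open>P_uniform_Cauchy\<close>: the Schwartz
  condition, applied to the closed unit ball of \<open>q\<close>, makes the unit ball of some
  \<open>m\<close> precompact for \<open>q\<close>.\<close>

lemma schwartz_cs:
  assumes S: "schwartz_space s X" and q: "cs q"
  obtains m where "cs m"
    "\<And>\<epsilon>::real. \<epsilon> > 0 \<Longrightarrow> \<exists>A. finite A \<and> A \<subseteq> V \<and> (\<forall>x\<in>{x \<in> V. m x < 1}. \<exists>a\<in>A. q (x - a) \<le> \<epsilon>)"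
proof -
  define U where "U = {x \<in> V. q x \<le> 1}"
  have U: "zero_nhd X U"
    by (rule zero_nhd_superset[OF cs_zero_nhd[OF q, of 1]]) (auto simp: U_def)
  have "q (s a x + s b y) \<le> 1" if "x \<in> U" "y \<in> U" "norm a + norm b \<le> 1" for a b x y
  proof -
    have "q (s a x + s b y) \<le> norm a * q x + norm b * q y"
      using cs_add[OF q, of "s a x" "s b y"] that by (simp add: U_def cs_scale[OF q])
    also have "\<dots> \<le> norm a * 1 + norm b * 1"
      using that by (intro add_mono mult_left_mono) (auto simp: U_def)
    finally show ?thesis using that by simp
  qed
  then have aU: "absolutely_convex s U"
    unfolding absolutely_convex_def using q by (auto simp: U_def intro!: exI[of _ 0])
  from S[unfolded schwartz_space_def, THEN conjunct2, rule_format, OF conjI[OF U aU]]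
  obtain W where W: "zero_nhd X W"
      "\<forall>\<epsilon>>0. \<exists>A. finite A \<and> A \<subseteq> W \<and> W \<subseteq> (\<Union>a\<in>A. (\<lambda>x. a + s (of_real \<epsilon>) x) ` U)"
    by (elim exE conjE)
  obtain m where m: "cs m" "{x \<in> V. m x < 1} \<subseteq> W" by (rule zero_nhd_cs[OF W(1)])
  have "\<exists>A. finite A \<and> A \<subseteq> V \<and> (\<forall>x\<in>{x \<in> V. m x < 1}. \<exists>a\<in>A. q (x - a) \<le> \<epsilon>)" if \<epsilon>: "\<epsilon> > 0" for \<epsilon> :: real
  proof -
    obtain A where A: "finite A" "A \<subseteq> W" "W \<subseteq> (\<Union>a\<in>A. (\<lambda>x. a + s (of_real \<epsilon>) x) ` U)"
      using W(2) \<epsilon> by auto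
    have "\<exists>a\<in>A. q (x - a) \<le> \<epsilon>" if "x \<in> W" for x
    proof -
      obtain a u where a: "a \<in> A" "u \<in> U" "x = a + s (of_real \<epsilon>) u" using A(3) \<open>x \<in> W\<close> by blast
      then have "q (x - a) = \<epsilon> * q u" using \<epsilon> by (simp add: U_def cs_scale[OF q])
      also have "\<dots> \<le> \<epsilon>" using a(2) \<epsilon> by (simp add: U_def mult_left_le)
      finally show ?thesis using a(1) by blast
    qed
    moreover have "A \<subseteq> V" using A(2) W(1) by (auto simp: zero_nhd_def)
    ultimately show ?thesis using A(1) m(2) by blast
  qed
  with m(1) show ?thesis by (rule that)
qed

end

context lc_basis_pair
begin

text \<open>Collects the partial sums for all functionals of a polar at once. These sets generate
  the Banach discs of E in which the series converges.\<close>

definition partials :: "('a \<Rightarrow> real) \<Rightarrow> 'e set" where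
  "partials q = {u j y | j y. y \<in> polar q}"

lemma u_in_partials: "y \<in> polar q \<Longrightarrow> u j y \<in> partials q"
  by (auto simp: partials_def)

text \<open>For e in \<open>G\<close> one has |e(u_j(y))| = |y(P_j h)| \<le> q(P_j h) \<le> q'(h),
  independently of j and y. Only functionals in \<open>G\<close> are available for this, so
  \<open>determines_boundedness\<close> is what makes the set bounded in E.\<close>

lemma bounded_partials:
  assumes G: "G \<subseteq> dual sE E" and det: "determines_boundedness sE E G"
    and R: "\<And>e. e \<in> G \<Longrightarrow> \<exists>h\<in>V. \<forall>n. T n h = e (g n)" and q: "cs q"
  shows "bounded_in sE E (partials q)"
proof -
  have "\<exists>c. \<forall>x\<in>partials q. norm (e x) \<le> c" if e: "e \<in> G" for e
  proof -
    obtain h where h: "h \<in> V" "\<And>n. T n h = e (g n)" using R[OF e] by blast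
    obtain q' where q': "cs q'" "\<And>k x. x \<in> V \<Longrightarrow> q (P k x) \<le> q' x" using P_equicontinuous[OF q] by metis
    have "norm (e (u j y)) \<le> q' h" if y: "y \<in> polar q" for j y
    proof -
      have ed: "e \<in> dual sE E" and yd: "y \<in> dual s X" using e G y by (auto simp: polar_def)
      have "e (u j y) = y (P j h)" by (rule dual_u[OF ed yd h(2)])
      also have "norm (y (P j h)) \<le> q (P j h)" using y by (simp add: polar_def)
      also have "\<dots> \<le> q' h" using q' h by simp
      finally show ?thesis .
    qed
    then show ?thesis by (intro exI[of _ "q' h"]) (auto simp: partials_def)
  qed
  then have "bounded_in sE (weak_topology E G) (partials q)"
    using G by (intro E.weakly_bounded) (auto simp: partials_def)
  then show ?thesis using det by (simp add: determines_boundedness_def)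
qed

text \<open>
  The difference of two partial sums at \<open>y\<close> is a small multiple of a partial sum at the functional
  \<open>z = (y \<circ> P i - y \<circ> P j) / \<epsilon>\<close>, which the Schwartz property puts into a fixed polar.
\<close>

lemma schwartz_partials:
  assumes S: "schwartz_space s X" and q: "cs q"
  obtains m where "cs m" "\<And>\<epsilon>::real. \<epsilon> > 0 \<Longrightarrow>
    \<exists>N. \<forall>i\<ge>N. \<forall>j\<ge>N. \<forall>y\<in>polar q. u i y - u j y \<in> sE (of_real \<epsilon>) ` partials m"
proof -
  obtain q' where q': "cs q'" "\<And>k x. x \<in> V \<Longrightarrow> q (P k x) \<le> q' x" using P_equicontinuous[OF q] by metis
  obtain m where m: "cs m" "\<And>\<epsilon>::real. \<epsilon> > 0 \<Longrightarrow>
      \<exists>A. finite A \<and> A \<subseteq> V \<and> (\<forall>x\<in>{x \<in> V. m x < 1}. \<exists>a\<in>A. q' (x - a) \<le> \<epsilon>)"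
    using schwartz_cs[OF S q'(1)] by metis
  have "\<exists>N. \<forall>i\<ge>N. \<forall>j\<ge>N. \<forall>y\<in>polar q. u i y - u j y \<in> sE (of_real \<epsilon>) ` partials m"
    if \<epsilon>: "\<epsilon> > 0" for \<epsilon> :: real
  proof -
    obtain N where N: "\<forall>i\<ge>N. \<forall>j\<ge>N. \<forall>x\<in>{x \<in> V. m x < 1}. q (P i x - P j x) \<le> \<epsilon>"
      using P_uniform_Cauchy[OF q q' _ m(2) \<epsilon>] by auto
    have "u i y - u j y \<in> sE (of_real \<epsilon>) ` partials m" if ij: "i \<ge> N" "j \<ge> N" and y: "y \<in> polar q" for i j y
    proof -
      have yd: "y \<in> dual s X" using y by (simp add: polar_def)
      note y_lin = dualD[OF yd]
      define z where "z x = (y (P i x) - y (P j x)) / of_real \<epsilon>" for x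
      \<comment> \<open>On the unit ball of \<open>m\<close> the operators P i and P j differ by at
        most \<epsilon> for \<open>q\<close>; homogeneity then gives |z| \<le> m everywhere.\<close>
      have z1: "norm (z x) \<le> 1" if "x \<in> V" "m x < 1" for x
      proof -
        have "norm (y (P i x) - y (P j x)) = norm (y (P i x - P j x))" by (simp add: y_lin)
        also have "\<dots> \<le> q (P i x - P j x)" using y by (simp add: polar_def)
        also have "\<dots> \<le> \<epsilon>" using N ij that by simp
        finally show ?thesis using \<epsilon> by (simp add: z_def norm_divide)
      qed
      have z_sc: "z (s c x) = c * z x" if "x \<in> V" for c x
        using that by (simp add: z_def P_scale y_lin right_diff_distrib)
      have z_m: "norm (z x) \<le> m x" if "x \<in> V" for x
        using cs_bound_scale[OF m(1), of "\<lambda>x. norm (z x)" 1 x] z1 that by (simp add: z_sc norm_mult)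
      have z0: "z x = 0" if "x \<notin> V" for x
        using that by (simp add: z_def P_def T_lin(5) y_lin)
      have "linear_map_on s (*) V z"
        unfolding linear_map_on_def
        by (auto simp: z_sc) (simp add: z_def P_add y_lin add_divide_distrib diff_divide_distrib)
      then have z: "z \<in> polar m"
        using m(1) z_m z0 by (auto simp: polar_def dual_iff)
      \<comment> \<open>All sums are brought to the range n \<le> max i j. There \<open>P_b\<close>
        gives \<epsilon> z(b_n) as the difference of the two truncated values of y(b_n), so a single
        partial sum at \<open>z\<close> represents the whole difference.\<close>
      have cut: "u k y = (\<Sum>n\<le>max i j. sE (if n \<le> k then y (b n) else 0) (g n))" if "k \<le> max i j" for k
        unfolding u_def using that by (intro sum.mono_neutral_cong_left) auto
      have "sE (of_real \<epsilon>) (u (max i j) z) = (\<Sum>n\<le>max i j. sE (of_real \<epsilon> * z (b n)) (g n))"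
        by (simp add: u_def E.scale_sum_right)
      also have "\<dots> = (\<Sum>n\<le>max i j. sE (if n \<le> i then y (b n) else 0) (g n) - sE (if n \<le> j then y (b n) else 0) (g n))"
        using \<epsilon> by (intro sum.cong refl) (auto simp: z_def P_b y_lin E.scale_left_diff_distrib)
      also have "\<dots> = u i y - u j y"
        by (simp add: cut sum_subtractf)
      finally show ?thesis using u_in_partials[OF z] by (metis imageI)
    qed
    then show ?thesis by blast
  qed
  with m(1) show ?thesis by (rule that)
qed

lemma dual_in_polar:
  assumes "y \<in> dual s X"
  obtains q where "cs q" "y \<in> polar q"
proof -
  obtain q where "cs q" "\<And>x. x \<in> V \<Longrightarrow> norm (y x) \<le> q x" using dual_bounded[OF assms] by metis
  then show ?thesis using that[of q] assms by (simp add: polar_def)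
qed

proposition interpolation_frechet_schwartz:
  assumes F: "frechet_space s X" and S: "schwartz_space s X" and LC: "locally_complete sE E"
    and G: "G \<subseteq> dual sE E" and det: "determines_boundedness sE E G"
    and R: "\<And>e. e \<in> G \<Longrightarrow> \<exists>h\<in>V. \<forall>n. T n h = e (g n)"
  obtains w where "w \<in> topspace (eps_product s X sE E)" "\<And>n. w (T n) = g n"
proof -
  have bdd: "bounded_in sE E (partials q)" if "cs q" for q
    by (rule bounded_partials[OF G det _ that]) (rule R)
  have conv: "\<exists>z. limitin E (\<lambda>k. u k y) z sequentially" if yd: "y \<in> dual s X" for y
  proof -
    obtain q where q: "cs q" "y \<in> polar q" by (rule dual_in_polar[OF yd])
    obtain m where m: "cs m" "\<And>\<epsilon>::real. \<epsilon> > 0 \<Longrightarrow>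
        \<exists>N. \<forall>i\<ge>N. \<forall>j\<ge>N. \<forall>y\<in>polar q. u i y - u j y \<in> sE (of_real \<epsilon>) ` partials m"
      using schwartz_partials[OF S q(1)] by metis
    show ?thesis
    \<comment> \<open>The terms lie in \<open>partials q\<close>, while their differences lie in
      small multiples of \<open>partials m\<close>; one bounded set must serve both purposes, hence
      the union.\<close>
    proof (rule E.locally_complete_limit[OF LC, of "partials q \<union> partials m"])
      show "bounded_in sE E (partials q \<union> partials m)"
        unfolding E.bounded_in_cs
      proof (intro conjI allI impI)
        show "partials q \<union> partials m \<subseteq> topspace E" by (auto simp: partials_def)
        fix p assume p: "E.cs p"
        obtain c d where "\<forall>x\<in>partials q. p x \<le> c" "\<forall>x\<in>partials m. p x \<le> d"
          using bdd[OF q(1)] bdd[OF m(1)] p unfolding E.bounded_in_cs by metis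
        then show "\<exists>c. \<forall>x\<in>partials q \<union> partials m. p x \<le> c"
          by (intro exI[of _ "max c d"]) (auto simp: le_max_iff_disj)
      qed
      show "range (\<lambda>k. u k y) \<subseteq> partials q \<union> partials m"
        using u_in_partials[OF q(2)] by auto
      show "\<exists>N. \<forall>i\<ge>N. \<forall>j\<ge>N. u i y - u j y \<in> sE (of_real \<epsilon>) ` (partials q \<union> partials m)"
        if "\<epsilon> > 0" for \<epsilon> :: real
        using m(2)[OF that] q(2) by (meson image_mono subsetD sup_ge2)
    qed
  qed
  have "\<exists>h\<in>V. \<forall>n. T n h = e (g n)" if e: "e \<in> dual sE E" for e
  proof -
    \<comment> \<open>An element with coefficients e(g_n) is given only for e in \<open>G\<close>.
      For general e the series of e(g_n) b_n is shown to be Cauchy: a functional norming h_i - h_j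
      for \<open>q\<close> transposes the difference into E, where \<open>schwartz_partials\<close>
      applies.\<close>
    define h where "h i = (\<Sum>n\<le>i. s (e (g n)) (b n))" for i
    have hV: "h i \<in> V" for i unfolding h_def by (intro V_sum) simp
    have yh: "y (h i) = e (u i y)" if "y \<in> dual s X" for y i
      by (simp add: h_def u_def dual_sum[OF that] dualD[OF that] E.dual_sum[OF e] E.dualD[OF e] mult.commute)
    have "\<exists>N. \<forall>i\<ge>N. \<forall>j\<ge>N. q (h i - h j) < \<epsilon>" if q: "cs q" and \<epsilon>: "\<epsilon> > 0" for q and \<epsilon> :: real
    proof -
      obtain m where m: "cs m" "\<And>\<epsilon>::real. \<epsilon> > 0 \<Longrightarrow>
          \<exists>N. \<forall>i\<ge>N. \<forall>j\<ge>N. \<forall>y\<in>polar q. u i y - u j y \<in> sE (of_real \<epsilon>) ` partials m"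
        using schwartz_partials[OF S q] by metis
      obtain p where p: "E.cs p" "\<And>x. x \<in> topspace E \<Longrightarrow> norm (e x) \<le> p x" using E.dual_bounded[OF e] by metis
      obtain c where c: "\<forall>x\<in>partials m. p x \<le> c" using bdd[OF m(1)] p(1) unfolding E.bounded_in_cs by metis
      \<comment> \<open>The constant compensates for the bound c of \<open>p\<close> on
        \<open>partials m\<close>; the added 1 keeps the denominator positive and makes the final
        inequality strict.\<close>
      define \<delta> where "\<delta> = \<epsilon> / (\<bar>c\<bar> + 1)"
      have \<delta>: "\<delta> > 0" using \<epsilon> by (simp add: \<delta>_def add_nonneg_pos)
      obtain N where N: "\<forall>i\<ge>N. \<forall>j\<ge>N. \<forall>y\<in>polar q. u i y - u j y \<in> sE (of_real \<delta>) ` partials m"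
        using m(2)[OF \<delta>] by blast
      have "q (h i - h j) < \<epsilon>" if ij: "i \<ge> N" "j \<ge> N" for i j
      proof -
        obtain y where y: "y \<in> dual s X" "\<And>x. x \<in> V \<Longrightarrow> norm (y x) \<le> q x" "norm (y (h i - h j)) = q (h i - h j)"
          using Hahn_Banach[OF q, of "h i - h j"] hV by auto
        then have "u i y - u j y \<in> sE (of_real \<delta>) ` partials m" using N ij by (auto simp: polar_def)
        then obtain v where v: "v \<in> partials m" "u i y - u j y = sE (of_real \<delta>) v" by blast
        have vE: "v \<in> topspace E" using v(1) by (auto simp: partials_def)
        have "q (h i - h j) = norm (e (u i y - u j y))"
          unfolding y(3)[symmetric] using hV by (simp add: dualD[OF y(1)] yh[OF y(1)] E.dualD[OF e])
        also have "\<dots> = \<delta> * norm (e v)" using \<delta> vE by (simp add: v E.dualD[OF e] norm_mult)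
        also have "norm (e v) \<le> \<bar>c\<bar>" using p(2)[OF vE] c v(1) by force
        also have "\<delta> * \<bar>c\<bar> < \<delta> * (\<bar>c\<bar> + 1)" using \<delta> by simp
        also have "\<dots> = \<epsilon>" by (simp add: \<delta>_def)
        finally show ?thesis using \<delta> by simp
      qed
      then show ?thesis by blast
    qed
    then have "\<exists>x. limitin X h x sequentially"
      by (intro seq_completeD[OF frechet_seq_complete[OF F], of h] hV)
    then obtain x where x: "limitin X h x sequentially" ..
    then show ?thesis using coefficient[of "\<lambda>n. e (g n)" x] limitin_topspace[OF x] by (auto simp: h_def[abs_def])
  qed
  then obtain R' where R': "\<And>e. e \<in> dual sE E \<Longrightarrow> R' e \<in> V \<and> (\<forall>n. T n (R' e) = e (g n))" by metis
  show ?thesis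
  proof (rule eps_product_interpolation[OF frechet_schwartz_semi_montel[OF F S] conv R' _ that])
    fix p assume p: "E.cs p"
    show "bounded_in s X (R' ` E.polar p)"
      unfolding bounded_in_cs
    proof (intro conjI allI impI)
      show "R' ` E.polar p \<subseteq> V" using R' by (auto simp: E.polar_def)
      fix q assume q: "cs q"
      obtain c where c: "\<forall>x\<in>partials q. p x \<le> c" using bdd[OF q] p unfolding E.bounded_in_cs by metis
      have "q (R' e) \<le> c" if e: "e \<in> E.polar p" for e
      proof -
        have ed: "e \<in> dual sE E" using e by (simp add: E.polar_def)
        obtain y where y: "y \<in> dual s X" "\<And>x. x \<in> V \<Longrightarrow> norm (y x) \<le> q x" "norm (y (R' e)) = q (R' e)"
          using Hahn_Banach[OF q, of "R' e"] R'[OF ed] by auto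
        \<comment> \<open>The bound holds for the truncations, since y(P_k(R' e)) = e(u_k(y)); it
          passes to R' e in the limit.\<close>
        have "(\<lambda>k. norm (y (P k (R' e)))) \<longlonglongrightarrow> norm (y (R' e))"
          using R'[OF ed] by (intro tendsto_norm dual_limit[OF y(1)] P_limit) simp
        moreover have "norm (y (P k (R' e))) \<le> c" for k
        proof -
          have "y (P k (R' e)) = e (u k y)" using dual_u[OF ed y(1), of "R' e" k] R'[OF ed] by simp
          also have "norm \<dots> \<le> p (u k y)" using e by (simp add: E.polar_def)
          also have "\<dots> \<le> c" using c u_in_partials[of y q k] y by (auto simp: polar_def)
          finally show ?thesis .
        qed
        ultimately have "norm (y (R' e)) \<le> c" by (intro LIMSEQ_le_const2) auto
        then show ?thesis using y(3) by simp
      qed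
      then show "\<exists>c. \<forall>x\<in>R' ` E.polar p. q x \<le> c" by blast
    qed
  qed
qed

end

section \<open>The semi-Montel BC case\<close>

lemma vector_space_pw:
  assumes "vector_space s" shows "vector_space (pw s)"
proof -
  interpret vector_space s by fact
  show ?thesis by unfold_locales (auto simp: pw_def fun_eq_iff scale_right_distrib scale_left_distrib)
qed

lemma vector_space_mult: "vector_space ((*) :: 'k::field \<Rightarrow> 'k \<Rightarrow> 'k)"
  by unfold_locales (auto simp: algebra_simps)

context lc_space
begin

text \<open>For a continuous seminorm \<open>p\<close> this is the linear span of
  \<open>polar p\<close>. \<open>dual_norm\<close> makes \<open>polar p\<close> the closed unit
  ball, which turns boundedness on polars into boundedness of a linear map on a Banach
  space.\<close>

definition dual_cs :: "('a \<Rightarrow> real) \<Rightarrow> ('a \<Rightarrow> 'k) set" where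
  "dual_cs p = {\<phi> \<in> dual s X. \<exists>c. \<forall>x\<in>V. norm (\<phi> x) \<le> c * p x}"

definition dual_norm :: "('a \<Rightarrow> real) \<Rightarrow> ('a \<Rightarrow> 'k) \<Rightarrow> real" where
  "dual_norm p \<phi> = Sup ((\<lambda>x. norm (\<phi> x)) ` {x \<in> V. p x \<le> 1})"

lemma bdd_above_dual_cs:
  assumes p: "cs p" and \<phi>: "\<phi> \<in> dual_cs p"
  shows "bdd_above ((\<lambda>x. norm (\<phi> x)) ` {x \<in> V. p x \<le> 1})"
proof -
  obtain c where c: "\<forall>x\<in>V. norm (\<phi> x) \<le> c * p x"
    using \<phi> by (auto simp: dual_cs_def)
  have "norm (\<phi> x) \<le> \<bar>c\<bar>" if "x \<in> V" "p x \<le> 1" for x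
  proof -
    have "c * p x \<le> \<bar>c\<bar> * 1" using that cs_nonneg[OF p that(1)] by (intro mult_mono) auto
    then show ?thesis using c that(1) by force
  qed
  then show ?thesis by (intro bdd_aboveI[of _ "\<bar>c\<bar>"]) auto
qed

lemma dual_norm_bound:
  assumes p: "cs p" and \<phi>: "\<phi> \<in> dual_cs p" and x: "x \<in> V"
  shows "norm (\<phi> x) \<le> dual_norm p \<phi> * p x"
proof -
  obtain c where c: "\<And>x. x \<in> V \<Longrightarrow> norm (\<phi> x) \<le> c * p x" and d: "\<phi> \<in> dual s X"
    using \<phi> by (auto simp: dual_cs_def)
  show ?thesis
  \<comment> \<open>A point with p x = 0 cannot be normalised; there the defining bound of
    \<open>dual_cs\<close> forces \<phi> x = 0.\<close>
  proof (cases "p x = 0")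
    case True
    then show ?thesis using c[OF x] by simp
  next
    case False
    then have px: "p x > 0" using cs_nonneg[OF p x] by simp
    have "norm (\<phi> (s (of_real (1 / p x)) x)) \<le> dual_norm p \<phi>"
      unfolding dual_norm_def using bdd_above_dual_cs[OF p \<phi>] px x
      by (intro cSup_upper) (auto simp: cs_scale[OF p] norm_divide)
    then show ?thesis using px x by (simp add: dualD[OF d] norm_divide pos_divide_le_eq)
  qed
qed

lemma dual_norm_le:
  assumes p: "cs p" and c: "c \<ge> 0" "\<And>x. x \<in> V \<Longrightarrow> norm (\<phi> x) \<le> c * p x"
  shows "dual_norm p \<phi> \<le> c"
  unfolding dual_norm_def
proof (rule cSup_least)
  have "0 \<in> {x \<in> V. p x \<le> 1}" using p by simp
  then show "(\<lambda>x. norm (\<phi> x)) ` {x \<in> V. p x \<le> 1} \<noteq> {}" by blast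
  fix r assume "r \<in> (\<lambda>x. norm (\<phi> x)) ` {x \<in> V. p x \<le> 1}"
  then obtain x where x: "x \<in> V" "p x \<le> 1" "r = norm (\<phi> x)" by blast
  then have "r \<le> c * p x" using c by simp
  also have "\<dots> \<le> c" using x(2) c(1) by (simp add: mult_left_le)
  finally show "r \<le> c" .
qed

lemma dual_norm_nonneg:
  assumes p: "cs p" and \<phi>: "\<phi> \<in> dual_cs p"
  shows "0 \<le> dual_norm p \<phi>"
proof -
  have "norm (\<phi> 0) \<le> dual_norm p \<phi>"
    unfolding dual_norm_def using bdd_above_dual_cs[OF p \<phi>] p by (intro cSup_upper) auto
  moreover have "\<phi> \<in> dual s X" using \<phi> by (simp add: dual_cs_def)
  ultimately show ?thesis by (simp add: dualD)
qed

lemma dual_csI: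
  assumes p: "cs p" and lin: "linear_map_on s (*) V \<phi>" "\<And>x. x \<notin> V \<Longrightarrow> \<phi> x = 0"
    and c: "\<And>x. x \<in> V \<Longrightarrow> norm (\<phi> x) \<le> c * p x"
  shows "\<phi> \<in> dual_cs p"
proof -
  have "norm (\<phi> x) \<le> (\<bar>c\<bar> + 1) * p x" if x: "x \<in> V" for x
  proof -
    have "c * p x \<le> (\<bar>c\<bar> + 1) * p x" using cs_nonneg[OF p x] by (intro mult_right_mono) auto
    then show ?thesis using c[OF x] by simp
  qed
  moreover have "cs (\<lambda>x. (\<bar>c\<bar> + 1) * p x)" using p by (intro cs_mult) auto
  ultimately have "\<phi> \<in> dual s X" using lin unfolding dual_iff by blast
  then show ?thesis using c by (auto simp: dual_cs_def)
qed

lemma normed_dual_cs: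
  assumes p: "cs p"
  shows "normed_on (pw (*)) (dual_cs p) (dual_norm p)"
proof -
  have vs: "vector_space (pw ((*) :: 'k \<Rightarrow> 'k \<Rightarrow> 'k) :: 'k \<Rightarrow> ('a \<Rightarrow> 'k) \<Rightarrow> _)"
    by (rule vector_space_pw[OF vector_space_mult])
  interpret f: vector_space "pw ((*) :: 'k \<Rightarrow> 'k \<Rightarrow> 'k) :: 'k \<Rightarrow> ('a \<Rightarrow> 'k) \<Rightarrow> _" by (rule vs)
  note bound = dual_norm_bound[OF p] and nn = dual_norm_nonneg[OF p]
  have lin: "linear_map_on s (*) V \<phi>" "x \<notin> V \<Longrightarrow> \<phi> x = 0" if "\<phi> \<in> dual_cs p" for \<phi> x
    using that by (auto simp: dual_cs_def dual_iff)
  have add_le: "norm ((\<phi> + \<psi>) x) \<le> (dual_norm p \<phi> + dual_norm p \<psi>) * p x"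
    if "\<phi> \<in> dual_cs p" "\<psi> \<in> dual_cs p" "x \<in> V" for \<phi> \<psi> x
    using bound[OF that(1,3)] bound[OF that(2,3)] norm_triangle_ineq[of "\<phi> x" "\<psi> x"]
    by (simp add: distrib_right)
  have sc_le: "norm (pw (*) c \<phi> x) \<le> (norm c * dual_norm p \<phi>) * p x"
    if "\<phi> \<in> dual_cs p" "x \<in> V" for \<phi> x c
    using bound[OF that] by (simp add: pw_def norm_mult mult.assoc mult_left_mono)
  have 0: "0 \<in> dual_cs p" by (rule dual_csI[OF p, of _ 0]) (auto simp: linear_map_on_def)
  have add: "\<phi> + \<psi> \<in> dual_cs p" if "\<phi> \<in> dual_cs p" "\<psi> \<in> dual_cs p" for \<phi> \<psi>
    using lin(1)[OF that(1)] lin(1)[OF that(2)] lin(2)[OF that(1)] lin(2)[OF that(2)]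
    by (intro dual_csI[OF p, where c = "dual_norm p \<phi> + dual_norm p \<psi>"] add_le that)
      (auto simp: linear_map_on_def algebra_simps)
  have sc: "pw (*) c \<phi> \<in> dual_cs p" if "\<phi> \<in> dual_cs p" for c \<phi>
    using lin(1)[OF that] lin(2)[OF that]
    by (intro dual_csI[OF p, where c = "norm c * dual_norm p \<phi>"] sc_le that)
      (auto simp: linear_map_on_def pw_def algebra_simps)
  have sc_norm_le: "dual_norm p (pw (*) c \<phi>) \<le> norm c * dual_norm p \<phi>" if "\<phi> \<in> dual_cs p" for c \<phi>
    using sc_le[OF that] nn[OF that] by (intro dual_norm_le[OF p]) auto
  show ?thesis
    unfolding normed_on_def
  proof (intro conjI ballI allI vs)
    show "f.subspace (dual_cs p)"
      using 0 add sc by (simp add: f.subspace_def)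
    show "0 \<le> dual_norm p \<phi>" if "\<phi> \<in> dual_cs p" for \<phi> by (rule nn[OF that])
    show "dual_norm p \<phi> = 0 \<longleftrightarrow> \<phi> = 0" if \<phi>: "\<phi> \<in> dual_cs p" for \<phi>
    proof
      assume "dual_norm p \<phi> = 0"
      then have "\<phi> x = 0" for x using bound[OF \<phi>, of x] lin(2)[OF \<phi>, of x] by (cases "x \<in> V") auto
      then show "\<phi> = 0" by (simp add: fun_eq_iff)
    next
      assume "\<phi> = 0"
      then show "dual_norm p \<phi> = 0" using nn[OF \<phi>] dual_norm_le[OF p, of 0 \<phi>] by simp
    qed
    show "dual_norm p (\<phi> + \<psi>) \<le> dual_norm p \<phi> + dual_norm p \<psi>"
      if "\<phi> \<in> dual_cs p" "\<psi> \<in> dual_cs p" for \<phi> \<psi>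
      using add_le[OF that] nn that by (intro dual_norm_le[OF p]) auto
    show "dual_norm p (pw (*) c \<phi>) = norm c * dual_norm p \<phi>" if \<phi>: "\<phi> \<in> dual_cs p" for c \<phi>
    proof (cases "c = 0")
      case True
      then show ?thesis using sc_norm_le[OF \<phi>, of c] nn[OF sc[OF \<phi>], of c] by simp
    next
      case False
      have "dual_norm p \<phi> \<le> norm (inverse c) * dual_norm p (pw (*) c \<phi>)"
        using sc_norm_le[OF sc[OF \<phi>], of "inverse c" c] False by simp
      then have "dual_norm p \<phi> \<le> dual_norm p (pw (*) c \<phi>) / norm c"
        using False by (simp add: norm_inverse divide_inverse mult.commute)
      then have "norm c * dual_norm p \<phi> \<le> dual_norm p (pw (*) c \<phi>)"
        using False by (simp add: pos_le_divide_eq mult.commute)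
      with sc_norm_le[OF \<phi>, of c] show ?thesis by simp
    qed
  qed
qed

text \<open>A norm Cauchy sequence is pointwise Cauchy, so completeness of the scalar field gives a
  pointwise limit. Letting the second index tend to infinity in the Cauchy estimate yields
  domination by \<open>p\<close> and norm convergence.\<close>

lemma banach_dual_cs:
  assumes p: "cs p"
  shows "banach_on (pw (*)) (dual_cs p) (dual_norm p)"
proof -
  note nrm = normed_dual_cs[OF p]
  note D = normed_onD[OF nrm]
  interpret M: Metric_space "dual_cs p" "norm_dist (dual_cs p) (dual_norm p)"
    by (rule Metric_space_norm_dist[OF nrm])
  note bound = dual_norm_bound[OF p]
  have "\<exists>\<phi>. limitin M.mtopology \<sigma> \<phi> sequentially" if \<sigma>: "M.MCauchy \<sigma>" for \<sigma>
  proof -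
    have \<sigma>W: "\<sigma> n \<in> dual_cs p" for n using \<sigma> by (auto simp: M.MCauchy_def)
    then have \<sigma>d: "\<sigma> n \<in> dual s X" for n by (auto simp: dual_cs_def)
    have C: "\<exists>N. \<forall>i\<ge>N. \<forall>j\<ge>N. \<forall>x\<in>V. norm (\<sigma> i x - \<sigma> j x) \<le> e * p x" if e: "e > 0" for e :: real
    proof -
      obtain N where N: "\<forall>i j. N \<le> i \<longrightarrow> N \<le> j \<longrightarrow> norm_dist (dual_cs p) (dual_norm p) (\<sigma> i) (\<sigma> j) < e"
        using \<sigma> e unfolding M.MCauchy_def by blast
      have "norm (\<sigma> i x - \<sigma> j x) \<le> e * p x" if "i \<ge> N" "j \<ge> N" "x \<in> V" for i j x
      proof -
        have "norm ((\<sigma> i - \<sigma> j) x) \<le> dual_norm p (\<sigma> i - \<sigma> j) * p x"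
          by (rule bound[OF D(4)[OF \<sigma>W \<sigma>W] that(3)])
        also have "\<dots> \<le> e * p x"
          using N that \<sigma>W cs_nonneg[OF p that(3)]
          by (intro mult_right_mono) (auto simp: norm_dist_def less_imp_le)
        finally show ?thesis by simp
      qed
      then show ?thesis by blast
    qed
    have Cx: "Cauchy (\<lambda>n. \<sigma> n x)" for x
    proof (cases "x \<in> V")
      case True
      show ?thesis unfolding Cauchy_def dist_norm
      proof (intro allI impI)
        fix e :: real assume e: "e > 0"
        \<comment> \<open>Using p x + 1 avoids a division by zero and still gives e / (p x + 1) * p
          x < e.\<close>
        have px: "p x + 1 > 0" using cs_nonneg[OF p True] by simp
        from C[of "e / (p x + 1)"] e px
        obtain N where N: "\<forall>i\<ge>N. \<forall>j\<ge>N. \<forall>y\<in>V. norm (\<sigma> i y - \<sigma> j y) \<le> e / (p x + 1) * p y"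
          by auto
        have "e / (p x + 1) * p x < e" using e px by (simp add: pos_divide_less_eq)
        then have "\<forall>i\<ge>N. \<forall>j\<ge>N. norm (\<sigma> i x - \<sigma> j x) < e"
          using N True by (meson le_less_trans)
        then show "\<exists>M. \<forall>m\<ge>M. \<forall>n\<ge>M. norm (\<sigma> m x - \<sigma> n x) < e" by blast
      qed
    qed (simp add: dualD[OF \<sigma>d] Cauchy_def)
    define \<phi> where "\<phi> x = lim (\<lambda>n. \<sigma> n x)" for x
    have lim: "(\<lambda>n. \<sigma> n x) \<longlonglongrightarrow> \<phi> x" for x
      using Cauchy_convergent_scalar[OF Cx] by (simp add: \<phi>_def convergent_LIMSEQ_iff)
    have near: "\<exists>N. \<forall>i\<ge>N. \<forall>x\<in>V. norm (\<sigma> i x - \<phi> x) \<le> e * p x" if e: "e > 0" for e :: real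
    proof -
      obtain N where N: "\<forall>i\<ge>N. \<forall>j\<ge>N. \<forall>x\<in>V. norm (\<sigma> i x - \<sigma> j x) \<le> e * p x" using C[OF e] by blast
      have "norm (\<sigma> i x - \<phi> x) \<le> e * p x" if "i \<ge> N" "x \<in> V" for i x
      proof (rule LIMSEQ_le_const2)
        show "(\<lambda>j. norm (\<sigma> i x - \<sigma> j x)) \<longlonglongrightarrow> norm (\<sigma> i x - \<phi> x)"
          by (intro tendsto_intros lim)
        show "\<exists>N. \<forall>j\<ge>N. norm (\<sigma> i x - \<sigma> j x) \<le> e * p x" using N that by blast
      qed
      then show ?thesis by blast
    qed
    obtain N where N: "\<forall>x\<in>V. norm (\<sigma> N x - \<phi> x) \<le> 1 * p x" using near[of 1] by auto
    have \<phi>W: "\<phi> \<in> dual_cs p"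
    proof (rule dual_csI[OF p])
      show "linear_map_on s (*) V \<phi>"
        unfolding linear_map_on_def
      proof (intro conjI ballI allI)
        show "\<phi> (x + y) = \<phi> x + \<phi> y" if "x \<in> V" "y \<in> V" for x y
          using LIMSEQ_unique[OF lim[of "x + y"]] tendsto_add[OF lim[of x] lim[of y]] that
          by (simp add: dualD[OF \<sigma>d])
        show "\<phi> (s c x) = c * \<phi> x" if "x \<in> V" for c x
          using LIMSEQ_unique[OF lim[of "s c x"]] tendsto_mult_left[OF lim[of x], of c] that
          by (simp add: dualD[OF \<sigma>d])
      qed
      show "\<phi> x = 0" if "x \<notin> V" for x
        using LIMSEQ_unique[OF lim[of x], of 0] that by (simp add: dualD[OF \<sigma>d])
      show "norm (\<phi> x) \<le> (1 + dual_norm p (\<sigma> N)) * p x" if "x \<in> V" for x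
      proof -
        have "norm (\<phi> x) \<le> norm (\<sigma> N x - \<phi> x) + norm (\<sigma> N x)"
          by (metis add.commute norm_minus_commute norm_triangle_sub)
        then show ?thesis using N that bound[OF \<sigma>W that, of N] by (force simp: distrib_right)
      qed
    qed
    have "limitin M.mtopology \<sigma> \<phi> sequentially"
      unfolding M.limit_metric_sequentially
    proof (intro conjI allI impI \<phi>W)
      fix e :: real assume e: "e > 0"
      then obtain N where N: "\<forall>i\<ge>N. \<forall>x\<in>V. norm (\<sigma> i x - \<phi> x) \<le> e / 2 * p x"
        using near[of "e / 2"] by auto
      have "dual_norm p (\<sigma> i - \<phi>) \<le> e / 2" if "i \<ge> N" for i
        using N that e by (intro dual_norm_le[OF p]) auto
      then have "\<sigma> i \<in> dual_cs p \<and> norm_dist (dual_cs p) (dual_norm p) (\<sigma> i) \<phi> < e" if "i \<ge> N" for i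
        using that e \<sigma>W \<phi>W by (force simp: norm_dist_def)
      then show "\<exists>N. \<forall>n\<ge>N. \<sigma> n \<in> dual_cs p \<and> norm_dist (dual_cs p) (dual_norm p) (\<sigma> n) \<phi> < e" by blast
    qed
    then show ?thesis by blast
  qed
  then have "M.mcomplete" by (simp add: M.mcomplete_def)
  with nrm show ?thesis by (simp add: banach_on_def)
qed

lemma continuous_evaluation:
  assumes p: "cs p" and x: "x \<in> V"
  shows "continuous_map (norm_topology (dual_cs p) (dual_norm p)) euclidean (\<lambda>\<phi>. \<phi> x)"
proof -
  note nrm = normed_dual_cs[OF p]
  interpret M: Metric_space "dual_cs p" "norm_dist (dual_cs p) (dual_norm p)"
    by (rule Metric_space_norm_dist[OF nrm])
  have "continuous_map M.mtopology euclidean (\<lambda>\<phi>. \<phi> x)"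
    unfolding continuous_map_def M.topspace_mtopology
  proof (intro conjI allI impI)
    fix U :: "'k set" assume "openin euclidean U"
    then have U: "open U" by simp
    show "openin M.mtopology {\<phi> \<in> dual_cs p. \<phi> x \<in> U}"
      unfolding M.openin_mtopology
    proof (intro conjI allI impI)
      fix \<phi> assume "\<phi> \<in> {\<phi> \<in> dual_cs p. \<phi> x \<in> U}"
      then have \<phi>: "\<phi> \<in> dual_cs p" "\<phi> x \<in> U" by auto
      then obtain e where e: "e > 0" "ball (\<phi> x) e \<subseteq> U" using U open_contains_ball by metis
      have px: "p x + 1 > 0" using cs_nonneg[OF p x] by simp
      have "\<psi> \<in> {\<phi> \<in> dual_cs p. \<phi> x \<in> U}" if \<psi>: "\<psi> \<in> M.mball \<phi> (e / (p x + 1))" for \<psi>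
      proof -
        have W: "\<psi> \<in> dual_cs p" "dual_norm p (\<phi> - \<psi>) < e / (p x + 1)"
          using \<psi> by (auto simp: norm_dist_def)
        have "norm ((\<phi> - \<psi>) x) \<le> dual_norm p (\<phi> - \<psi>) * p x"
          by (rule dual_norm_bound[OF p normed_onD(4)[OF nrm \<phi>(1) W(1)] x])
        also have "\<dots> \<le> e / (p x + 1) * p x"
          using W(2) cs_nonneg[OF p x] by (intro mult_right_mono) auto
        also have "\<dots> < e" using e(1) px by (simp add: pos_divide_less_eq)
        finally have "\<psi> x \<in> ball (\<phi> x) e" by (simp add: dist_norm)
        then show ?thesis using e(2) W(1) by auto
      qed
      then show "\<exists>r>0. M.mball \<phi> r \<subseteq> {\<phi> \<in> dual_cs p. \<phi> x \<in> U}"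
        using e(1) px by (intro exI[of _ "e / (p x + 1)"]) auto
    qed auto
  qed auto
  then show ?thesis by (simp add: norm_topology_def)
qed

end

section \<open>Closed graph argument and uniform convergence on compact sets\<close>

context lc_basis_pair
begin

text \<open>The graph of \<open>R\<close> is the intersection over n of the closed conditions T_n(x)
  = e(g_n), because basis coefficients determine an element. So \<open>R\<close> is continuous on
  the Banach space of functionals dominated by \<open>p\<close>, hence bounded on its unit
  ball.\<close>

lemma BC_bounded:
  assumes BC: "BC_space s X" and R: "\<And>e. e \<in> dual sE E \<Longrightarrow> R e \<in> V \<and> (\<forall>n. T n (R e) = e (g n))"
    and p: "E.cs p"
  shows "bounded_in s X (R ` E.polar p)"
proof -
  let ?W = "E.dual_cs p" and ?n = "E.dual_norm p"
  note nrm = E.normed_dual_cs[OF p]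
  interpret M: Metric_space ?W "norm_dist ?W ?n"
    by (rule Metric_space_norm_dist[OF nrm])
  have Wd: "e \<in> dual sE E" if "e \<in> ?W" for e using that by (auto simp: E.dual_cs_def)
  have lin: "linear_map_on (pw (*)) s ?W R"
    unfolding linear_map_on_def
  proof (intro conjI ballI allI)
    show "R (e + e') = R e + R e'" if "e \<in> ?W" "e' \<in> ?W" for e e'
      using R[OF Wd[OF that(1)]] R[OF Wd[OF that(2)]] R[OF E.dual_add[OF Wd[OF that(1)] Wd[OF that(2)]]]
      by (intro T_inject) (auto simp: T_lin)
    show "R (pw (*) c e) = s c (R e)" if "e \<in> ?W" for c e
      using R[OF Wd[OF that]] R[OF E.dual_scale[OF Wd[OF that]], of c]
      by (intro T_inject) (auto simp: T_lin pw_def)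
  qed
  have RW: "R ` ?W \<subseteq> V" using R Wd by auto
  let ?X = "prod_topology (norm_topology ?W ?n) X"
  have tW: "topspace (norm_topology ?W ?n) = ?W" by (simp add: norm_topology_def)
  have "continuous_map ?X euclidean (\<lambda>z. T n (snd z) - fst z (g n))" for n
  proof (rule continuous_map_diff)
    have "continuous_map X euclidean (T n)" using T_dual[of n] by (simp add: dual_def cont_lin_def)
    from continuous_map_compose[OF continuous_map_snd this]
    show "continuous_map ?X euclidean (\<lambda>z. T n (snd z))" by (simp add: o_def)
    from continuous_map_compose[OF continuous_map_fst E.continuous_evaluation[OF p g_E[of n]]]
    show "continuous_map ?X euclidean (\<lambda>z. fst z (g n))" by (simp add: o_def)
  qed
  then have "closedin ?X {z \<in> topspace ?X. T n (snd z) - fst z (g n) \<in> {0}}" for n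
    by (rule closedin_continuous_map_preimage) simp
  then have "closedin ?X (\<Inter>n. {z \<in> topspace ?X. T n (snd z) - fst z (g n) \<in> {0}})"
    by (intro closedin_INT) auto
  also have "(\<Inter>n. {z \<in> topspace ?X. T n (snd z) - fst z (g n) \<in> {0}}) = (\<lambda>e. (e, R e)) ` ?W"
  proof (intro set_eqI iffI)
    fix z assume "z \<in> (\<Inter>n. {z \<in> topspace ?X. T n (snd z) - fst z (g n) \<in> {0}})"
    then have z: "fst z \<in> ?W" "snd z \<in> V" "\<And>n. T n (snd z) = fst z (g n)"
      by (auto simp: tW)
    have "snd z = R (fst z)" using z R[OF Wd[OF z(1)]] by (intro T_inject) auto
    then show "z \<in> (\<lambda>e. (e, R e)) ` ?W" using z(1) by (auto simp: image_iff prod_eq_iff)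
  next
    fix z assume "z \<in> (\<lambda>e. (e, R e)) ` ?W"
    then show "z \<in> (\<Inter>n. {z \<in> topspace ?X. T n (snd z) - fst z (g n) \<in> {0}})"
      using R Wd by (auto simp: tW)
  qed
  finally have clo: "closedin ?X ((\<lambda>e. (e, R e)) ` ?W)" .
  have cont: "continuous_map M.mtopology X R"
    using BC_space_closed_graph[OF BC E.banach_dual_cs[OF p] lin RW clo] by (simp add: norm_topology_def)
  show ?thesis
    unfolding bounded_in_cs
  proof (intro conjI allI impI)
    show "R ` E.polar p \<subseteq> V" using R by (auto simp: E.polar_def)
    fix q assume q: "cs q"
    have "openin X {x \<in> V. q (x - 0) < 1}" using q by (intro openin_cs_ball) auto
    from openin_continuous_map_preimage[OF cont this]
    have op: "openin M.mtopology {e \<in> ?W. q (R e) < 1}" using R Wd by (simp cong: conj_cong)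
    have 0: "0 \<in> ?W" by (rule normed_onD(2)[OF nrm])
    have "R 0 = 0" using lin 0 unfolding linear_map_on_def by (metis add_cancel_right_right)
    with 0 q have "0 \<in> {e \<in> ?W. q (R e) < 1}" by simp
    with op obtain r where r: "r > 0" "M.mball 0 r \<subseteq> {e \<in> ?W. q (R e) < 1}"
      unfolding M.openin_mtopology by blast
    have "q (R e) \<le> 2 / r" if e: "e \<in> E.polar p" for e
    proof -
      have eW: "e \<in> ?W" using e by (auto simp: E.polar_def E.dual_cs_def intro!: exI[of _ 1])
      have n1: "?n e \<le> 1" using e by (intro E.dual_norm_le[OF p]) (auto simp: E.polar_def)
      \<comment> \<open>Scaling by r / 2 moves the closed unit ball into the open ball of radius r,
        where q o R < 1; undoing it gives the bound 2 / r.\<close>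
      let ?e = "pw (*) (of_real (r / 2)) e"
      have eW': "?e \<in> ?W" by (rule normed_onD(5)[OF nrm eW])
      have "norm_dist ?W ?n 0 ?e = norm_dist ?W ?n ?e 0" by (rule M.commute)
      also have "\<dots> = ?n ?e" using eW' 0 by (simp add: norm_dist_def)
      also have "\<dots> = r / 2 * ?n e" using r(1) by (simp add: normed_onD(9)[OF nrm eW] norm_divide)
      also have "\<dots> \<le> r / 2" using r(1) n1 by simp
      also have "\<dots> < r" using r(1) by simp
      finally have "?e \<in> M.mball 0 r" using 0 eW' by simp
      then have "q (R ?e) < 1" using r(2) by blast
      moreover have "R ?e = s (of_real (r / 2)) (R e)" using lin eW by (simp add: linear_map_on_def)
      ultimately have "r / 2 * q (R e) < 1" using R[OF Wd[OF eW]] r(1) by (simp add: cs_scale[OF q] norm_divide)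
      then show ?thesis using r(1) by (simp add: field_simps)
    qed
    then show "\<exists>c. \<forall>x\<in>R ` E.polar p. q x \<le> c" by blast
  qed
qed

lemma compact_finite_net:
  assumes K: "compactin X K" and q: "cs q" and \<epsilon>: "(\<epsilon>::real) > 0"
  shows "\<exists>A. finite A \<and> A \<subseteq> V \<and> (\<forall>x\<in>K. \<exists>a\<in>A. q (x - a) \<le> \<epsilon>)"
proof -
  have KV: "K \<subseteq> V" using K by (rule compactin_subset_topspace)
  let ?B = "\<lambda>a. {x \<in> V. q (x - a) < \<epsilon>}"
  have "K \<subseteq> \<Union>(?B ` K)" using KV \<epsilon> q by auto
  moreover have "openin X U" if "U \<in> ?B ` K" for U using that openin_cs_ball[OF q] KV by blast
  ultimately have "\<exists>F. finite F \<and> F \<subseteq> ?B ` K \<and> K \<subseteq> \<Union>F"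
    by (intro compactinD[OF K])
  then obtain F where F: "finite F" "F \<subseteq> ?B ` K" "K \<subseteq> \<Union>F" by blast
  from finite_subset_image[OF F(1,2)] obtain A where A: "finite A" "A \<subseteq> K" "F = ?B ` A" by blast
  have "\<exists>a\<in>A. q (x - a) \<le> \<epsilon>" if x: "x \<in> K" for x
  proof -
    obtain a where "a \<in> A" "x \<in> ?B a" using x F(3) A(3) by blast
    then show ?thesis by (auto intro: less_imp_le)
  qed
  then show ?thesis using A KV by blast
qed

proposition interpolation_semi_montel_BC:
  assumes SM: "semi_montel s X" and BC: "BC_space s X" and SC: "seq_complete E"
    and R: "\<And>e. e \<in> dual sE E \<Longrightarrow> \<exists>h\<in>V. \<forall>n. T n h = e (g n)"
  obtains w where "w \<in> topspace (eps_product s X sE E)" "\<And>n. w (T n) = g n"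
proof -
  obtain R' where R': "\<And>e. e \<in> dual sE E \<Longrightarrow> R' e \<in> V \<and> (\<forall>n. T n (R' e) = e (g n))" using R by metis
  have bdd: "bounded_in s X (R' ` E.polar p)" if "E.cs p" for p
    by (rule BC_bounded[OF BC _ that]) (rule R')
  have conv: "\<exists>z. limitin E (\<lambda>k. u k y) z sequentially" if y: "y \<in> dual s X" for y
  proof -
    obtain q where q: "cs q" "y \<in> polar q" by (rule dual_in_polar[OF y])
    obtain q' where q': "cs q'" "\<And>k x. x \<in> V \<Longrightarrow> q (P k x) \<le> q' x" using P_equicontinuous[OF q(1)] by metis
    have "\<exists>N. \<forall>i\<ge>N. \<forall>j\<ge>N. p (u i y - u j y) < e" if p: "E.cs p" and e: "e > 0" for p and e :: real
    proof -
      \<comment> \<open>All R' \<phi> with \<phi> in the polar of \<open>p\<close> lie in this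
        compact set, so uniform convergence of the expansion operators on it makes \<open>N\<close>
        independent of the norming functional taken afterwards.\<close>
      let ?K = "polar_hull (R' ` E.polar p)"
      have K: "compactin X ?K" by (rule semi_montelD[OF SM bdd[OF p]])
      have "\<exists>N. \<forall>i\<ge>N. \<forall>j\<ge>N. \<forall>x\<in>?K. q (P i x - P j x) \<le> e / 2"
        by (rule P_uniform_Cauchy[OF q(1) q' compactin_subset_topspace[OF K] compact_finite_net[OF K q'(1)]])
          (use e in auto)
      then obtain N where N: "\<forall>i\<ge>N. \<forall>j\<ge>N. \<forall>x\<in>?K. q (P i x - P j x) \<le> e / 2" ..
      have "p (u i y - u j y) < e" if ij: "i \<ge> N" "j \<ge> N" for i j
      proof -
        obtain \<phi> where \<phi>: "\<phi> \<in> dual sE E" "\<And>x. x \<in> topspace E \<Longrightarrow> norm (\<phi> x) \<le> p x"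
          "norm (\<phi> (u i y - u j y)) = p (u i y - u j y)"
          using E.Hahn_Banach[OF p, of "u i y - u j y"] by auto
        have "R' ` E.polar p \<subseteq> V" using bdd[OF p] by (simp add: bounded_in_def)
        moreover have "R' \<phi> \<in> R' ` E.polar p" using \<phi> by (auto simp: E.polar_def)
        ultimately have RK: "R' \<phi> \<in> ?K" by (rule subsetD[OF polar_hull_superset])
        have "\<phi> (u i y - u j y) = y (P i (R' \<phi>) - P j (R' \<phi>))"
          using R'[OF \<phi>(1)] by (simp add: E.dualD[OF \<phi>(1)] dualD[OF y] dual_u[OF \<phi>(1) y, of "R' \<phi>"])
        moreover have "norm (y (P i (R' \<phi>) - P j (R' \<phi>))) \<le> q (P i (R' \<phi>) - P j (R' \<phi>))"
          using q(2) by (simp add: polar_def)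
        ultimately have "p (u i y - u j y) \<le> q (P i (R' \<phi>) - P j (R' \<phi>))"
          using \<phi>(3) by simp
        also have "\<dots> \<le> e / 2" using N ij RK by blast
        finally show ?thesis using e by simp
      qed
      then show ?thesis by blast
    qed
    then show ?thesis by (intro E.seq_completeD[OF SC u_E])
  qed
  show ?thesis by (rule eps_product_interpolation[OF SM conv R' bdd that])
qed

end

section \<open>Functoriality of the epsilon product\<close>

text \<open>Linearity of the inverse is checked by applying it to f (f' x + f' y); the hypothesis on
  \<open>X\<close> keeps the argument inside the carrier.\<close>

lemma tvs_iso_inverse:
  assumes f: "tvs_iso s1 X s2 Y f" and V: "\<And>x y c. x \<in> topspace X \<Longrightarrow> y \<in> topspace X \<Longrightarrow> x + y \<in> topspace X \<and> s1 c x \<in> topspace X"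
  obtains f' where "tvs_iso s2 Y s1 X f'" "\<And>x. x \<in> topspace X \<Longrightarrow> f' (f x) = x"
    "\<And>y. y \<in> topspace Y \<Longrightarrow> f (f' y) = y"
proof -
  obtain f' where m: "homeomorphic_maps X Y f f'"
    using f by (auto simp: tvs_iso_def homeomorphic_map_maps)
  then have inv: "\<And>x. x \<in> topspace X \<Longrightarrow> f' (f x) = x" "\<And>y. y \<in> topspace Y \<Longrightarrow> f (f' y) = y"
    and hom: "homeomorphic_map Y X f'"
    by (auto simp: homeomorphic_maps_map)
  have V': "f' y \<in> topspace X" if "y \<in> topspace Y" for y
    using homeomorphic_imp_surjective_map[OF hom] that by blast
  have lin: "f (x + y) = f x + f y" "f (s1 c x) = s2 c (f x)" if "x \<in> topspace X" "y \<in> topspace X" for x y c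
    using f that by (auto simp: tvs_iso_def linear_map_on_def)
  have "linear_map_on s2 s1 (topspace Y) f'"
    unfolding linear_map_on_def
  proof (intro conjI ballI allI)
    show "f' (x + y) = f' x + f' y" if "x \<in> topspace Y" "y \<in> topspace Y" for x y
      using inv(1)[of "f' x + f' y"] V[OF V'[OF that(1)] V'[OF that(2)]] that
      by (simp add: lin V' inv(2))
    show "f' (s2 c x) = s1 c (f' x)" if "x \<in> topspace Y" for c x
      using inv(1)[of "s1 c (f' x)"] V[OF V'[OF that] V'[OF that]] that
      by (simp add: lin(2)[OF V' V'] inv(2))
  qed
  then show ?thesis using that[of f'] hom inv by (simp add: tvs_iso_def)
qed

section \<open>Transposes and the induced maps on epsilon products\<close>

locale lc_map = X1: lc_space s1 X1 + X2: lc_space s2 X2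
  for s1 :: "'k::real_or_complex \<Rightarrow> 'a::ab_group_add \<Rightarrow> 'a" and X1
    and s2 :: "'k \<Rightarrow> 'b::ab_group_add \<Rightarrow> 'b" and X2 +
  fixes T :: "'a \<Rightarrow> 'b"
  assumes lin: "linear_map_on s1 s2 (topspace X1) T" and cont: "continuous_map X1 X2 T"
begin

lemma T_V [simp]: "x \<in> topspace X1 \<Longrightarrow> T x \<in> topspace X2"
  using cont by (auto simp: continuous_map_def)

lemma T_add: "x \<in> topspace X1 \<Longrightarrow> y \<in> topspace X1 \<Longrightarrow> T (x + y) = T x + T y"
  and T_scale: "x \<in> topspace X1 \<Longrightarrow> T (s1 c x) = s2 c (T x)"
  using lin by (auto simp: linear_map_on_def)

lemma T_zero [simp]: "T 0 = 0"
  using T_add[of 0 0] by simp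

lemma transposed_dual [simp]:
  assumes y: "y \<in> dual s2 X2" shows "transposed X1 T y \<in> dual s1 X1"
proof -
  have "continuous_map X2 euclidean y" using y by (simp add: dual_def cont_lin_def)
  from continuous_map_compose[OF cont this]
  have "continuous_map X1 euclidean (transposed X1 T y)"
    by (rule continuous_map_eq) (simp add: transposed_def)
  moreover have "linear_map_on s1 (*) (topspace X1) (transposed X1 T y)"
    unfolding linear_map_on_def
    by (auto simp: transposed_def T_add T_scale X2.dualD[OF y])
  ultimately show ?thesis by (auto simp: dual_def cont_lin_def transposed_def)
qed

lemma absolutely_convex_image:
  assumes "K \<subseteq> topspace X1" "absolutely_convex s1 K"
  shows "absolutely_convex s2 (T ` K)"
  unfolding absolutely_convex_def
proof (intro conjI ballI allI impI)
  show "T ` K \<noteq> {}" using assms by (simp add: absolutely_convex_def)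
  fix x y and a b :: 'k assume xy: "x \<in> T ` K" "y \<in> T ` K" and ab: "norm a + norm b \<le> 1"
  then obtain x' y' where x: "x' \<in> K" "x = T x'" "y' \<in> K" "y = T y'" by blast
  have "s1 a x' + s1 b y' \<in> K" using assms(2) x ab by (simp add: absolutely_convex_def)
  moreover have "x' \<in> topspace X1" "y' \<in> topspace X1" using x assms(1) by auto
  then have "s2 a x + s2 b y = T (s1 a x' + s1 b y')" using x by (simp add: T_add T_scale)
  ultimately show "s2 a x + s2 b y \<in> T ` K" by simp
qed

lemma equicontinuous_transposed:
  assumes H: "H \<subseteq> dual s2 X2" "equicontinuous X2 euclidean H"
  shows "equicontinuous X1 euclidean (transposed X1 T ` H)"
  unfolding equicontinuous_def
proof (intro allI impI)
  fix U :: "'k set" assume "zero_nhd euclidean U"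
  then obtain W where W: "zero_nhd X2 W" "\<forall>h\<in>H. h ` W \<subseteq> U"
    using H(2) unfolding equicontinuous_def by blast
  then obtain O' where O': "openin X2 O'" "0 \<in> O'" "O' \<subseteq> W" by (auto simp: zero_nhd_def)
  let ?O = "{x \<in> topspace X1. T x \<in> O'}"
  have "openin X1 ?O" using cont O'(1) by (rule openin_continuous_map_preimage)
  then have "zero_nhd X1 ?O" using O' by (auto simp: zero_nhd_def)
  moreover have "\<forall>h\<in>transposed X1 T ` H. h ` ?O \<subseteq> U"
    using W(2) O'(3) by (auto simp: transposed_def)
  ultimately show "\<exists>V. zero_nhd X1 V \<and> (\<forall>h\<in>transposed X1 T ` H. h ` V \<subseteq> U)" by blast
qed

lemma topspace_dual_kappa: "topspace (dual_kappa s X) = dual s X"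
  unfolding dual_kappa_def by (rule topspace_unif_topology) simp

text \<open>The transpose of y takes on K the values of y on T(K), and T(K) is again absolutely
  convex and compact; so uniform convergence on T(K) gives uniform convergence of the transposes on
  K.\<close>

lemma continuous_transposed:
  "continuous_map (dual_kappa s2 X2) (dual_kappa s1 X1) (transposed X1 T)"
  unfolding continuous_map_def topspace_dual_kappa
proof (intro conjI allI impI)
  fix W assume "openin (dual_kappa s1 X1) W"
  then have W: "unif_open (dual s1 X1) {K. absolutely_convex s1 K \<and> compactin X1 K} euclidean W"
    by (simp add: dual_kappa_def openin_unif_topology)
  show "openin (dual_kappa s2 X2) {y \<in> dual s2 X2. transposed X1 T y \<in> W}"
    unfolding dual_kappa_def openin_unif_topology unif_open_def
  proof (intro conjI ballI)
    fix y assume "y \<in> {y \<in> dual s2 X2. transposed X1 T y \<in> W}"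
    then have y: "y \<in> dual s2 X2" "transposed X1 T y \<in> W" by auto
    from W[unfolded unif_open_def, THEN conjunct2, rule_format, OF y(2)]
    obtain Q U where Q: "finite Q" "Q \<subseteq> {K. absolutely_convex s1 K \<and> compactin X1 K}"
      "zero_nhd euclidean U"
      "{v \<in> dual s1 X1. \<forall>M\<in>Q. \<forall>x\<in>M. v x - transposed X1 T y x \<in> U} \<subseteq> W"
      by (elim exE conjE)
    have KV: "K \<subseteq> topspace X1" if "K \<in> Q" for K using Q(2) that compactin_subset_topspace by blast
    have "absolutely_convex s2 (T ` K) \<and> compactin X2 (T ` K)" if "K \<in> Q" for K
      using Q(2) that absolutely_convex_image[OF KV[OF that]] image_compactin[OF _ cont, of K] by blast
    then have "(`) T ` Q \<subseteq> {K. absolutely_convex s2 K \<and> compactin X2 K}" by blast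
    moreover have "{v \<in> dual s2 X2. \<forall>M\<in>(`) T ` Q. \<forall>x\<in>M. v x - y x \<in> U} \<subseteq> {y \<in> dual s2 X2. transposed X1 T y \<in> W}"
    proof
      fix v assume "v \<in> {v \<in> dual s2 X2. \<forall>M\<in>(`) T ` Q. \<forall>x\<in>M. v x - y x \<in> U}"
      then have v: "v \<in> dual s2 X2" "\<And>K x. K \<in> Q \<Longrightarrow> x \<in> K \<Longrightarrow> v (T x) - y (T x) \<in> U" by auto
      have "transposed X1 T v x - transposed X1 T y x \<in> U" if "K \<in> Q" "x \<in> K" for K x
        using v(2)[OF that] subsetD[OF KV[OF that(1)] that(2)] by (simp add: transposed_def)
      then have "transposed X1 T v \<in> {v \<in> dual s1 X1. \<forall>M\<in>Q. \<forall>x\<in>M. v x - transposed X1 T y x \<in> U}"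
        using v(1) by simp
      then show "v \<in> {y \<in> dual s2 X2. transposed X1 T y \<in> W}" using Q(4) v(1) by blast
    qed
    ultimately show "\<exists>\<Q> U. finite \<Q> \<and> \<Q> \<subseteq> {K. absolutely_convex s2 K \<and> compactin X2 K} \<and> zero_nhd euclidean U \<and>
        {v \<in> dual s2 X2. \<forall>M\<in>\<Q>. \<forall>x\<in>M. v x - y x \<in> U} \<subseteq> {y \<in> dual s2 X2. transposed X1 T y \<in> W}"
      using Q(1,3) by (intro exI[of _ "(`) T ` Q"] exI[of _ U]) simp
  qed auto
qed simp

lemma transposed_add: "transposed X1 T (y + z) = transposed X1 T y + transposed X1 T z"
  for y z :: "'b \<Rightarrow> 'k"
  by (auto simp: transposed_def)

lemma transposed_scale: "transposed X1 T (pw (*) c y) = pw (*) c (transposed X1 T y)"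
  for y :: "'b \<Rightarrow> 'k"
  by (auto simp: transposed_def pw_def)

end

lemma topspace_eps_product:
  assumes "lc_space sE E"
  shows "topspace (eps_product s X sE E) = cont_lin (pw (*)) (dual_kappa s X) sE E"
proof -
  interpret lc_space sE E by fact
  show ?thesis unfolding eps_product_def by (rule topspace_unif_topology) simp
qed

context lc_map
begin

lemma eps_id_in:
  assumes E: "lc_space sE E" and u: "u \<in> topspace (eps_product s1 X1 sE E)"
  shows "eps_id X1 s2 X2 T u \<in> topspace (eps_product s2 X2 sE E)"
proof -
  have u: "linear_map_on (pw (*)) sE (dual s1 X1) u" "continuous_map (dual_kappa s1 X1) E u"
    using u by (auto simp: topspace_eps_product[OF E] cont_lin_def topspace_dual_kappa)
  from continuous_map_compose[OF continuous_transposed u(2)]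
  have "continuous_map (dual_kappa s2 X2) E (eps_id X1 s2 X2 T u)"
    by (rule continuous_map_eq) (simp add: eps_id_def topspace_dual_kappa)
  moreover have "linear_map_on (pw (*)) sE (dual s2 X2) (eps_id X1 s2 X2 T u)"
    using u(1) unfolding linear_map_on_def eps_id_def
    by (auto simp: X2.dual_add X2.dual_scale transposed_add transposed_scale)
  ultimately show ?thesis
    by (auto simp: topspace_eps_product[OF E] cont_lin_def topspace_dual_kappa eps_id_def)
qed

lemma linear_eps_id:
  fixes sE :: "'k \<Rightarrow> 'e::ab_group_add \<Rightarrow> 'e"
  assumes "lc_space sE E"
  shows "linear_map_on (pw sE) (pw sE) W (eps_id X1 s2 X2 T)"
proof -
  interpret lc_space sE E by fact
  show ?thesis by (auto simp: linear_map_on_def eps_id_def pw_def fun_eq_iff)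
qed

text \<open>The same pattern one level up: for an equicontinuous H in the dual of \<open>X2\<close>,
  uniform convergence of the images on H is uniform convergence on the set of transposes, which is
  equicontinuous on \<open>X1\<close>.\<close>

lemma continuous_eps_id:
  assumes E: "lc_space sE E"
  shows "continuous_map (eps_product s1 X1 sE E) (eps_product s2 X2 sE E) (eps_id X1 s2 X2 T)"
  unfolding continuous_map_def
proof (intro conjI allI impI)
  let ?L1 = "cont_lin (pw (*)) (dual_kappa s1 X1) sE E" and ?L2 = "cont_lin (pw (*)) (dual_kappa s2 X2) sE E"
  let ?H1 = "{H. H \<subseteq> dual s1 X1 \<and> equicontinuous X1 euclidean H}"
    and ?H2 = "{H. H \<subseteq> dual s2 X2 \<and> equicontinuous X2 euclidean H}"
  let ?A = "eps_id X1 s2 X2 T :: (('a \<Rightarrow> 'k) \<Rightarrow> _) \<Rightarrow> _"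
  have A: "?A u \<in> ?L2" if "u \<in> ?L1" for u
    using eps_id_in[OF E, of u] that by (simp add: topspace_eps_product[OF E])
  fix W assume "openin (eps_product s2 X2 sE E) W"
  then have W: "unif_open ?L2 ?H2 E W" by (simp add: eps_product_def openin_unif_topology)
  show "openin (eps_product s1 X1 sE E) {u \<in> topspace (eps_product s1 X1 sE E). ?A u \<in> W}"
    unfolding topspace_eps_product[OF E] unfolding eps_product_def openin_unif_topology unif_open_def
  proof (intro conjI ballI)
    fix u assume "u \<in> {u \<in> ?L1. ?A u \<in> W}"
    then have u: "u \<in> ?L1" "?A u \<in> W" by auto
    from W[unfolded unif_open_def, THEN conjunct2, rule_format, OF u(2)]
    obtain Q U where Q: "finite Q" "Q \<subseteq> ?H2" "zero_nhd E U"
      "{v \<in> ?L2. \<forall>M\<in>Q. \<forall>x\<in>M. v x - ?A u x \<in> U} \<subseteq> W"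
      by (elim exE conjE)
    have HD: "H \<subseteq> dual s2 X2" if "H \<in> Q" for H using Q(2) that by blast
    have "(`) (transposed X1 T) ` Q \<subseteq> ?H1"
      using Q(2) equicontinuous_transposed by (auto simp: subset_iff)
    moreover have "{v \<in> ?L1. \<forall>M\<in>(`) (transposed X1 T) ` Q. \<forall>x\<in>M. v x - u x \<in> U} \<subseteq> {u \<in> ?L1. ?A u \<in> W}"
    proof
      fix v assume "v \<in> {v \<in> ?L1. \<forall>M\<in>(`) (transposed X1 T) ` Q. \<forall>x\<in>M. v x - u x \<in> U}"
      then have v: "v \<in> ?L1" "\<And>H y. H \<in> Q \<Longrightarrow> y \<in> H \<Longrightarrow> v (transposed X1 T y) - u (transposed X1 T y) \<in> U"
        by auto
      have "?A v y - ?A u y \<in> U" if "H \<in> Q" "y \<in> H" for H y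
        using v(2)[OF that] HD that by (auto simp: eps_id_def)
      then have "?A v \<in> {v \<in> ?L2. \<forall>M\<in>Q. \<forall>x\<in>M. v x - ?A u x \<in> U}" using A[OF v(1)] by blast
      then show "v \<in> {u \<in> ?L1. ?A u \<in> W}" using Q(4) v(1) by blast
    qed
    ultimately show "\<exists>\<Q> U. finite \<Q> \<and> \<Q> \<subseteq> ?H1 \<and> zero_nhd E U \<and>
        {v \<in> ?L1. \<forall>M\<in>\<Q>. \<forall>x\<in>M. v x - u x \<in> U} \<subseteq> {u \<in> ?L1. ?A u \<in> W}"
      using Q(1,3) by (intro exI[of _ "(`) (transposed X1 T) ` Q"] exI[of _ U] conjI) simp_all
  qed auto
qed (use eps_id_in[OF E] in auto)

text \<open>The transposes of \<open>T\<close> and \<open>T'\<close> cancel. Equality holds as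
  functions on the whole type because functionals and members of the epsilon product vanish off
  their domains.\<close>

lemma eps_id_inverse:
  assumes E: "lc_space sE E" and T': "\<And>x. x \<in> topspace X1 \<Longrightarrow> T' (T x) = x"
    and lc: "lc_map s2 X2 s1 X1 T'"
    and u: "u \<in> topspace (eps_product s1 X1 sE E)"
  shows "eps_id X2 s1 X1 T' (eps_id X1 s2 X2 T u) = u"
proof
  interpret T': lc_map s2 X2 s1 X1 T' by fact
  fix y
  show "eps_id X2 s1 X1 T' (eps_id X1 s2 X2 T u) y = u y"
  proof (cases "y \<in> dual s1 X1")
    case True
    have "transposed X1 T (transposed X2 T' y) = y"
      using X1.dualD(5)[OF True] T' by (auto simp: transposed_def fun_eq_iff)
    then show ?thesis using True by (simp add: eps_id_def)
  next
    case False
    then show ?thesis using u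
      by (simp add: eps_id_def topspace_eps_product[OF E] cont_lin_def topspace_dual_kappa)
  qed
qed

end

lemma tvs_iso_eps_id:
  assumes X1: "lc_space s1 X1" and X2: "lc_space s2 X2" and E: "lc_space sE E"
    and T: "tvs_iso s1 X1 s2 X2 T"
  shows "tvs_iso (pw sE) (eps_product s1 X1 sE E) (pw sE) (eps_product s2 X2 sE E) (eps_id X1 s2 X2 T)"
proof -
  interpret X1: lc_space s1 X1 by fact
  interpret X2: lc_space s2 X2 by fact
  obtain T' where T': "tvs_iso s2 X2 s1 X1 T'" "\<And>x. x \<in> topspace X1 \<Longrightarrow> T' (T x) = x"
    "\<And>y. y \<in> topspace X2 \<Longrightarrow> T (T' y) = y"
    using tvs_iso_inverse[OF T] by (metis X1.V_closed(2,4))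
  interpret T: lc_map s1 X1 s2 X2 T
    using T by unfold_locales (auto simp: tvs_iso_def homeomorphic_imp_continuous_map)
  interpret T': lc_map s2 X2 s1 X1 T'
    using T'(1) by unfold_locales (auto simp: tvs_iso_def homeomorphic_imp_continuous_map)
  have "homeomorphic_maps (eps_product s1 X1 sE E) (eps_product s2 X2 sE E)
      (eps_id X1 s2 X2 T) (eps_id X2 s1 X1 T')"
    unfolding homeomorphic_maps_def
    using T.continuous_eps_id[OF E] T'.continuous_eps_id[OF E]
      T.eps_id_inverse[OF E T'(2) T'.lc_map_axioms] T'.eps_id_inverse[OF E T'(3) T.lc_map_axioms]
    by blast
  then show ?thesis
    using T.linear_eps_id[OF E] by (simp add: tvs_iso_def homeomorphic_maps_imp_map)
qed

lemma tvs_iso_into_imp_tvs_iso: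
  assumes "tvs_iso_into s1 X s2 Y f" "f ` topspace X = topspace Y"
  shows "tvs_iso s1 X s2 Y f"
  using assms by (simp add: tvs_iso_into_def tvs_iso_def embedding_map_def)

theorem theorem5p7p1:
  fixes sE :: "'k::real_or_complex \<Rightarrow> 'e::ab_group_add \<Rightarrow> 'e"
    and E :: "'e topology"
    and G :: "('e \<Rightarrow> 'k) set"
    and F :: "('x \<Rightarrow> 'k) topology" and FE :: "('x \<Rightarrow> 'e) topology"
    and l :: "(nat \<Rightarrow> 'k) topology" and lE :: "(nat \<Rightarrow> 'e) topology"
    and f :: "nat \<Rightarrow> 'x \<Rightarrow> 'k"
    and TK :: "nat \<Rightarrow> ('x \<Rightarrow> 'k) \<Rightarrow> 'k"
    and TE :: "nat \<Rightarrow> ('x \<Rightarrow> 'e) \<Rightarrow> 'e"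
  assumes "lcHs sE E" and "locally_complete sE E"
    and "G \<subseteq> dual sE E" and "module.subspace (pw (*)) G" and "determines_boundedness sE E G"
    and "eps_into_compatible sE E F FE"
    and "eps_into_compatible sE E l lE"
    and "\<forall>e'\<in>dual sE E. \<forall>g\<in>topspace lE. e' \<circ> g \<in> topspace l"
    and "equicontinuous_schauder_basis (pw (*)) F f TK"
    and "tvs_iso (pw (*)) F (pw (*)) l (\<lambda>g n. TK n g)"
    and "consistent sE E F FE TE TK" and "strong sE E F FE TE TK"
    and "(frechet_space (pw (*)) F \<and> schwartz_space (pw (*)) F) \<or>
         (seq_complete E \<and> G = dual sE E \<and> semi_montel (pw (*)) F \<and> BC_space (pw (*)) F)"
  shows "F_G E F TK G = topspace lE \<and>
    eps_compatible sE E l lE \<and>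
    tvs_isomorphic (pw sE) (eps_product (pw (*)) l sE E) (pw sE) lE \<and>
    tvs_iso (pw sE) FE (pw sE) lE (\<lambda>g n. TE n g) \<and>
    eps_compatible sE E F FE \<and>
    tvs_isomorphic (pw sE) (eps_product (pw (*)) F sE E) (pw sE) FE \<and>
    (\<forall>g\<in>topspace FE.
           (\<lambda>n. TE n g) =
           (S_map l \<circ> eps_id F (pw (*)) l (\<lambda>h n. TK n h) \<circ>
              inv_into (topspace (eps_product (pw (*)) F sE E)) (S_map F)) g)"
proof -
  note E = assms(1)
  have lcE: "lc_space sE E" by unfold_locales (rule E)
  have fsF: "function_spaces sE E F FE" and intoF: "tvs_iso_into (pw sE) (eps_product (pw (*)) F sE E) (pw sE) FE (S_map F)"
    using assms(6) by (auto simp: eps_into_compatible_def)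
  have fsl: "function_spaces sE E l lE" and intol: "tvs_iso_into (pw sE) (eps_product (pw (*)) l sE E) (pw sE) lE (S_map l)"
    using assms(7) by (auto simp: eps_into_compatible_def)
  have lcF: "lc_space (pw (*)) F" and lcl: "lc_space (pw (*)) l"
    using fsF fsl by (auto simp: function_spaces_def lc_space_def)
  interpret E: lc_space sE E by (rule lcE)
  interpret F: lc_basis "pw (*)" F f TK
    using lcF assms(9) by (simp add: lc_basis_def lc_basis_axioms_def)
  define tT where "tT = (\<lambda>g n. TK n g)"
  have T: "tvs_iso (pw (*)) F (pw (*)) l tT" using assms(10) by (simp add: tT_def)
  then have surjT: "tT ` topspace F = topspace l"
    by (auto simp: tvs_iso_def dest: homeomorphic_imp_surjective_map)
  define A :: "((('x \<Rightarrow> 'k) \<Rightarrow> 'k) \<Rightarrow> 'e) \<Rightarrow> ((nat \<Rightarrow> 'k) \<Rightarrow> 'k) \<Rightarrow> 'e"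
    where "A = eps_id F (pw (*)) l tT"
  let ?eF = "eps_product (pw (*)) F sE E" and ?el = "eps_product (pw (*)) l sE E"
  have A: "tvs_iso (pw sE) ?eF (pw sE) ?el A"
    unfolding A_def by (rule tvs_iso_eps_id[OF lcF lcl lcE T])
  then have A_in: "A w \<in> topspace ?el" if "w \<in> topspace ?eF" for w
    using that by (auto simp: tvs_iso_def dest: homeomorphic_imp_surjective_map)
  have interpolation: "\<exists>w\<in>topspace ?eF. \<forall>n. w (TK n) = g n" if g: "g \<in> F_G E F TK G" for g
  proof -
    interpret p: lc_basis_pair "pw (*)" F f TK sE E g
      using g by unfold_locales (auto simp: F_G_def)
    have R: "\<exists>h\<in>topspace F. \<forall>n. TK n h = e (g n)" if "e \<in> G" for e
      using g that by (auto simp: F_G_def)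
    from assms(13) show ?thesis
    proof
      assume FS: "frechet_space (pw (*)) F \<and> schwartz_space (pw (*)) F"
      obtain w where "w \<in> topspace ?eF" "\<And>n. w (TK n) = g n"
        using p.interpolation_frechet_schwartz[OF _ _ assms(2,3,5) R] FS by metis
      then show ?thesis by blast
    next
      assume *: "seq_complete E \<and> G = dual sE E \<and> semi_montel (pw (*)) F \<and> BC_space (pw (*)) F"
      then have R': "\<exists>h\<in>topspace F. \<forall>n. TK n h = e (g n)" if "e \<in> dual sE E" for e
        using R that by simp
      obtain w where "w \<in> topspace ?eF" "\<And>n. w (TK n) = g n"
        using p.interpolation_semi_montel_BC[OF _ _ _ R'] * by metis
      then show ?thesis by blast
    qed
  qed
  \<comment> \<open>The transpose of \<open>tT\<close> sends the evaluation at n on l(N) to T_n.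
    Both vanish off the carrier of \<open>F\<close>, so this is an equality of functions.\<close>
  have SA: "S_map l (A w) = (\<lambda>n. w (TK n))" for w
  proof
    fix n
    have "delta l n \<in> dual (pw (*)) l" using fsl by (simp add: function_spaces_def)
    moreover have "transposed F tT (delta l n) = TK n"
      using surjT F.T_lin(5)[of _ n] by (auto simp: transposed_def delta_def tT_def fun_eq_iff)
    ultimately show "S_map l (A w) n = w (TK n)" by (simp add: S_map_def A_def eps_id_def)
  qed
  have E_range: "h x \<in> topspace E" if "h \<in> topspace FE" for h x
    using fsF that by (auto simp: function_spaces_def)
  have TE_E: "TE n h \<in> topspace E" if "h \<in> topspace FE" for h n
    using assms(11) that by (auto simp: consistent_def)
  have S_TE: "S_map F w \<in> topspace FE" "TE n (S_map F w) = w (TK n)" if "w \<in> topspace ?eF" for w n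
    using assms(11) that by (auto simp: consistent_def)
  have strong: "e \<circ> h \<in> topspace F" "TK n (e \<circ> h) = e (TE n h)"
    if "e \<in> dual sE E" "h \<in> topspace FE" for e h n
    using assms(12) that by (auto simp: strong_def)

  \<comment> \<open>Composites e' o g lie in l(N) by hypothesis, and surjectivity of
    \<open>tT\<close> turns them into elements of F with coefficients e'(g(n)).\<close>
  have l_sub: "topspace lE \<subseteq> F_G E F TK G"
  proof
    fix g assume g: "g \<in> topspace lE"
    have "\<exists>h\<in>topspace F. \<forall>n. TK n h = e (g n)" if "e \<in> G" for e
    proof -
      have "e \<circ> g \<in> tT ` topspace F" using assms(3,8) that g surjT by blast
      then obtain h where "h \<in> topspace F" "e \<circ> g = tT h" by blast
      then show ?thesis by (auto simp: tT_def fun_eq_iff intro!: bexI[of _ h])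
    qed
    moreover have "range g \<subseteq> topspace E" using g fsl by (simp add: function_spaces_def)
    ultimately show "g \<in> F_G E F TK G" by (simp add: F_G_def)
  qed
  have F_sub: "F_G E F TK G \<subseteq> S_map l ` topspace ?el"
  proof
    fix g assume "g \<in> F_G E F TK G"
    then obtain w where w: "w \<in> topspace ?eF" "\<forall>n. w (TK n) = g n" using interpolation by blast
    then have "g = S_map l (A w)" by (simp add: SA fun_eq_iff)
    then show "g \<in> S_map l ` topspace ?el" using A_in w by blast
  qed
  have S_sub: "S_map l ` topspace ?el \<subseteq> topspace lE" using intol by (simp add: tvs_iso_into_def)
  \<comment> \<open>The three inclusions form a cycle, which gives this equality and surjectivity of
    \<open>S_map l\<close> together.\<close>
  have a: "F_G E F TK G = topspace lE" using l_sub F_sub S_sub by blast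
  have isol: "tvs_iso (pw sE) ?el (pw sE) lE (S_map l)"
    using tvs_iso_into_imp_tvs_iso[OF intol] l_sub F_sub S_sub by blast

  have surjS: "\<exists>w\<in>topspace ?eF. S_map F w = h" if h: "h \<in> topspace FE" for h
  proof -
    have "\<exists>k\<in>topspace F. \<forall>n. TK n k = e (TE n h)" if "e \<in> G" for e
      using strong[OF _ h, of e] assms(3) that by (intro bexI[of _ "e \<circ> h"]) auto
    then have "(\<lambda>n. TE n h) \<in> F_G E F TK G" using TE_E[OF h] by (auto simp: F_G_def)
    then obtain w where w: "w \<in> topspace ?eF" "\<forall>n. w (TK n) = TE n h" using interpolation by blast
    have "S_map F w x = h x" for x
    proof (rule E.dual_separates)
      fix e assume e: "e \<in> dual sE E"
      \<comment> \<open>Strongness and consistency give both scalar functions the coefficients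
        e(T^E_n(h)), so \<open>F.T_inject\<close> identifies them.\<close>
      have "e \<circ> S_map F w = e \<circ> h"
        using strong[OF e h] strong[OF e S_TE(1)[OF w(1)]] w by (intro F.T_inject) (auto simp: S_TE)
      then show "e (S_map F w x) = e (h x)" by (auto simp: fun_eq_iff)
    qed (use E_range h S_TE(1)[OF w(1)] in auto)
    then show ?thesis using w(1) by (auto simp: fun_eq_iff intro!: bexI[of _ w])
  qed
  have isoF: "tvs_iso (pw sE) ?eF (pw sE) FE (S_map F)"
    using S_TE(1) surjS by (intro tvs_iso_into_imp_tvs_iso[OF intoF]) blast
  then have homF: "homeomorphic_map ?eF FE (S_map F)" by (simp add: tvs_iso_def)
  then obtain S' where "homeomorphic_maps ?eF FE (S_map F) S'" by (auto simp: homeomorphic_map_maps)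
  then have S': "homeomorphic_map FE ?eF S'" "\<And>h. h \<in> topspace FE \<Longrightarrow> S_map F (S' h) = h"
    by (auto simp: homeomorphic_maps_map)
  let ?inv = "inv_into (topspace ?eF) (S_map F)"
  have S'_in: "S' h \<in> topspace ?eF" if "h \<in> topspace FE" for h
    using homeomorphic_imp_surjective_map[OF S'(1)] that by blast
  \<comment> \<open>On the carrier of \<open>FE\<close>, where the formula is claimed,
    \<open>inv_into\<close> is the inverse \<open>S'\<close> of the homeomorphism.\<close>
  have inv: "?inv h = S' h" if "h \<in> topspace FE" for h
    using inv_into_f_f[OF homeomorphic_imp_injective_map[OF homF] S'_in[OF that]] S'(2)[OF that] by simp
  have TE: "(\<lambda>n. TE n h) = S_map l (A (S' h))" if h: "h \<in> topspace FE" for h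
    using S_TE(2)[OF S'_in[OF h]] by (simp add: SA S'(2)[OF h])
  \<comment> \<open>Continuity of T^E is nowhere assumed; it is inherited from this composite of
    three isomorphisms, with which it agrees on the carrier of \<open>FE\<close>.\<close>
  have "homeomorphic_map FE lE (S_map l \<circ> (A \<circ> S'))"
    using S'(1) A isol by (intro homeomorphic_map_compose) (auto simp: tvs_iso_def)
  then have "homeomorphic_map FE lE (\<lambda>h n. TE n h)"
    by (rule homeomorphic_map_eq) (simp add: TE)
  moreover have "linear_map_on (pw sE) (pw sE) (topspace FE) (\<lambda>h n. TE n h)"
    using assms(11) by (auto simp: consistent_def linear_map_on_def pw_def fun_eq_iff)
  ultimately have isoTE: "tvs_iso (pw sE) FE (pw sE) lE (\<lambda>g n. TE n g)" by (simp add: tvs_iso_def)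
  have formula: "(\<lambda>n. TE n g) = (S_map l \<circ> eps_id F (pw (*)) l (\<lambda>h n. TK n h) \<circ> ?inv) g"
    if "g \<in> topspace FE" for g
    using TE[OF that] inv[OF that] by (simp add: A_def tT_def)
  have "eps_compatible sE E l lE" "eps_compatible sE E F FE"
    using fsl fsF isol isoF by (simp_all add: eps_compatible_def)
  moreover have "tvs_isomorphic (pw sE) ?el (pw sE) lE" "tvs_isomorphic (pw sE) ?eF (pw sE) FE"
    using isol isoF by (auto simp: tvs_isomorphic_def)
  ultimately show ?thesis
    using a isoTE formula by blast
qed

end
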